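(* $(UGQSym,\cdot,\Delta)$ is a Hopf algebra over $\mathbb{K}$. Moreover, it is filtered (as a Hopf algebra) by the number of edges, and also by the number of nodes: writing $F_k$ for the span of the $\mathcal{M}_G$ with $G$ having at most $k$ edges (respectively, at most $k$ nodes), one has $F_k\cdot F_l\subset F_{k+l}$, $\Delta(F_k)\subset\sum_{i=0}^{k}F_i\otimes F_{k-i}$, and $F_k$ is stable under the antipode, for all $k,l\ge 0$.
   Context: Graphs are finite, undirected, without loops or multiple edges. $\mathbb{K}$ is a field of characteristic $0$. Ambient algebra: $\mathbb{K}[x_{ij}\mid i<j,\ x_{ij}^2=x_{ij}]$ denotes the commutative algebra of formal, possibly infinite, $\mathbb{K}$-linear combinations of squarefree monomials $x_E:=\prod_{(i,j)\in E}x_{ij}$, where $E$ ranges over the finite sets of pairs $(i,j)$ of integers with $0<i<j$, with multiplication $x_A\cdot x_B=x_{A\cup B}$ extended to infinite combinations. Action: for $\sigma \in \mathfrak{S}_n$ and $1\le i<j\le n$, $\sigma\cdot(i,j) := (\min(\sigma(i),\sigma(j)),\max(\sigma(i),\sigma(j)))$. Definition of $\mathcal{M}_G$: let $G$ be a graph on $n\ge 2$ vertices without isolated vertex. Choose any labeling of the vertices of $G$ by $1,\dots,n$ and let $a_{ij}\in\{0,1\}$ ($1\le i<j\le n$) be $1$ if and only if $i$ and $j$ are adjacent. Let $R\subset\mathfrak{S}_n$ be a set of permutations such that the families $(a_{\sigma\cdot(i,j)})_{1\le i<j\le n}$, $\sigma\in R$, are pairwise distinct and exhaust all the families obtained for $\sigma\in\mathfrak{S}_n$.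 Then $$\mathcal{M}_G := \sum_{0<r_1<\dots<r_n}\ \sum_{\sigma\in R}\ \prod_{1\le i<j\le n} x_{r_i r_j}^{a_{\sigma\cdot(i,j)}} .$$ By convention the one-vertex graph $\bullet$ counts as a graph without isolated vertex, and $\mathcal{M}_\bullet:=1$. In the filtration by nodes, $\bullet$ (the unit) is counted as having $0$ nodes. $UGQSym$ is the $\mathbb{K}$-linear span of all $\mathcal{M}_G$, $G$ a finite graph without isolated vertex, inside this ambient algebra; it is a subalgebra, and the $\mathcal{M}_G$ (one for each isomorphism class) form a linear basis. Coproduct: $\Delta$ is the linear map defined on the basis by $$\Delta(\mathcal{M}_G):=\sum_{(G',G'')}\mathcal{M}_{G'}\otimes\mathcal{M}_{G''},$$ where the sum runs over all ordered pairs $(G',G'')$ of isomorphism classes of graphs without isolated vertex whose disjoint union is isomorphic to $G$, each pair counted once; here $\bullet$ is treated as the neutral element for disjoint union, so the pairs $(G,\bullet)$ and $(\bullet,G)$ occur. The counit is the linear map with $\varepsilon(\mathcal{M}_\bullet)=1$ and $\varepsilon(\mathcal{M}_G)=0$ for every other $G$. *)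

theory Defs
  imports Complex_Main "HOL-Library.Function_Algebras" "HOL-Library.FuncSet"
    "HOL-Combinatorics.Permutations"
begin

section \<open>Vector spaces of scalar-valued functions and their tensor products\<close>

text \<open>
  All vector spaces below are subspaces \<open>U\<close> of a function space \<open>'x \<Rightarrow> 'k\<close> over a field \<open>'k\<close>
  (addition is pointwise, from \<^theory>\<open>HOL-Library.Function_Algebras\<close>).  Every vector space is
  isomorphic to one of this form.
\<close>

definition fscale :: "'k::field \<Rightarrow> ('x \<Rightarrow> 'k) \<Rightarrow> ('x \<Rightarrow> 'k)"
  where "fscale c f = (\<lambda>x. c * f x)"

global_interpretation fs: vector_space fscale
  by unfold_locales (auto simp: fscale_def fun_eq_iff algebra_simps)

definition linear_on :: "('k::field \<Rightarrow> 'w::ab_group_add \<Rightarrow> 'w) \<Rightarrow> ('x \<Rightarrow> 'k) set \<Rightarrow> (('x \<Rightarrow> 'k) \<Rightarrow> 'w) \<Rightarrow> bool"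
  where "linear_on s U f \<longleftrightarrow>
    (\<forall>u\<in>U. \<forall>v\<in>U. f (u + v) = f u + f v) \<and> (\<forall>c. \<forall>u\<in>U. f (fscale c u) = s c (f u))"

definition bilinear_on :: "('k::field \<Rightarrow> 'w::ab_group_add \<Rightarrow> 'w) \<Rightarrow> ('x \<Rightarrow> 'k) set \<Rightarrow> ('y \<Rightarrow> 'k) set \<Rightarrow>
    (('x \<Rightarrow> 'k) \<Rightarrow> ('y \<Rightarrow> 'k) \<Rightarrow> 'w) \<Rightarrow> bool"
  where "bilinear_on s U V \<beta> \<longleftrightarrow>
    (\<forall>u\<in>U. linear_on s V (\<lambda>v. \<beta> u v)) \<and> (\<forall>v\<in>V. linear_on s U (\<lambda>u. \<beta> u v))"

text \<open>
  Over a field, the canonical map from the tensor product of \<open>U\<close> and \<open>V\<close>, with \<open>U\<close> a space of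
  functions on \<open>'x\<close> and \<open>V\<close> a space of functions on \<open>'y\<close>, to the functions on \<open>'x \<times> 'y\<close>
  is injective; the tensor product is realized as its image.  The universal property is proved in
  \<open>tensor_universal\<close> below.
\<close>

definition tensor :: "('x \<Rightarrow> 'k::field) \<Rightarrow> ('y \<Rightarrow> 'k) \<Rightarrow> ('x \<times> 'y \<Rightarrow> 'k)"  (infixr "\<otimes>" 75)
  where "u \<otimes> v = (\<lambda>(x, y). u x * v y)"

definition tensor_space :: "('x \<Rightarrow> 'k::field) set \<Rightarrow> ('y \<Rightarrow> 'k) set \<Rightarrow> ('x \<times> 'y \<Rightarrow> 'k) set"
  where "tensor_space U V = fs.span {u \<otimes> v | u v. u \<in> U \<and> v \<in> V}"

text \<open>
  The linear map on the tensor product of \<open>U\<close> and \<open>V\<close> with \<open>u \<otimes> v \<mapsto> \<beta> u v\<close>, for \<open>\<beta>\<close> bilinear.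
\<close>

definition tensor_lift :: "('x \<Rightarrow> 'k::field) set \<Rightarrow> ('y \<Rightarrow> 'k) set \<Rightarrow>
    (('x \<Rightarrow> 'k) \<Rightarrow> ('y \<Rightarrow> 'k) \<Rightarrow> 'w::ab_group_add) \<Rightarrow> ('x \<times> 'y \<Rightarrow> 'k) \<Rightarrow> 'w"
  where "tensor_lift U V \<beta> t = (THE w. \<exists>ps. set ps \<subseteq> U \<times> V \<and>
    t = (\<Sum>(u, v)\<leftarrow>ps. u \<otimes> v) \<and> w = (\<Sum>(u, v)\<leftarrow>ps. \<beta> u v))"

definition tensor_assoc :: "(('x \<times> 'y) \<times> 'z \<Rightarrow> 'k) \<Rightarrow> ('x \<times> 'y \<times> 'z \<Rightarrow> 'k)"
  where "tensor_assoc t = (\<lambda>(x, y, z). t ((x, y), z))"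

lemma tensor_assoc_tensor: "tensor_assoc ((u \<otimes> v) \<otimes> w) = u \<otimes> (v \<otimes> w)"
  by (auto simp: tensor_assoc_def tensor_def fun_eq_iff)

lemma sum_list_fun_apply: "(\<Sum>a\<leftarrow>as. f a) x = (\<Sum>a\<leftarrow>as. f a x)"
  for f :: "'a \<Rightarrow> 'x \<Rightarrow> 'k::field"
  by (induction as) auto

lemma sum_fun_apply': "(\<Sum>a\<in>A. f a) x = (\<Sum>a\<in>A. f a x)"
  for f :: "'a \<Rightarrow> 'x \<Rightarrow> 'k::field"
  by (induction A rule: infinite_finite_induct) auto

lemma linear_on_zero:
  assumes "vector_space s" "fs.subspace U" "linear_on s U f"
  shows "f 0 = 0"
proof -
  interpret vector_space s by fact
  have "0 \<in> U" using assms(2) by (rule fs.subspace_0)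
  then have "f (fscale 0 0) = s 0 (f 0)" using assms(3) unfolding linear_on_def by blast
  then show ?thesis by (metis fs.scale_zero_left scale_zero_left)
qed

lemma linear_on_sum:
  assumes "vector_space s" "fs.subspace U" "linear_on s U f" "finite A" "\<And>a. a \<in> A \<Longrightarrow> g a \<in> U"
  shows "f (\<Sum>a\<in>A. fscale (c a) (g a)) = (\<Sum>a\<in>A. s (c a) (f (g a)))"
  using assms(4,5)
proof (induction A rule: finite_induct)
  case empty
  then show ?case using linear_on_zero[OF assms(1-3)] by (simp del: zero_fun_apply)
next
  case (insert a A)
  have "(\<Sum>a\<in>A. fscale (c a) (g a)) \<in> U"
    using insert.prems by (intro fs.subspace_sum[OF assms(2)] fs.subspace_scale[OF assms(2)]) auto
  moreover have "fscale (c a) (g a) \<in> U" "g a \<in> U"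
    using insert.prems by (auto intro: fs.subspace_scale[OF assms(2)])
  ultimately show ?case
    using insert assms(3) by (simp add: linear_on_def del: plus_fun_apply)
qed

lemma linear_on_sum_list:
  assumes "vector_space s" "fs.subspace U" "linear_on s U f" "\<And>a. a \<in> set as \<Longrightarrow> g a \<in> U"
  shows "f (\<Sum>a\<leftarrow>as. fscale (c a) (g a)) = (\<Sum>a\<leftarrow>as. s (c a) (f (g a)))"
    and "(\<Sum>a\<leftarrow>as. fscale (c a) (g a)) \<in> U"
proof -
  have "f (\<Sum>a\<leftarrow>as. fscale (c a) (g a)) = (\<Sum>a\<leftarrow>as. s (c a) (f (g a))) \<and>
    (\<Sum>a\<leftarrow>as. fscale (c a) (g a)) \<in> U"
    using assms(4)
  proof (induction as)
    case Nil
    then show ?case using linear_on_zero[OF assms(1-3)] fs.subspace_0[OF assms(2)] by (simp del: zero_fun_apply)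
  next
    case (Cons a as)
    moreover have "fscale (c a) (g a) \<in> U" "g a \<in> U"
      using Cons.prems by (auto intro: fs.subspace_scale[OF assms(2)])
    ultimately show ?case
      using assms(3) by (simp add: linear_on_def fs.subspace_add[OF assms(2)] del: plus_fun_apply)
  qed
  then show "f (\<Sum>a\<leftarrow>as. fscale (c a) (g a)) = (\<Sum>a\<leftarrow>as. s (c a) (f (g a)))"
    and "(\<Sum>a\<leftarrow>as. fscale (c a) (g a)) \<in> U" by auto
qed

lemma tensor_relation:
  fixes U :: "('x \<Rightarrow> 'k::field) set" and V :: "('y \<Rightarrow> 'k) set"
  assumes s: "vector_space s" and U: "fs.subspace U" and V: "fs.subspace V"
    and \<beta>: "bilinear_on s U V \<beta>" and ps: "set ps \<subseteq> U \<times> V"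
    and zero: "(\<Sum>(u, v)\<leftarrow>ps. u \<otimes> v) = 0"
  shows "(\<Sum>(u, v)\<leftarrow>ps. \<beta> u v) = 0"
proof -
  interpret vector_space s by fact
  obtain B where B: "B \<subseteq> snd ` set ps" "fs.independent B" "snd ` set ps \<subseteq> fs.span B"
    by (rule fs.maximal_independent_subset)
  have fin: "finite B" using B(1) finite_subset by blast
  have BV: "B \<subseteq> V" using B(1) ps by force
  define r where "r p b = fs.representation B (snd p) b" for p :: "('x \<Rightarrow> 'k) \<times> ('y \<Rightarrow> 'k)" and b
  have rep: "snd p = (\<Sum>b\<in>B. fscale (r p b) b)" if "p \<in> set ps" for p
    using fs.sum_representation_eq[OF B(2) _ fin order_refl, of "snd p"] B(3) that
    unfolding r_def by auto
  have coeff: "(\<Sum>p\<leftarrow>ps. fscale (r p b) (fst p)) = 0" if "b \<in> B" for b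
  proof
    fix x
    have "(\<Sum>b\<in>B. fscale (\<Sum>p\<leftarrow>ps. r p b * fst p x) b) = 0"
    proof
      fix y
      have "(\<Sum>b\<in>B. fscale (\<Sum>p\<leftarrow>ps. r p b * fst p x) b) y
          = (\<Sum>b\<in>B. (\<Sum>p\<leftarrow>ps. r p b * fst p x * b y))"
        by (simp add: sum_fun_apply' fscale_def sum_list_mult_const)
      also have "\<dots> = (\<Sum>p\<leftarrow>ps. \<Sum>b\<in>B. r p b * fst p x * b y)"
        by (induction ps) (simp_all add: sum.distrib)
      also have "\<dots> = (\<Sum>p\<leftarrow>ps. fst p x * snd p y)"
      proof (rule arg_cong[where f = sum_list], rule map_cong[OF refl])
        fix p assume "p \<in> set ps"
        then have "snd p y = (\<Sum>b\<in>B. r p b * b y)"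
          using rep[of p] by (metis (no_types, lifting) fscale_def sum.cong sum_fun_apply')
        then show "(\<Sum>b\<in>B. r p b * fst p x * b y) = fst p x * snd p y"
          by (simp add: sum_distrib_left mult_ac)
      qed
      also have "\<dots> = (\<Sum>(u, v)\<leftarrow>ps. u \<otimes> v) (x, y)"
        by (simp add: sum_list_fun_apply tensor_def case_prod_beta)
      finally show "(\<Sum>b\<in>B. fscale (\<Sum>p\<leftarrow>ps. r p b * fst p x) b) y = 0 y"
        using zero by simp
    qed
    then have "(\<Sum>p\<leftarrow>ps. r p b * fst p x) = 0"
      using fs.independentD[OF B(2) fin order_refl, of "\<lambda>b. \<Sum>p\<leftarrow>ps. r p b * fst p x"] that by blast
    then show "(\<Sum>p\<leftarrow>ps. fscale (r p b) (fst p)) x = 0 x"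
      by (simp add: sum_list_fun_apply fscale_def)
  qed
  have "(\<Sum>(u, v)\<leftarrow>ps. \<beta> u v) = (\<Sum>p\<leftarrow>ps. \<Sum>b\<in>B. s (r p b) (\<beta> (fst p) b))"
  proof (rule arg_cong[where f = sum_list], rule map_cong[OF refl])
    fix p assume p: "p \<in> set ps"
    then have "linear_on s V (\<beta> (fst p))" using ps \<beta> by (auto simp: bilinear_on_def)
    from linear_on_sum[OF s V this fin, of "\<lambda>b. b" "r p"] BV
    have "\<beta> (fst p) (\<Sum>b\<in>B. fscale (r p b) b) = (\<Sum>b\<in>B. s (r p b) (\<beta> (fst p) b))"
      by blast
    then show "(case p of (u, v) \<Rightarrow> \<beta> u v) = (\<Sum>b\<in>B. s (r p b) (\<beta> (fst p) b))"
      using rep[OF p] by (simp add: case_prod_beta)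
  qed
  also have "\<dots> = (\<Sum>b\<in>B. \<Sum>p\<leftarrow>ps. s (r p b) (\<beta> (fst p) b))"
    by (induction ps) (simp_all add: sum.distrib)
  also have "\<dots> = (\<Sum>b\<in>B. \<beta> (\<Sum>p\<leftarrow>ps. fscale (r p b) (fst p)) b)"
  proof (rule sum.cong[OF refl])
    fix b assume "b \<in> B"
    then have lin: "linear_on s U (\<lambda>u. \<beta> u b)" using BV \<beta> by (auto simp: bilinear_on_def)
    show "(\<Sum>p\<leftarrow>ps. s (r p b) (\<beta> (fst p) b)) = \<beta> (\<Sum>p\<leftarrow>ps. fscale (r p b) (fst p)) b"
      by (rule linear_on_sum_list(1)[OF s U lin, symmetric]) (use ps in auto)
  qed
  also have "\<dots> = (\<Sum>b\<in>B. \<beta> 0 b)"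
    by (rule sum.cong[OF refl]) (simp only: coeff)
  also have "\<dots> = 0"
  proof (rule sum.neutral, rule ballI)
    fix b assume "b \<in> B"
    then have lin: "linear_on s U (\<lambda>u. \<beta> u b)" using BV \<beta> by (auto simp: bilinear_on_def)
    show "\<beta> 0 b = 0" by (rule linear_on_zero[OF s U lin])
  qed
  finally show ?thesis .
qed

lemma tensor_scale_left: "fscale c u \<otimes> v = fscale c (u \<otimes> v)"
  by (auto simp: tensor_def fscale_def fun_eq_iff)

lemma tensor_lift_sum_list:
  assumes s: "vector_space s" and U: "fs.subspace U" and V: "fs.subspace V"
    and \<beta>: "bilinear_on s U V \<beta>" and ps: "set ps \<subseteq> U \<times> V"
  shows "tensor_lift U V \<beta> (\<Sum>(u, v)\<leftarrow>ps. u \<otimes> v) = (\<Sum>(u, v)\<leftarrow>ps. \<beta> u v)"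
  unfolding tensor_lift_def
proof (rule the_equality)
  show "\<exists>qs. set qs \<subseteq> U \<times> V \<and> (\<Sum>(u, v)\<leftarrow>ps. u \<otimes> v) = (\<Sum>(u, v)\<leftarrow>qs. u \<otimes> v) \<and>
    (\<Sum>(u, v)\<leftarrow>ps. \<beta> u v) = (\<Sum>(u, v)\<leftarrow>qs. \<beta> u v)"
    using ps by blast
next
  interpret vector_space s by fact
  fix w
  assume "\<exists>qs. set qs \<subseteq> U \<times> V \<and> (\<Sum>(u, v)\<leftarrow>ps. u \<otimes> v) = (\<Sum>(u, v)\<leftarrow>qs. u \<otimes> v) \<and>
    w = (\<Sum>(u, v)\<leftarrow>qs. \<beta> u v)"
  then obtain qs where qs: "set qs \<subseteq> U \<times> V" "(\<Sum>(u, v)\<leftarrow>ps. u \<otimes> v) = (\<Sum>(u, v)\<leftarrow>qs. u \<otimes> v)"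
    "w = (\<Sum>(u, v)\<leftarrow>qs. \<beta> u v)" by blast
  let ?ns = "map (\<lambda>(u, v). (fscale (- 1) u, v)) qs"
  have neg: "(\<Sum>(u, v)\<leftarrow>?ns. u \<otimes> v) = - (\<Sum>(u, v)\<leftarrow>qs. u \<otimes> v)"
    by (induction qs) (auto simp: fun_eq_iff tensor_def)
  have "\<beta> (fscale (- 1) u) v = - \<beta> u v" if "(u, v) \<in> U \<times> V" for u v
    using \<beta> that by (auto simp: bilinear_on_def linear_on_def simp del: fs.scale_minus_left)
  with qs(1) have neg': "(\<Sum>(u, v)\<leftarrow>?ns. \<beta> u v) = - (\<Sum>(u, v)\<leftarrow>qs. \<beta> u v)"
    by (induction qs) (auto simp del: fs.scale_minus_left)
  have "set (ps @ ?ns) \<subseteq> U \<times> V"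
    using ps qs(1) by (auto simp del: fs.scale_minus_left intro!: fs.subspace_scale[OF U])
  moreover have "(\<Sum>(u, v)\<leftarrow>ps @ ?ns. u \<otimes> v) = 0"
    using qs(2) neg by simp
  ultimately have "(\<Sum>(u, v)\<leftarrow>ps @ ?ns. \<beta> u v) = 0"
    by (intro tensor_relation[OF s U V \<beta>])
  then show "w = (\<Sum>(u, v)\<leftarrow>ps. \<beta> u v)"
    using qs(3) neg' by simp
qed

lemma tensor_space_sum_list:
  assumes U: "fs.subspace U" and t: "t \<in> tensor_space U V"
  obtains ps where "set ps \<subseteq> U \<times> V" "t = (\<Sum>(u, v)\<leftarrow>ps. u \<otimes> v)"
proof -
  have "\<exists>ps. set ps \<subseteq> U \<times> V \<and> t = (\<Sum>(u, v)\<leftarrow>ps. u \<otimes> v)"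
    using t unfolding tensor_space_def
  proof (induction rule: fs.span_induct_alt)
    case base
    then show ?case by (intro exI[of _ "[]"]) simp
  next
    case (step c x y)
    then obtain u v ps where "x = u \<otimes> v" "u \<in> U" "v \<in> V" "set ps \<subseteq> U \<times> V"
      "y = (\<Sum>(u, v)\<leftarrow>ps. u \<otimes> v)" by blast
    then show ?case
      by (intro exI[of _ "(fscale c u, v) # ps"])
        (auto simp: tensor_scale_left intro: fs.subspace_scale[OF U])
  qed
  then show thesis using that by blast
qed

theorem tensor_universal:
  assumes s: "vector_space s" and U: "fs.subspace U" and V: "fs.subspace V"
    and \<beta>: "bilinear_on s U V \<beta>"
  shows "linear_on s (tensor_space U V) (tensor_lift U V \<beta>)"
    and "\<And>u v. u \<in> U \<Longrightarrow> v \<in> V \<Longrightarrow> tensor_lift U V \<beta> (u \<otimes> v) = \<beta> u v"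
proof -
  interpret vector_space s by fact
  show "linear_on s (tensor_space U V) (tensor_lift U V \<beta>)"
    unfolding linear_on_def
  proof (intro conjI ballI allI)
    fix t t' assume "t \<in> tensor_space U V" "t' \<in> tensor_space U V"
    then obtain ps qs where "set ps \<subseteq> U \<times> V" "t = (\<Sum>(u, v)\<leftarrow>ps. u \<otimes> v)"
      "set qs \<subseteq> U \<times> V" "t' = (\<Sum>(u, v)\<leftarrow>qs. u \<otimes> v)"
      using tensor_space_sum_list[OF U] by metis
    then show "tensor_lift U V \<beta> (t + t') = tensor_lift U V \<beta> t + tensor_lift U V \<beta> t'"
      using tensor_lift_sum_list[OF s U V \<beta>, of "ps @ qs"] tensor_lift_sum_list[OF s U V \<beta>]
      by simp
  next
    fix c t assume "t \<in> tensor_space U V"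
    then obtain ps where ps: "set ps \<subseteq> U \<times> V" "t = (\<Sum>(u, v)\<leftarrow>ps. u \<otimes> v)"
      using tensor_space_sum_list[OF U] by metis
    let ?cs = "map (\<lambda>(u, v). (fscale c u, v)) ps"
    have cs: "(\<Sum>(u, v)\<leftarrow>?cs. u \<otimes> v) = fscale c t"
      unfolding ps(2) by (induction ps) (auto simp: fun_eq_iff tensor_def fscale_def algebra_simps)
    have "\<beta> (fscale c u) v = s c (\<beta> u v)" if "(u, v) \<in> U \<times> V" for u v
      using \<beta> that by (auto simp: bilinear_on_def linear_on_def)
    with ps(1) have "(\<Sum>(u, v)\<leftarrow>?cs. \<beta> u v) = s c (\<Sum>(u, v)\<leftarrow>ps. \<beta> u v)"
      by (induction ps) (auto simp: scale_right_distrib)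
    moreover have "set ?cs \<subseteq> U \<times> V" using ps(1) by (auto intro: fs.subspace_scale[OF U])
    ultimately show "tensor_lift U V \<beta> (fscale c t) = s c (tensor_lift U V \<beta> t)"
      using tensor_lift_sum_list[OF s U V \<beta>, of ?cs] tensor_lift_sum_list[OF s U V \<beta> ps(1)] ps(2) cs
      by simp
  qed
  show "tensor_lift U V \<beta> (u \<otimes> v) = \<beta> u v" if "u \<in> U" "v \<in> V" for u v
    using tensor_lift_sum_list[OF s U V \<beta>, of "[(u, v)]"] that by simp
qed


section \<open>Hopf algebras\<close>

locale algebra_on =
  fixes H :: "('x \<Rightarrow> 'k::field) set"
    and mul :: "('x \<Rightarrow> 'k) \<Rightarrow> ('x \<Rightarrow> 'k) \<Rightarrow> ('x \<Rightarrow> 'k)"  (infixl "\<bullet>" 70)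
    and unit :: "'x \<Rightarrow> 'k"
  assumes subspace: "fs.subspace H"
    and mul_closed: "x \<in> H \<Longrightarrow> y \<in> H \<Longrightarrow> x \<bullet> y \<in> H"
    and unit_closed: "unit \<in> H"
    and mul_bilinear: "bilinear_on fscale H H (\<bullet>)"
    and mul_assoc: "x \<in> H \<Longrightarrow> y \<in> H \<Longrightarrow> z \<in> H \<Longrightarrow> (x \<bullet> y) \<bullet> z = x \<bullet> (y \<bullet> z)"
    and unit_left: "x \<in> H \<Longrightarrow> unit \<bullet> x = x"
    and unit_right: "x \<in> H \<Longrightarrow> x \<bullet> unit = x"

locale coalgebra_on =
  fixes H :: "('x \<Rightarrow> 'k::field) set"
    and \<Delta> :: "('x \<Rightarrow> 'k) \<Rightarrow> ('x \<times> 'x \<Rightarrow> 'k)"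
    and \<epsilon> :: "('x \<Rightarrow> 'k) \<Rightarrow> 'k"
  assumes subspace: "fs.subspace H"
    and comult_closed: "x \<in> H \<Longrightarrow> \<Delta> x \<in> tensor_space H H"
    and comult_linear: "linear_on fscale H \<Delta>"
    and counit_linear: "linear_on (*) H \<epsilon>"
    and coassoc: "x \<in> H \<Longrightarrow>
      tensor_assoc (tensor_lift H H (\<lambda>a b. \<Delta> a \<otimes> b) (\<Delta> x)) = tensor_lift H H (\<lambda>a b. a \<otimes> \<Delta> b) (\<Delta> x)"
    and counit_left: "x \<in> H \<Longrightarrow> tensor_lift H H (\<lambda>a b. fscale (\<epsilon> a) b) (\<Delta> x) = x"
    and counit_right: "x \<in> H \<Longrightarrow> tensor_lift H H (\<lambda>a b. fscale (\<epsilon> b) a) (\<Delta> x) = x"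

text \<open>The product \<open>(a \<otimes> b) (c \<otimes> d) = (a c) \<otimes> (b d)\<close> on the tensor square of \<open>H\<close>.\<close>

definition tensor_mult :: "('x \<Rightarrow> 'k::field) set \<Rightarrow> (('x \<Rightarrow> 'k) \<Rightarrow> ('x \<Rightarrow> 'k) \<Rightarrow> ('x \<Rightarrow> 'k)) \<Rightarrow>
    ('x \<times> 'x \<Rightarrow> 'k) \<Rightarrow> ('x \<times> 'x \<Rightarrow> 'k) \<Rightarrow> ('x \<times> 'x \<Rightarrow> 'k)"
  where "tensor_mult H mul s t =
    tensor_lift H H (\<lambda>a b. tensor_lift H H (\<lambda>c d. mul a c \<otimes> mul b d) t) s"

locale bialgebra_on = algebra_on H mul unit + coalgebra_on H \<Delta> \<epsilon>
  for H :: "('x \<Rightarrow> 'k::field) set" and mul unit \<Delta> \<epsilon> +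
  assumes comult_mul: "x \<in> H \<Longrightarrow> y \<in> H \<Longrightarrow> \<Delta> (mul x y) = tensor_mult H mul (\<Delta> x) (\<Delta> y)"
    and comult_unit: "\<Delta> unit = unit \<otimes> unit"
    and counit_mul: "x \<in> H \<Longrightarrow> y \<in> H \<Longrightarrow> \<epsilon> (mul x y) = \<epsilon> x * \<epsilon> y"
    and counit_unit: "\<epsilon> unit = 1"

locale hopf_algebra_on = bialgebra_on H mul unit \<Delta> \<epsilon>
  for H :: "('x \<Rightarrow> 'k::field) set" and mul unit \<Delta> \<epsilon> +
  fixes S :: "('x \<Rightarrow> 'k) \<Rightarrow> ('x \<Rightarrow> 'k)"
  assumes antipode_closed: "x \<in> H \<Longrightarrow> S x \<in> H"
    and antipode_linear: "linear_on fscale H S"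
    and antipode_left: "x \<in> H \<Longrightarrow> tensor_lift H H (\<lambda>a b. mul (S a) b) (\<Delta> x) = fscale (\<epsilon> x) unit"
    and antipode_right: "x \<in> H \<Longrightarrow> tensor_lift H H (\<lambda>a b. mul a (S b)) (\<Delta> x) = fscale (\<epsilon> x) unit"

locale filtered_hopf_algebra_on = hopf_algebra_on H mul unit \<Delta> \<epsilon> S
  for H :: "('x \<Rightarrow> 'k::field) set" and mul unit \<Delta> \<epsilon> S +
  fixes F :: "nat \<Rightarrow> ('x \<Rightarrow> 'k) set"
  assumes filt_subspace: "fs.subspace (F k)"
    and filt_mono: "k \<le> l \<Longrightarrow> F k \<subseteq> F l"
    and filt_exhaustive: "(\<Union>k. F k) = H"
    and filt_unit: "unit \<in> F 0"
    and filt_mul: "x \<in> F k \<Longrightarrow> y \<in> F l \<Longrightarrow> mul x y \<in> F (k + l)"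
    and filt_comult: "x \<in> F k \<Longrightarrow> \<Delta> x \<in> fs.span (\<Union>i\<in>{0..k}. tensor_space (F i) (F (k - i)))"
    and filt_antipode: "x \<in> F k \<Longrightarrow> S x \<in> F k"


section \<open>Graphs\<close>

text \<open>
  Vertex set and set of edges, an edge being the set of its two end points.  As all graphs are
  finite, it is enough to consider graphs whose vertices are natural numbers.
\<close>

type_synonym 'v ugraph = "'v set \<times> 'v set set"

abbreviation verts :: "'v ugraph \<Rightarrow> 'v set" where "verts G \<equiv> fst G"
abbreviation edges :: "'v ugraph \<Rightarrow> 'v set set" where "edges G \<equiv> snd G"

definition simple_graph :: "'v ugraph \<Rightarrow> bool"
  where "simple_graph G \<longleftrightarrow> finite (verts G) \<and> edges G \<subseteq> {{u, v} | u v. u \<in> verts G \<and> v \<in> verts G \<and> u \<noteq> v}"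

definition adjacent :: "'v ugraph \<Rightarrow> 'v \<Rightarrow> 'v \<Rightarrow> bool"
  where "adjacent G u v \<longleftrightarrow> {u, v} \<in> edges G"

definition one_vertex :: "'v ugraph \<Rightarrow> bool"
  where "one_vertex G \<longleftrightarrow> card (verts G) = 1"

text \<open>
  The one-vertex graph counts as a graph without isolated vertex.  The empty graph is excluded: its
  role as the neutral element is played by the one-vertex graph.
\<close>

definition no_isolated :: "'v ugraph \<Rightarrow> bool"
  where "no_isolated G \<longleftrightarrow> simple_graph G \<and>
    (one_vertex G \<or> card (verts G) \<ge> 2 \<and> (\<forall>u\<in>verts G. \<exists>v\<in>verts G. adjacent G u v))"

definition graph_iso :: "'v ugraph \<Rightarrow> 'w ugraph \<Rightarrow> bool"
  where "graph_iso G G' \<longleftrightarrow> (\<exists>f. bij_betw f (verts G) (verts G') \<and>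
    (\<forall>u\<in>verts G. \<forall>v\<in>verts G. adjacent G u v \<longleftrightarrow> adjacent G' (f u) (f v)))"

definition disjoint_union :: "'v ugraph \<Rightarrow> 'w ugraph \<Rightarrow> ('v + 'w) ugraph"
  where "disjoint_union G G' = (verts G <+> verts G', image Inl ` edges G \<union> image Inr ` edges G')"

text \<open>\<open>G\<close> is the disjoint union of \<open>G'\<close> and \<open>G''\<close>, the one-vertex graph being neutral.\<close>

definition splits :: "'u ugraph \<Rightarrow> 'v ugraph \<Rightarrow> 'w ugraph \<Rightarrow> bool"
  where "splits G G' G'' \<longleftrightarrow>
    (if one_vertex G' then graph_iso G'' G
     else if one_vertex G'' then graph_iso G' G
     else graph_iso (disjoint_union G' G'') G)"

definition num_edges :: "'v ugraph \<Rightarrow> nat"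
  where "num_edges G = card (edges G)"

definition num_nodes :: "'v ugraph \<Rightarrow> nat"
  where "num_nodes G = (if one_vertex G then 0 else card (verts G))"

definition iso_classes :: "nat ugraph set set"
  where "iso_classes =
    {G. no_isolated G} // {(G, G'). no_isolated G \<and> no_isolated G' \<and> graph_iso G G'}"


section \<open>The ambient algebra and the polynomials of graphs\<close>

text \<open>
  A formal, possibly infinite, linear combination of squarefree monomials \<open>x\<^sub>E\<close> is the function
  sending \<open>E\<close> to the coefficient of \<open>x\<^sub>E\<close>.
\<close>

definition ambient :: "((nat \<times> nat) set \<Rightarrow> 'k::field) set"
  where "ambient = {f. \<forall>E. f E \<noteq> 0 \<longrightarrow> finite E \<and> E \<subseteq> {(i, j). 0 < i \<and> i < j}}"

text \<open>For finite \<open>E\<close>, there are only finitely many \<open>(A, B)\<close> with \<open>A \<union> B = E\<close>.\<close>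

definition amb_mult ::
    "((nat \<times> nat) set \<Rightarrow> 'k::field) \<Rightarrow> ((nat \<times> nat) set \<Rightarrow> 'k) \<Rightarrow> ((nat \<times> nat) set \<Rightarrow> 'k)"
  where "amb_mult f g = (\<lambda>E. \<Sum>(A, B) | A \<union> B = E. f A * g B)"

definition amb_one :: "(nat \<times> nat) set \<Rightarrow> 'k::field"
  where "amb_one = (\<lambda>E. if E = {} then 1 else 0)"

definition pairs :: "nat \<Rightarrow> (nat \<times> nat) set"
  where "pairs n = {(i, j). 1 \<le> i \<and> i < j \<and> j \<le> n}"

definition perm_act :: "(nat \<Rightarrow> nat) \<Rightarrow> nat \<times> nat \<Rightarrow> nat \<times> nat"
  where "perm_act \<sigma> = (\<lambda>(i, j). (min (\<sigma> i) (\<sigma> j), max (\<sigma> i) (\<sigma> j)))"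

text \<open>
  In the following, \<open>a (i, j)\<close> stands for \<open>a\<^sub>i\<^sub>j = 1\<close>; only its values on \<open>pairs n\<close> matter.
\<close>

definition perm_family :: "nat \<Rightarrow> (nat \<times> nat \<Rightarrow> bool) \<Rightarrow> (nat \<Rightarrow> nat) \<Rightarrow> (nat \<times> nat \<Rightarrow> bool)"
  where "perm_family n a \<sigma> = restrict (\<lambda>p. a (perm_act \<sigma> p)) (pairs n)"

definition rep_set :: "nat \<Rightarrow> (nat \<times> nat \<Rightarrow> bool) \<Rightarrow> (nat \<Rightarrow> nat) set \<Rightarrow> bool"
  where "rep_set n a R \<longleftrightarrow> R \<subseteq> {\<sigma>. \<sigma> permutes {1..n}} \<and> inj_on (perm_family n a) R \<and>
    perm_family n a ` R = perm_family n a ` {\<sigma>. \<sigma> permutes {1..n}}"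

text \<open>The sequences \<open>0 < r\<^sub>1 < \<dots> < r\<^sub>n\<close>.\<close>

definition index_seqs :: "nat \<Rightarrow> (nat \<Rightarrow> nat) set"
  where "index_seqs n = {r \<in> {1..n} \<rightarrow>\<^sub>E {0<..}. strict_mono_on {1..n} r}"

text \<open>
  The set \<open>E\<close> with \<open>x\<^sub>E\<close> equal to the product of the variables indexed by \<open>(r\<^sub>i, r\<^sub>j)\<close>, for
  \<open>i < j\<close> with \<open>a\<^bsub>\<sigma>(i,j)\<^esub> = 1\<close>.
\<close>

definition monomial :: "nat \<Rightarrow> (nat \<times> nat \<Rightarrow> bool) \<Rightarrow> (nat \<Rightarrow> nat) \<Rightarrow> (nat \<Rightarrow> nat) \<Rightarrow> (nat \<times> nat) set"
  where "monomial n a \<sigma> r = {(r i, r j) | i j. (i, j) \<in> pairs n \<and> a (perm_act \<sigma> (i, j))}"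

text \<open>
  The coefficient of \<open>x\<^sub>E\<close> in the double sum is the number of terms equal to \<open>x\<^sub>E\<close>.  There are
  finitely many of them, see \<open>finite_terms\<close> below.
\<close>

definition M_sum :: "nat \<Rightarrow> (nat \<times> nat \<Rightarrow> bool) \<Rightarrow> (nat \<Rightarrow> nat) set \<Rightarrow> (nat \<times> nat) set \<Rightarrow> 'k::field"
  where "M_sum n a R = (\<lambda>E. of_nat (card {(r, \<sigma>). r \<in> index_seqs n \<and> \<sigma> \<in> R \<and> monomial n a \<sigma> r = E}))"

lemma finite_pairs: "finite (pairs n)"
  by (rule finite_subset[of _ "{1..n} \<times> {1..n}"]) (auto simp: pairs_def)

lemma finite_terms:
  assumes G: "no_isolated G" "\<not> one_vertex G" and n: "n = card (verts G)"
    and lab: "bij_betw lab {1..n} (verts G)" and a: "a = (\<lambda>(i, j). adjacent G (lab i) (lab j))"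
    and R: "R \<subseteq> {\<sigma>. \<sigma> permutes {1..n}}"
  shows "finite {(r, \<sigma>). r \<in> index_seqs n \<and> \<sigma> \<in> R \<and> monomial n a \<sigma> r = E}" (is "finite ?T")
proof (cases "?T = {}")
  case False
  then obtain r \<sigma> where E: "monomial n a \<sigma> r = E" by blast
  have "monomial n a \<sigma> r \<subseteq> (\<lambda>(i, j). (r i, r j)) ` pairs n"
    by (auto simp: monomial_def)
  then have finE: "finite E" using E finite_pairs finite_surj by blast
  have "r \<in> {1..n} \<rightarrow>\<^sub>E fst ` E \<union> snd ` E" if "(r, \<sigma>) \<in> ?T" for r \<sigma>
  proof (rule PiE_I)
    from that have r: "r \<in> index_seqs n" and \<sigma>: "\<sigma> permutes {1..n}" and E: "monomial n a \<sigma> r = E"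
      using R by auto
    show "r i = undefined" if "i \<notin> {1..n}" for i
      using r that by (auto simp: index_seqs_def PiE_def extensional_def)
    fix i assume i: "i \<in> {1..n}"
    then have \<sigma>i: "\<sigma> i \<in> {1..n}" using permutes_in_image[OF \<sigma>] by blast
    then have "lab (\<sigma> i) \<in> verts G" using lab by (auto simp: bij_betw_def)
    then obtain v where v: "v \<in> verts G" "adjacent G (lab (\<sigma> i)) v"
      using G by (auto simp: no_isolated_def)
    have "v \<in> lab ` {1..n}" using lab v(1) by (simp add: bij_betw_def)
    then have "v \<in> lab ` \<sigma> ` {1..n}" by (simp only: permutes_image[OF \<sigma>])
    then obtain j where j: "j \<in> {1..n}" "v = lab (\<sigma> j)" by blast
    have sym: "adjacent G (lab (\<sigma> j)) (lab (\<sigma> i))" "adjacent G (lab (\<sigma> i)) (lab (\<sigma> j))"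
      using v(2) j(2) by (auto simp: adjacent_def insert_commute)
    have "lab (\<sigma> i) \<noteq> lab (\<sigma> j)"
      using sym(1) G(1) by (auto simp: adjacent_def no_isolated_def simple_graph_def)
    then have "i \<noteq> j" by auto
    then consider "(i, j) \<in> pairs n" | "(j, i) \<in> pairs n"
      using i j(1) by (cases "i < j") (auto simp: pairs_def)
    then show "r i \<in> fst ` E \<union> snd ` E"
    proof cases
      case 1
      then have "(r i, r j) \<in> E"
        using sym unfolding E[symmetric] monomial_def a by (auto simp: perm_act_def min_def max_def)
      then show ?thesis by force
    next
      case 2
      then have "(r j, r i) \<in> E"
        using sym unfolding E[symmetric] monomial_def a by (auto simp: perm_act_def min_def max_def)
      then show ?thesis by force
    qed
  qed
  then have "?T \<subseteq> ({1..n} \<rightarrow>\<^sub>E fst ` E \<union> snd ` E) \<times> {\<sigma>. \<sigma> permutes {1..n}}"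
    using R by auto
  moreover have "finite (({1..n} \<rightarrow>\<^sub>E fst ` E \<union> snd ` E) \<times> {\<sigma>. \<sigma> permutes {1..n}})"
    using finE by (intro finite_cartesian_product finite_PiE finite_permutations) auto
  ultimately show ?thesis by (rule finite_subset)
next
  case True
  show ?thesis unfolding True by (rule finite.emptyI)
qed

lemma M_sum_ambient: "M_sum n a R \<in> ambient"
proof -
  have "finite E \<and> E \<subseteq> {(i, j). 0 < i \<and> i < j}" if "r \<in> index_seqs n" "monomial n a \<sigma> r = E" for r \<sigma> E
  proof
    have "E \<subseteq> (\<lambda>(i, j). (r i, r j)) ` pairs n"
      using that(2) by (auto simp: monomial_def)
    then show "finite E" using finite_pairs finite_surj by blast
    show "E \<subseteq> {(i, j). 0 < i \<and> i < j}"
      using that by (auto simp: monomial_def index_seqs_def pairs_def strict_mono_on_def PiE_iff)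
  qed
  then have "M_sum n a R E = 0" if "\<not> (finite E \<and> E \<subseteq> {(i, j). 0 < i \<and> i < j})" for E
  proof -
    have "{(r, \<sigma>). r \<in> index_seqs n \<and> \<sigma> \<in> R \<and> monomial n a \<sigma> r = E} = {}"
      using that \<open>\<And>r \<sigma> E. r \<in> index_seqs n \<Longrightarrow> monomial n a \<sigma> r = E \<Longrightarrow>
        finite E \<and> E \<subseteq> {(i, j). 0 < i \<and> i < j}\<close> by blast
    then show ?thesis unfolding M_sum_def by (simp only: card.empty of_nat_0)
  qed
  then show ?thesis unfolding ambient_def by blast
qed

text \<open>The two choices are the labelling and the set \<open>R\<close>; the result does not depend on them.\<close>

definition M :: "'v ugraph \<Rightarrow> (nat \<times> nat) set \<Rightarrow> 'k::field"
  where "M G = (if one_vertex G then amb_one else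
    (let n = card (verts G);
         lab = (SOME lab. bij_betw lab {1..n} (verts G));
         a = (\<lambda>(i, j). adjacent G (lab i) (lab j));
         R = (SOME R. rep_set n a R)
     in M_sum n a R))"

definition M_class :: "nat ugraph set \<Rightarrow> (nat \<times> nat) set \<Rightarrow> 'k::field"
  where "M_class C = M (SOME G. G \<in> C)"

definition M_basis :: "((nat \<times> nat) set \<Rightarrow> 'k::field) set"
  where "M_basis = {M G | G :: nat ugraph. no_isolated G}"

definition UGQSym :: "((nat \<times> nat) set \<Rightarrow> 'k::field) set"
  where "UGQSym = fs.span M_basis"

lemma UGQSym_ambient: "(UGQSym :: ((nat \<times> nat) set \<Rightarrow> 'k::field) set) \<subseteq> ambient"
proof -
  have "fs.subspace (ambient :: ((nat \<times> nat) set \<Rightarrow> 'k) set)"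
    unfolding fs.subspace_def
  proof (intro conjI ballI allI)
    fix f g :: "(nat \<times> nat) set \<Rightarrow> 'k" assume "f \<in> ambient" "g \<in> ambient"
    moreover have "f E \<noteq> 0 \<or> g E \<noteq> 0" if "(f + g) E \<noteq> 0" for E
      using that by auto
    ultimately show "f + g \<in> ambient" unfolding ambient_def by blast
  qed (auto simp: ambient_def fscale_def)
  moreover have "(M G :: (nat \<times> nat) set \<Rightarrow> 'k) \<in> ambient" for G :: "nat ugraph"
  proof (cases "one_vertex G")
    case True
    then show ?thesis by (simp add: M_def amb_one_def ambient_def)
  next
    case False
    then show ?thesis by (simp add: M_def Let_def M_sum_ambient)
  qed
  ultimately show ?thesis unfolding UGQSym_def M_basis_def by (intro fs.span_minimal) auto
qed

definition M_coproduct :: "nat ugraph \<Rightarrow> (nat \<times> nat) set \<times> (nat \<times> nat) set \<Rightarrow> 'k::field"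
  where "M_coproduct G = (\<Sum>(C', C'') | C' \<in> iso_classes \<and> C'' \<in> iso_classes \<and>
      (\<exists>G'\<in>C'. \<exists>G''\<in>C''. splits G G' G''). M_class C' \<otimes> M_class C'')"

global_interpretation ff: vector_space_pair fscale fscale
  by unfold_locales

global_interpretation fk: vector_space_pair fscale "(*) :: 'k::field \<Rightarrow> 'k \<Rightarrow> 'k"
  by unfold_locales (auto simp: algebra_simps)

text \<open>
  The constants \<open>ff.construct B\<close> and \<open>fk.construct B\<close> are the linear extension of a map given on an
  independent set \<open>B\<close>.  A basis element determines its graph up to isomorphism.
\<close>

definition coproduct :: "((nat \<times> nat) set \<Rightarrow> 'k::field) \<Rightarrow> ((nat \<times> nat) set \<times> (nat \<times> nat) set \<Rightarrow> 'k)"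
  where "coproduct = ff.construct M_basis
    (\<lambda>m. M_coproduct (SOME G :: nat ugraph. no_isolated G \<and> M G = m))"

definition counit :: "((nat \<times> nat) set \<Rightarrow> 'k::field) \<Rightarrow> 'k"
  where "counit = fk.construct M_basis
    (\<lambda>m. if one_vertex (SOME G :: nat ugraph. no_isolated G \<and> M G = m) then 1 else 0)"

definition edge_filtration :: "nat \<Rightarrow> ((nat \<times> nat) set \<Rightarrow> 'k::field) set"
  where "edge_filtration k = fs.span {M G | G :: nat ugraph. no_isolated G \<and> num_edges G \<le> k}"

definition node_filtration :: "nat \<Rightarrow> ((nat \<times> nat) set \<Rightarrow> 'k::field) set"
  where "node_filtration k = fs.span {M G | G :: nat ugraph. no_isolated G \<and> num_nodes G \<le> k}"

end

theory Submission
  imports Defs "HOL-Library.Infinite_Set"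
begin

text \<open>
  A graph without isolated vertex whose nodes are positive integers is determined by its edge set, so
  \<open>M G\<close> is the indicator function of the edge sets isomorphic to \<open>G\<close>, and \<open>UGQSym\<close> consists of the
  isomorphism-invariant functions on edge sets that vanish on all but finitely many isomorphism
  classes.  In these terms the coproduct is \<open>(A, B) \<mapsto> f (A \<squnion> B)\<close> with \<open>\<squnion>\<close> the disjoint union and the
  counit is \<open>f {}\<close>.  The bialgebra axioms become identities between finite sums: multiplicativity of the
  coproduct holds since a pair of edge sets with union \<open>A \<squnion> B\<close> is a pair of pairs with unions \<open>A\<close> and
  \<open>B\<close>.  The antipode is defined by recursion on the number of edges; it is a two-sided convolution
  inverse since the product is commutative and the coproduct cocommutative.  Both filtrations are given
  by a size function that is additive on disjoint unions and subadditive on unions.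
\<close>

section \<open>Edge sets and relabellings\<close>

text \<open>The axioms are stated through \<open>tensor_lift\<close>, a definite description over
  decompositions into pure tensors, which is awkward to compute with. As tensors are functions of
  two edge sets, each map out of the tensor square that occurs has an explicit formula in the values
  of its argument, and \<open>tensor_lift_eqI\<close> identifies the two by comparing pure tensors
  only. In the same spirit no Sweedler decomposition is chosen: the antipode acts on the slices X
  \<mapsto> f (X \<squnion> B), the coproduct with its second argument frozen. A nonempty B uses up
  at least one edge of the bound on f, so the recursion ends. That the coproduct lands in the
  algebraic tensor product rests on finiteness: only finitely many isomorphism classes have bounded
  size, so f (A \<squnion> B) is a finite sum of indicators in A times slices in B. The indicator
  description of \<open>M G\<close> comes from the set R, which removes the repetitions caused by
  automorphisms: an edge set determines the sequence r as the increasing enumeration of its nodes,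
  and then the family of \<sigma>, so every coefficient is 0 or 1.\<close>

definition nodes :: "(nat \<times> nat) set \<Rightarrow> nat set"
  where "nodes E = fst ` E \<union> snd ` E"

definition edge_sets :: "(nat \<times> nat) set set"
  where "edge_sets = {E. finite E \<and> E \<subseteq> {(i, j). 0 < i \<and> i < j}}"

definition relabel :: "(nat \<Rightarrow> nat) \<Rightarrow> (nat \<times> nat) set \<Rightarrow> (nat \<times> nat) set"
  where "relabel f E = perm_act f ` E"

text \<open>Only the values on the nodes of \<open>E\<close> are constrained. The value 0 is
  excluded because variables have positive indices; orientation is not an issue, as
  \<open>perm_act\<close> sorts the end points.\<close>

definition relabelling :: "(nat \<Rightarrow> nat) \<Rightarrow> (nat \<times> nat) set \<Rightarrow> bool"
  where "relabelling f E \<longleftrightarrow> inj_on f (nodes E) \<and> 0 \<notin> f ` nodes E"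

definition edge_iso :: "(nat \<times> nat) set \<Rightarrow> (nat \<times> nat) set \<Rightarrow> bool"
  where "edge_iso E E' \<longleftrightarrow> (\<exists>f. relabelling f E \<and> E' = relabel f E)"

lemma edge_setsD:
  assumes "E \<in> edge_sets"
  shows "finite E" and "(i, j) \<in> E \<Longrightarrow> 0 < i" and "(i, j) \<in> E \<Longrightarrow> i < j"
    and "finite (nodes E)" and "x \<in> nodes E \<Longrightarrow> 0 < x"
  using assms by (auto simp: edge_sets_def nodes_def)

lemma edge_sets_empty [simp]: "{} \<in> edge_sets"
  by (simp add: edge_sets_def)

lemma edge_sets_Un [simp]: "A \<union> B \<in> edge_sets \<longleftrightarrow> A \<in> edge_sets \<and> B \<in> edge_sets"
  by (auto simp: edge_sets_def)

lemma nodes_empty [simp]: "nodes {} = {}"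
  by (simp add: nodes_def)

lemma nodes_Un: "nodes (A \<union> B) = nodes A \<union> nodes B"
  by (auto simp: nodes_def)

lemma nodes_mono: "A \<subseteq> B \<Longrightarrow> nodes A \<subseteq> nodes B"
  by (auto simp: nodes_def)

lemma nodes_eq_empty [simp]: "nodes E = {} \<longleftrightarrow> E = {}"
  by (auto simp: nodes_def)

lemma nodesI: "(i, j) \<in> E \<Longrightarrow> i \<in> nodes E" "(i, j) \<in> E \<Longrightarrow> j \<in> nodes E"
  by (force simp: nodes_def)+

lemma nodesE:
  assumes "x \<in> nodes E" obtains y where "(x, y) \<in> E \<or> (y, x) \<in> E"
  using assms by (fastforce simp: nodes_def)

lemma relabel_empty [simp]: "relabel f {} = {}"
  by (simp add: relabel_def)

lemma relabel_Un: "relabel f (A \<union> B) = relabel f A \<union> relabel f B"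
  by (simp add: relabel_def image_Un)

lemma relabel_eq_empty [simp]: "relabel f E = {} \<longleftrightarrow> E = {}"
  by (simp add: relabel_def)

lemma perm_act_comp: "perm_act g (perm_act f e) = perm_act (g \<circ> f) e"
  by (cases e) (auto simp: perm_act_def min_def max_def)

lemma relabel_comp: "relabel g (relabel f E) = relabel (g \<circ> f) E"
  by (simp add: relabel_def image_image perm_act_comp)

lemma nodes_relabel: "nodes (relabel f E) = f ` nodes E"
proof -
  have "{fst (perm_act f e), snd (perm_act f e)} = {f (fst e), f (snd e)}" for e
    by (cases e) (auto simp: perm_act_def min_def max_def)
  moreover have "nodes X = (\<Union>e\<in>X. {fst e, snd e})" for X
    by (auto simp: nodes_def)
  ultimately show ?thesis
    by (auto simp: relabel_def)
qed

lemma perm_act_cong: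
  assumes "e \<in> E" "\<And>x. x \<in> nodes E \<Longrightarrow> f x = g x"
  shows "perm_act f e = perm_act g e"
  using assms(1) assms(2)[of "fst e"] assms(2)[of "snd e"]
  by (cases e) (auto simp: perm_act_def nodesI)

lemma relabel_cong: "(\<And>x. x \<in> nodes E \<Longrightarrow> f x = g x) \<Longrightarrow> relabel f E = relabel g E"
  unfolding relabel_def by (intro image_cong refl perm_act_cong)

lemma perm_act_id: "i < j \<Longrightarrow> perm_act (\<lambda>x. x) (i, j) = (i, j)"
  by (simp add: perm_act_def)

lemma relabel_id:
  assumes "E \<in> edge_sets" "\<And>x. x \<in> nodes E \<Longrightarrow> f x = x"
  shows "relabel f E = E"
proof -
  have "relabel f E = relabel (\<lambda>x. x) E" using assms(2) by (rule relabel_cong)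
  also have "perm_act (\<lambda>x. x) e = e" if "e \<in> E" for e
    using that edge_setsD(3)[OF assms(1)] by (cases e) (simp add: perm_act_id)
  then have "relabel (\<lambda>x. x) E = E" by (force simp: relabel_def)
  finally show ?thesis .
qed

lemma relabelling_subset: "relabelling f E \<Longrightarrow> A \<subseteq> E \<Longrightarrow> relabelling f A"
  unfolding relabelling_def using nodes_mono[of A E] by (meson image_mono inj_on_subset subsetD)

lemma relabel_edge_sets:
  assumes "E \<in> edge_sets" "relabelling f E"
  shows "relabel f E \<in> edge_sets"
proof -
  have "fst (perm_act f (i, j)) < snd (perm_act f (i, j)) \<and> 0 < fst (perm_act f (i, j))"
    if "(i, j) \<in> E" for i j
  proof -
    have "i \<noteq> j" "i \<in> nodes E" "j \<in> nodes E"
      using that edge_setsD(3)[OF assms(1) that] by (auto intro: nodesI)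
    then have "f i \<noteq> f j" "f i \<noteq> 0" "f j \<noteq> 0"
      using assms(2) by (auto simp: relabelling_def inj_on_def image_iff)
    then show ?thesis by (auto simp: perm_act_def min_def)
  qed
  then have "relabel f E \<subseteq> {(i, j). 0 < i \<and> i < j}"
    by (auto simp: relabel_def) (metis fst_conv snd_conv)+
  then show ?thesis
    using edge_setsD(1)[OF assms(1)] by (simp add: edge_sets_def relabel_def)
qed

text \<open>The inverse takes its values in \<open>nodes E\<close>, which are positive, so it is
  again an admissible relabelling; this makes \<open>edge_iso\<close> symmetric.\<close>

lemma relabel_inv_into:
  assumes "E \<in> edge_sets" "relabelling f E"
  shows "relabel (inv_into (nodes E) f) (relabel f E) = E"
    and "relabelling (inv_into (nodes E) f) (relabel f E)"
proof -
  have inv: "inv_into (nodes E) f (f x) = x" if "x \<in> nodes E" for x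
    using assms(2) that by (simp add: relabelling_def)
  then show "relabel (inv_into (nodes E) f) (relabel f E) = E"
    unfolding relabel_comp by (intro relabel_id assms) simp
  show "relabelling (inv_into (nodes E) f) (relabel f E)"
    unfolding relabelling_def nodes_relabel
    using inv edge_setsD(5)[OF assms(1)] by (force simp: inj_on_def)
qed

text \<open>The inverse node map gives a left inverse on edges, because an edge of an edge set is
  already sorted and hence fixed by the identity action.\<close>

lemma inj_on_perm_act:
  assumes "E \<in> edge_sets" "inj_on f (nodes E)"
  shows "inj_on (perm_act f) E"
proof (rule inj_on_inverseI)
  fix e assume e: "e \<in> E"
  have "perm_act (inv_into (nodes E) f) (perm_act f e) = perm_act (\<lambda>x. x) e"
    unfolding perm_act_comp using assms(2) e by (intro perm_act_cong) auto
  also have "\<dots> = e"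
    using e edge_setsD(3)[OF assms(1)] by (cases e) (simp add: perm_act_id)
  finally show "perm_act (inv_into (nodes E) f) (perm_act f e) = e" .
qed

lemma edge_iso_refl: "E \<in> edge_sets \<Longrightarrow> edge_iso E E"
  unfolding edge_iso_def relabelling_def
  by (intro exI[of _ id]) (auto dest: edge_setsD(5) simp: relabel_id)

lemma edge_iso_sym: "E \<in> edge_sets \<Longrightarrow> edge_iso E E' \<Longrightarrow> edge_iso E' E"
  unfolding edge_iso_def using relabel_inv_into by metis

lemma relabelling_comp:
  "relabelling f E \<Longrightarrow> relabelling g (relabel f E) \<Longrightarrow> relabelling (g \<circ> f) E"
  unfolding relabelling_def nodes_relabel by (auto intro: comp_inj_on)

lemma edge_iso_trans: "edge_iso E E' \<Longrightarrow> edge_iso E' E'' \<Longrightarrow> edge_iso E E''"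
  unfolding edge_iso_def using relabel_comp relabelling_comp by metis

lemma edge_iso_edge_sets: "E \<in> edge_sets \<Longrightarrow> edge_iso E E' \<Longrightarrow> E' \<in> edge_sets"
  unfolding edge_iso_def using relabel_edge_sets by blast

section \<open>Disjoint unions of edge sets\<close>

text \<open>Nodes are positive, so the truncated subtraction in \<open>odd_label\<close> is harmless.\<close>

definition even_label :: "nat \<Rightarrow> nat" where "even_label i = 2 * i"
definition odd_label :: "nat \<Rightarrow> nat" where "odd_label i = 2 * i - 1"

text \<open>The labels map the positive integers onto the even and the odd ones, which yields one
  concrete disjoint union. It is commutative, associative and unital only up to
  \<open>edge_iso\<close>, which suffices for invariant functions.\<close>

definition dunion :: "(nat \<times> nat) set \<Rightarrow> (nat \<times> nat) set \<Rightarrow> (nat \<times> nat) set"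
  where "dunion A B = relabel even_label A \<union> relabel odd_label B"

lemma relabelling_even: "A \<in> edge_sets \<Longrightarrow> relabelling even_label A"
  unfolding relabelling_def even_label_def by (auto simp: inj_on_def dest: edge_setsD(5))

lemma relabelling_odd: "A \<in> edge_sets \<Longrightarrow> relabelling odd_label A"
  using edge_setsD(5)[of A] unfolding relabelling_def odd_label_def
  by (fastforce simp: inj_on_def)

lemma dunion_edge_sets: "A \<in> edge_sets \<Longrightarrow> B \<in> edge_sets \<Longrightarrow> dunion A B \<in> edge_sets"
  by (simp add: dunion_def relabel_edge_sets relabelling_even relabelling_odd)

lemma nodes_dunion: "nodes (dunion A B) = even_label ` nodes A \<union> odd_label ` nodes B"
  by (simp add: dunion_def nodes_Un nodes_relabel)

lemma nodes_dunion_disjoint: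
  assumes "B \<in> edge_sets"
  shows "even_label ` nodes A \<inter> odd_label ` nodes B = {}"
  using edge_setsD(5)[OF assms] by (force simp: even_label_def odd_label_def elim: arg_cong[of _ _ odd, elim_format])

lemma dunion_Un: "dunion (A \<union> A') (B \<union> B') = dunion A B \<union> dunion A' B'"
  by (auto simp: dunion_def relabel_Un)

lemma dunion_eq_empty [simp]: "dunion A B = {} \<longleftrightarrow> A = {} \<and> B = {}"
  by (simp add: dunion_def)

lemma dunion_relabel:
  assumes A: "A \<in> edge_sets" "relabelling f A" and B: "B \<in> edge_sets" "relabelling g B"
  shows "edge_iso (dunion A B) (dunion (relabel f A) (relabel g B))"
proof -
  \<comment> \<open>Undo the label, apply \<open>f\<close> or \<open>g\<close>, and label again: an
    even \<open>x\<close> is \<open>even_label (x div 2)\<close>, an odd one is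
    \<open>odd_label ((x + 1) div 2)\<close>.\<close>
  define h where "h x = (if even x then 2 * f (x div 2) else 2 * g ((x + 1) div 2) - 1)" for x :: nat
  have he: "h (even_label x) = even_label (f x)" for x
    by (simp add: h_def even_label_def)
  have ho: "h (odd_label x) = odd_label (g x)" if "x \<in> nodes B" for x
    using edge_setsD(5)[OF B(1) that] by (auto simp: h_def odd_label_def)
  have "relabel h (dunion A B) = dunion (relabel f A) (relabel g B)"
    unfolding dunion_def relabel_Un relabel_comp
    by (intro arg_cong2[where f = "(\<union>)"] relabel_cong) (simp_all add: he ho)
  moreover have "relabelling h (dunion A B)"
    unfolding relabelling_def nodes_dunion inj_on_Un
  proof (intro conjI)
    show "inj_on h (even_label ` nodes A)"
      using A(2) by (force simp: inj_on_def he relabelling_def even_label_def[of "f _"])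
    have "g x > 0" if "x \<in> nodes B" for x
      using B(2) that by (auto simp: relabelling_def image_iff)
    then have inj: "g x = g y" if "odd_label (g x) = odd_label (g y)" "x \<in> nodes B" "y \<in> nodes B" for x y
      using that by (fastforce simp: odd_label_def)
    show "inj_on h (odd_label ` nodes B)"
      using B(2) by (auto simp: inj_on_def ho relabelling_def dest!: inj)
    have "f ` nodes A = nodes (relabel f A)" "g ` nodes B = nodes (relabel g B)"
      by (simp_all add: nodes_relabel)
    moreover have "h ` even_label ` nodes A = even_label ` f ` nodes A"
      by (simp add: image_image he)
    moreover have "h ` odd_label ` nodes B = odd_label ` g ` nodes B"
      by (force simp: image_image ho)
    ultimately show "h ` (even_label ` nodes A - odd_label ` nodes B) \<inter> h ` (odd_label ` nodes B - even_label ` nodes A) = {}"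
      using nodes_dunion_disjoint[OF relabel_edge_sets[OF B], of "relabel f A"] by blast
    have "f x > 0" if "x \<in> nodes A" for x
      using A(2) that by (auto simp: relabelling_def image_iff)
    then show "0 \<notin> h ` (even_label ` nodes A \<union> odd_label ` nodes B)"
      using \<open>\<And>x. x \<in> nodes B \<Longrightarrow> g x > 0\<close>
      by (fastforce simp: he ho even_label_def[of "f _"] odd_label_def[of "g _"])
  qed
  ultimately show ?thesis unfolding edge_iso_def by metis
qed

lemma edge_isoI:
  "h ` nodes E \<subseteq> {0<..} \<Longrightarrow> inj_on h (nodes E) \<Longrightarrow> E' = relabel h E \<Longrightarrow> edge_iso E E'"
  unfolding edge_iso_def relabelling_def by fastforce

lemma dunion_commute:
  assumes "A \<in> edge_sets" "B \<in> edge_sets"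
  shows "edge_iso (dunion A B) (dunion B A)"
proof (rule edge_isoI)
  \<comment> \<open>The labels of a node \<open>i\<close> are \<open>2 * i\<close> and
    \<open>2 * i - 1\<close>, so \<open>h\<close> exchanges neighbours and is an involution on
    positive numbers.\<close>
  define h where "h x = (if even x then x - 1 else x + 1)" for x :: nat
  have he: "h (even_label x) = odd_label x" if "x > 0" for x
    using that by (simp add: h_def even_label_def odd_label_def)
  have ho: "h (odd_label x) = even_label x" if "x > 0" for x
    using that by (auto simp: h_def even_label_def odd_label_def)
  show "dunion B A = relabel h (dunion A B)"
    unfolding dunion_def relabel_Un relabel_comp Un_commute[of "relabel even_label B"]
    by (intro arg_cong2[where f = "(\<union>)"] relabel_cong)
      (auto simp: he ho dest: edge_setsD(5)[OF assms(1)] edge_setsD(5)[OF assms(2)])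
  have pos: "x > 0" if "x \<in> nodes (dunion A B)" for x
    using edge_setsD(5)[OF dunion_edge_sets[OF assms]] that .
  have "h (h x) = x" if "x > 0" for x
    using that by (simp add: h_def)
  with pos show "inj_on h (nodes (dunion A B))" by (metis inj_on_inverseI)
  show "h ` nodes (dunion A B) \<subseteq> {0<..}"
    using pos by (fastforce simp: h_def elim: evenE)
qed

lemma dunion_assoc:
  assumes "A \<in> edge_sets" "B \<in> edge_sets" "C \<in> edge_sets"
  shows "edge_iso (dunion (dunion A B) C) (dunion A (dunion B C))"
proof (rule edge_isoI)
  \<comment> \<open>Nodes \<open>a\<close>, \<open>b\<close>, \<open>c\<close> of the three parts
    carry the labels \<open>4 * a\<close>, \<open>4 * b - 2\<close>, \<open>2 * c - 1\<close> on the
    left and \<open>2 * a\<close>, \<open>4 * b - 1\<close>, \<open>4 * c - 3\<close> on the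
    right.\<close>
  define h where "h x = (if 4 dvd x then x div 2 else if even x then x + 1 else 2 * x - 1)" for x :: nat
  have h1: "h (even_label (even_label x)) = even_label x" for x
    by (simp add: h_def even_label_def)
  have h2: "h (even_label (odd_label x)) = odd_label (even_label x)" if "x > 0" for x
  proof -
    have "\<not> 4 dvd 2 * (2 * x - 1)" using that by presburger
    then show ?thesis using that by (simp add: h_def even_label_def odd_label_def)
  qed
  have h3: "h (odd_label x) = odd_label (odd_label x)" if "x > 0" for x
  proof -
    have "odd (2 * x - 1)" using that by presburger
    then have "odd (2 * x - 1)" "\<not> 4 dvd 2 * x - 1" by presburger+
    then show ?thesis unfolding h_def even_label_def odd_label_def by simp
  qed
  show "dunion A (dunion B C) = relabel h (dunion (dunion A B) C)"
    unfolding dunion_def relabel_Un relabel_comp Un_assoc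
    by (intro arg_cong2[where f = "(\<union>)"] relabel_cong)
      (auto simp: h1 h2 h3 dest: edge_setsD(5)[OF assms(1)] edge_setsD(5)[OF assms(2)] edge_setsD(5)[OF assms(3)])
  have pos: "x > 0" if "x \<in> nodes (dunion (dunion A B) C)" for x
    using edge_setsD(5)[OF dunion_edge_sets[OF dunion_edge_sets[OF assms(1,2)] assms(3)]] that .
  \<comment> \<open>The inverse of \<open>h\<close>, read off from the residue modulo 4 of the
    right-hand labels: even, 3, or 1.\<close>
  define h' where "h' y = (if even y then 2 * y else if y mod 4 = 3 then y - 1 else (y + 1) div 2)" for y :: nat
  have h': "h' (h x) = x \<and> h x > 0" if "x > 0" for x
  proof -
    consider k where "x = 4 * k" | k where "x = 4 * k + 2" | k where "x = 2 * k + 1"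
    proof (cases "even x")
      case True
      then obtain l where "x = 2 * l" by blast
      with that show ?thesis by (cases "even l") (auto elim!: evenE oddE)
    qed (use that in \<open>auto elim!: oddE\<close>)
    then show ?thesis
    proof cases
      case (1 k)
      then show ?thesis using that by (simp add: h_def h'_def)
    next
      case (2 k)
      have "\<not> 4 dvd 4 * k + 2" "(4 * k + 3) mod 4 = 3" by presburger+
      then show ?thesis using 2 by (simp add: h_def h'_def)
    next
      case (3 k)
      have "\<not> 4 dvd 2 * k + 1" "(4 * k + 1) mod 4 \<noteq> 3" by presburger+
      then show ?thesis using 3 by (simp add: h_def h'_def)
    qed
  qed
  with pos show "inj_on h (nodes (dunion (dunion A B) C))" by (metis inj_on_inverseI)
  show "h ` nodes (dunion (dunion A B) C) \<subseteq> {0<..}"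
    using pos h' by auto
qed

lemma dunion_empty_right:
  assumes "A \<in> edge_sets"
  shows "edge_iso A (dunion A {})"
  unfolding edge_iso_def dunion_def using relabelling_even[OF assms] by auto

lemma dunion_empty_left:
  assumes "A \<in> edge_sets"
  shows "edge_iso A (dunion {} A)"
  unfolding edge_iso_def dunion_def using relabelling_odd[OF assms] by auto

section \<open>Isomorphism-invariant functions on edge sets\<close>

definition covers :: "'a set \<Rightarrow> ('a set \<times> 'a set) set"
  where "covers E = {(A, B). A \<union> B = E}"

lemma finite_covers: "finite E \<Longrightarrow> finite (covers E)"
  by (rule finite_subset[of _ "Pow E \<times> Pow E"]) (auto simp: covers_def)

text \<open>A sum over an infinite index set is 0 by convention, so \<open>amb_mult\<close> vanishes
  on infinite sets and the algebra laws may be checked on finite ones.\<close>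

lemma infinite_covers: "infinite E \<Longrightarrow> infinite (covers E)"
proof
  assume "infinite E" "finite (covers E)"
  moreover have "(\<lambda>A. (A, E)) ` Pow E \<subseteq> covers E" by (auto simp: covers_def)
  ultimately have "finite ((\<lambda>A. (A, E)) ` Pow E)" by (rule_tac finite_subset)
  then have "finite (Pow E)" by (rule finite_imageD) (auto simp: inj_on_def)
  with \<open>infinite E\<close> show False by simp
qed

lemma sum_covers_image:
  assumes "inj_on p E"
  shows "(\<Sum>(A, B)\<in>covers (p ` E). h A B) = (\<Sum>(A, B)\<in>covers E. h (p ` A) (p ` B))"
proof (rule sum.reindex_bij_witness[where j = "\<lambda>(A, B). (E \<inter> p -` A, E \<inter> p -` B)"
      and i = "\<lambda>(A, B). (p ` A, p ` B)"])
  fix AB assume "AB \<in> covers (p ` E)"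
  then obtain A B where AB: "AB = (A, B)" "A \<union> B = p ` E" by (auto simp: covers_def)
  then have "A \<subseteq> p ` E" "B \<subseteq> p ` E" by auto
  then have *: "p ` (E \<inter> p -` A) = A" "p ` (E \<inter> p -` B) = B" by blast+
  show "(\<lambda>(A, B). (p ` A, p ` B)) ((\<lambda>(A, B). (E \<inter> p -` A, E \<inter> p -` B)) AB) = AB"
    using * by (simp add: AB(1))
  show "(\<lambda>(A, B). (E \<inter> p -` A, E \<inter> p -` B)) AB \<in> covers E"
    using AB(2) by (auto simp: AB(1) covers_def)
  show "(\<lambda>(A, B). h (p ` A) (p ` B)) ((\<lambda>(A, B). (E \<inter> p -` A, E \<inter> p -` B)) AB) = (\<lambda>(A, B). h A B) AB"
    using * by (simp add: AB(1))
next
  fix AB assume "AB \<in> covers E"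
  then obtain A B where AB: "AB = (A, B)" "A \<union> B = E" by (auto simp: covers_def)
  then have "E \<inter> p -` p ` A = A" "E \<inter> p -` p ` B = B"
    using assms by (auto simp: inj_on_def)
  then show "(\<lambda>(A, B). (E \<inter> p -` A, E \<inter> p -` B)) ((\<lambda>(A, B). (p ` A, p ` B)) AB) = AB"
    by (simp add: AB(1))
  show "(\<lambda>(A, B). (p ` A, p ` B)) AB \<in> covers (p ` E)"
    using AB(2) by (auto simp: AB(1) covers_def)
qed

lemma sum_covers_swap: "(\<Sum>(A, B)\<in>covers E. h A B) = (\<Sum>(A, B)\<in>covers E. h B A)"
  by (rule sum.reindex_bij_witness[where i = prod.swap and j = prod.swap]) (auto simp: covers_def)

lemma sum_covers_relabel:
  assumes "E \<in> edge_sets" "relabelling f E"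
  shows "(\<Sum>(A, B)\<in>covers (relabel f E). h A B) = (\<Sum>(A, B)\<in>covers E. h (relabel f A) (relabel f B))"
  unfolding relabel_def using assms
  by (intro sum_covers_image inj_on_perm_act) (auto simp: relabelling_def)

lemma amb_mult_covers: "amb_mult f g E = (\<Sum>(A, B)\<in>covers E. f A * g B)"
  by (simp add: amb_mult_def covers_def)

definition shape_funs :: "((nat \<times> nat) set \<Rightarrow> 'k::field) set"
  where "shape_funs = {f. (\<forall>E. E \<notin> edge_sets \<longrightarrow> f E = 0) \<and>
    (\<forall>E E'. E \<in> edge_sets \<longrightarrow> edge_iso E E' \<longrightarrow> f E' = f E)}"

definition shape_indicator :: "(nat \<times> nat) set \<Rightarrow> (nat \<times> nat) set \<Rightarrow> 'k::field"
  where "shape_indicator E = (\<lambda>E'. if edge_iso E E' then 1 else 0)"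

definition bounded_funs :: "((nat \<times> nat) set \<Rightarrow> nat) \<Rightarrow> nat \<Rightarrow> ((nat \<times> nat) set \<Rightarrow> 'k::field) set"
  where "bounded_funs s k = {f \<in> shape_funs. \<forall>E. f E \<noteq> 0 \<longrightarrow> s E \<le> k}"

lemma shape_funsI:
  assumes "\<And>E. E \<notin> edge_sets \<Longrightarrow> f E = 0"
    and "\<And>E h. E \<in> edge_sets \<Longrightarrow> relabelling h E \<Longrightarrow> f (relabel h E) = f E"
  shows "f \<in> shape_funs"
  unfolding shape_funs_def edge_iso_def using assms by auto

lemma shape_funsD:
  assumes "f \<in> shape_funs"
  shows "E \<notin> edge_sets \<Longrightarrow> f E = 0"
    and "E \<in> edge_sets \<Longrightarrow> edge_iso E E' \<Longrightarrow> f E' = f E"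
    and "E \<in> edge_sets \<Longrightarrow> relabelling h E \<Longrightarrow> f (relabel h E) = f E"
  using assms unfolding shape_funs_def edge_iso_def by auto

lemma bounded_funs_shape: "f \<in> bounded_funs s k \<Longrightarrow> f \<in> shape_funs"
  by (simp add: bounded_funs_def)

lemma bounded_funsD: "f \<in> bounded_funs s k \<Longrightarrow> f E \<noteq> 0 \<Longrightarrow> s E \<le> k"
  by (simp add: bounded_funs_def)

lemma bounded_funs_mono: "k \<le> l \<Longrightarrow> bounded_funs s k \<subseteq> bounded_funs s l"
  by (auto simp: bounded_funs_def intro: order_trans)

lemma subspace_shape_funs: "fs.subspace shape_funs"
  unfolding fs.subspace_def shape_funs_def fscale_def by auto

lemma subspace_bounded_funs: "fs.subspace (bounded_funs s k)"
  unfolding fs.subspace_def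
proof (intro conjI ballI allI)
  fix f g :: "(nat \<times> nat) set \<Rightarrow> 'a" assume fg: "f \<in> bounded_funs s k" "g \<in> bounded_funs s k"
  then have "f + g \<in> shape_funs"
    by (intro fs.subspace_add[OF subspace_shape_funs] bounded_funs_shape)
  moreover have "f E \<noteq> 0 \<or> g E \<noteq> 0" if "(f + g) E \<noteq> 0" for E using that by auto
  ultimately show "f + g \<in> bounded_funs s k"
    using fg unfolding bounded_funs_def by blast
next
  fix c and f :: "(nat \<times> nat) set \<Rightarrow> 'a" assume "f \<in> bounded_funs s k"
  then show "fscale c f \<in> bounded_funs s k"
    using fs.subspace_scale[OF subspace_shape_funs] by (auto simp: bounded_funs_def fscale_def)
qed (use fs.subspace_0[OF subspace_shape_funs] in \<open>auto simp: bounded_funs_def\<close>)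

lemma shape_indicator_shape: "E \<in> edge_sets \<Longrightarrow> shape_indicator E \<in> shape_funs"
  unfolding shape_funs_def shape_indicator_def
  by (auto dest: edge_iso_edge_sets edge_iso_sym intro: edge_iso_trans)

lemma shape_indicator_eq:
  assumes "E \<in> edge_sets" "E' \<in> edge_sets"
  shows "(shape_indicator E :: _ \<Rightarrow> 'k::field) = shape_indicator E' \<longleftrightarrow> edge_iso E E'"
proof
  assume "(shape_indicator E :: _ \<Rightarrow> 'k) = shape_indicator E'"
  then have "(shape_indicator E E' :: 'k) = shape_indicator E' E'" by simp
  then show "edge_iso E E'"
    using edge_iso_refl[OF assms(2)] by (simp add: shape_indicator_def split: if_splits)
next
  assume "edge_iso E E'"
  then show "(shape_indicator E :: _ \<Rightarrow> 'k) = shape_indicator E'"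
    unfolding shape_indicator_def using edge_iso_sym[OF assms(1)] edge_iso_trans by metis
qed

lemma shape_indicator_empty: "shape_indicator {} = amb_one"
  by (auto simp: shape_indicator_def amb_one_def edge_iso_def relabelling_def fun_eq_iff)

text \<open>Confines representatives to a finite square; this is the source of the finiteness of the
  set of isomorphism classes of bounded size.\<close>

lemma edge_iso_into_interval:
  assumes "E \<in> edge_sets"
  obtains E' where "edge_iso E E'" "E' \<subseteq> {1..card (nodes E)} \<times> {1..card (nodes E)}"
proof -
  obtain h where h: "bij_betw h (nodes E) {1..card (nodes E)}"
    using ex_bij_betw_finite_nat[OF edge_setsD(4)[OF assms]]
    by (metis edge_setsD(4)[OF assms] card_atLeastAtMost diff_Suc_1 finite_atLeastAtMost finite_same_card_bij)
  then have "relabelling h E" by (auto simp: relabelling_def bij_betw_def)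
  moreover have "nodes (relabel h E) \<subseteq> {1..card (nodes E)}"
    using h by (simp add: nodes_relabel bij_betw_def)
  then have "relabel h E \<subseteq> {1..card (nodes E)} \<times> {1..card (nodes E)}"
    by (force simp: nodes_def)
  ultimately show thesis using that unfolding edge_iso_def by blast
qed

section \<open>Size functions, indicator bases and filtration pieces\<close>

text \<open>Covers the number of edges and the number of nodes at once. The last axiom bounds the
  nodes by the size, which leaves finitely many classes in each bounded size and makes nonempty edge
  sets positive; the factor 2 accounts for the two end points of an edge.\<close>

locale edge_size =
  fixes s :: "(nat \<times> nat) set \<Rightarrow> nat"
  assumes size_relabel: "E \<in> edge_sets \<Longrightarrow> relabelling f E \<Longrightarrow> s (relabel f E) = s E"
    and size_Un: "A \<in> edge_sets \<Longrightarrow> B \<in> edge_sets \<Longrightarrow> s (A \<union> B) \<le> s A + s B"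
    and size_dunion: "A \<in> edge_sets \<Longrightarrow> B \<in> edge_sets \<Longrightarrow> s (dunion A B) = s A + s B"
    and card_nodes_size: "E \<in> edge_sets \<Longrightarrow> card (nodes E) \<le> 2 * s E"
begin

lemma size_empty: "s {} = 0"
  using size_dunion[of "{}" "{}"] by (simp add: dunion_def)

lemma size_pos:
  assumes "E \<in> edge_sets" "E \<noteq> {}"
  shows "s E > 0"
proof -
  have "card (nodes E) > 0" using assms edge_setsD(4) by (simp add: card_gt_0_iff)
  with card_nodes_size[OF assms(1)] show ?thesis by linarith
qed

lemma size_edge_iso: "E \<in> edge_sets \<Longrightarrow> edge_iso E E' \<Longrightarrow> s E' = s E"
  unfolding edge_iso_def using size_relabel by blast

text \<open>Indicators stand in for isomorphism classes: isomorphic edge sets give the same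
  function, so each class is listed once.\<close>

definition shapes :: "nat \<Rightarrow> ((nat \<times> nat) set \<Rightarrow> 'k::field) set"
  where "shapes k = shape_indicator ` {E \<in> edge_sets. s E \<le> k}"

definition shape_rep :: "nat \<Rightarrow> ((nat \<times> nat) set \<Rightarrow> 'k::field) \<Rightarrow> (nat \<times> nat) set"
  where "shape_rep k m = (SOME E. E \<in> edge_sets \<and> s E \<le> k \<and> shape_indicator E = m)"

lemma shape_rep:
  assumes "m \<in> shapes k"
  shows "shape_rep k m \<in> edge_sets" "s (shape_rep k m) \<le> k" "shape_indicator (shape_rep k m) = m"
proof -
  have "\<exists>E. E \<in> edge_sets \<and> s E \<le> k \<and> shape_indicator E = m"
    using assms by (auto simp: shapes_def)
  from someI_ex[OF this] show "shape_rep k m \<in> edge_sets" "s (shape_rep k m) \<le> k"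
    "shape_indicator (shape_rep k m) = m" by (auto simp: shape_rep_def)
qed

lemma finite_shapes: "finite (shapes k)"
proof (rule finite_subset)
  show "shapes k \<subseteq> shape_indicator ` Pow ({1..2 * k} \<times> {1..2 * k})"
  proof
    fix m :: "(nat \<times> nat) set \<Rightarrow> 'k::field" assume "m \<in> shapes k"
    then obtain E where E: "E \<in> edge_sets" "s E \<le> k" "m = shape_indicator E"
      by (auto simp: shapes_def)
    from edge_iso_into_interval[OF E(1)] obtain E' where
      E': "edge_iso E E'" "E' \<subseteq> {1..card (nodes E)} \<times> {1..card (nodes E)}" .
    have "card (nodes E) \<le> 2 * k" using card_nodes_size[OF E(1)] E(2) by linarith
    then have "E' \<subseteq> {1..2 * k} \<times> {1..2 * k}" using E'(2) by fastforce
    moreover have "m = shape_indicator E'"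
      unfolding E(3) using E'(1) edge_iso_edge_sets[OF E(1) E'(1)] E(1) by (simp add: shape_indicator_eq)
    ultimately show "m \<in> shape_indicator ` Pow ({1..2 * k} \<times> {1..2 * k})" by blast
  qed
qed simp

text \<open>The coordinate of \<open>f\<close> at a class is its value on a representative. It is
  stated at a single \<open>A\<close>, with a finite index set independent of \<open>f\<close>, so
  that it can also be applied to slices of a function of two arguments.\<close>

lemma shape_expansion:
  fixes f :: "(nat \<times> nat) set \<Rightarrow> 'k::field"
  assumes "f \<in> bounded_funs s k"
  shows "(\<Sum>m\<in>shapes k. m A * f (shape_rep k m)) = f A"
proof (cases "A \<in> edge_sets \<and> s A \<le> k")
  case True
  then have "A \<in> edge_sets" and mem: "(shape_indicator A :: _ \<Rightarrow> 'k) \<in> shapes k"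
    by (auto simp: shapes_def)
  \<comment> \<open>Distinct classes have disjoint supports: of all the indicators only that of the
    class of \<open>A\<close> is nonzero at \<open>A\<close>.\<close>
  have *: "m A = (if m = shape_indicator A then 1 else 0)" if "m \<in> shapes k" for m :: "_ \<Rightarrow> 'k"
    using shape_rep[OF that] shape_indicator_eq[of "shape_rep k m" A, where 'k = 'k] \<open>A \<in> edge_sets\<close>
    by (metis shape_indicator_def)
  have "(\<Sum>m\<in>shapes k. m A * f (shape_rep k m))
      = (\<Sum>m\<in>shapes k. if m = (shape_indicator A :: _ \<Rightarrow> 'k) then f (shape_rep k m) else 0)"
    by (rule sum.cong) (simp_all add: *)
  also have "\<dots> = f (shape_rep k (shape_indicator A :: _ \<Rightarrow> 'k))"
    using mem by (simp add: finite_shapes)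
  also have "\<dots> = f A"
    using shape_rep[OF mem] shape_indicator_eq[of _ A, where 'k = 'k] \<open>A \<in> edge_sets\<close>
      shape_funsD(2)[OF bounded_funs_shape[OF assms]] by metis
  finally show ?thesis .
next
  case False
  then have "f A = 0"
    using bounded_funsD[OF assms] shape_funsD(1)[OF bounded_funs_shape[OF assms]] by blast
  moreover have "m A = 0" if "m \<in> shapes k" for m :: "_ \<Rightarrow> 'k"
    using False shape_rep[OF that] size_edge_iso edge_iso_edge_sets
    by (metis shape_indicator_def)
  ultimately show ?thesis by (simp add: sum.neutral)
qed

lemma shape_indicator_bounded:
  "E \<in> edge_sets \<Longrightarrow> (shape_indicator E :: _ \<Rightarrow> 'k::field) \<in> bounded_funs s (s E)"
  using shape_indicator_shape[of E] size_edge_iso[of E]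
  by (auto simp: bounded_funs_def shape_indicator_def split: if_splits)

lemma bounded_funs_span: "bounded_funs s k = fs.span (shapes k)"
proof
  show "fs.span (shapes k) \<subseteq> (bounded_funs s k :: (_ \<Rightarrow> 'k::field) set)"
    using shape_indicator_bounded bounded_funs_mono[of _ k s]
    by (intro fs.span_minimal subspace_bounded_funs) (auto simp: shapes_def)
  show "bounded_funs s k \<subseteq> (fs.span (shapes k) :: (_ \<Rightarrow> 'k::field) set)"
  proof
    fix f :: "_ \<Rightarrow> 'k" assume f: "f \<in> bounded_funs s k"
    have "f = (\<Sum>m\<in>shapes k. fscale (f (shape_rep k m)) m)"
      using shape_expansion[OF f] by (auto simp: fun_eq_iff sum_fun_apply' fscale_def mult.commute)
    also have "\<dots> \<in> fs.span (shapes k)"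
      by (intro fs.span_sum fs.span_scale fs.span_base)
    finally show "f \<in> fs.span (shapes k)" .
  qed
qed

end

definition graph_funs :: "((nat \<times> nat) set \<Rightarrow> 'k::field) set"
  where "graph_funs = fs.span (shape_indicator ` edge_sets)"

lemma subspace_graph_funs: "fs.subspace graph_funs"
  by (simp add: graph_funs_def)

lemma graph_funs_shape: "f \<in> graph_funs \<Longrightarrow> f \<in> shape_funs"
  unfolding graph_funs_def
  using fs.span_minimal[OF _ subspace_shape_funs] shape_indicator_shape by blast

text \<open>Finitely many indicators always have a common bound, so every size function exhausts the
  same space. Later arguments on \<open>graph_funs\<close> may therefore count edges even when the
  filtration is by nodes.\<close>

lemma (in edge_size) graph_funs_eq: "graph_funs = (\<Union>k. bounded_funs s k)"
proof
  show "(\<Union>k. bounded_funs s k) \<subseteq> graph_funs"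
    unfolding graph_funs_def bounded_funs_span by (intro UN_least fs.span_mono) (auto simp: shapes_def)
  show "graph_funs \<subseteq> (\<Union>k. bounded_funs s k)"
  proof
    fix f :: "_ \<Rightarrow> 'k::field" assume "f \<in> graph_funs"
    then show "f \<in> (\<Union>k. bounded_funs s k)"
      unfolding graph_funs_def
    proof (induction rule: fs.span_induct_alt)
      case base
      then show ?case using fs.subspace_0[OF subspace_bounded_funs] by blast
    next
      case (step c x y)
      then obtain E k where "E \<in> edge_sets" "x = shape_indicator E" "y \<in> bounded_funs s k" by blast
      then have "x \<in> bounded_funs s (max (s E) k)" "y \<in> bounded_funs s (max (s E) k)"
        using shape_indicator_bounded[of E] bounded_funs_mono[of "s E" "max (s E) k" s]
          bounded_funs_mono[of k "max (s E) k" s] by auto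
      then show ?case
        by (intro UN_I[of "max (s E) k"] fs.subspace_add[OF subspace_bounded_funs]
          fs.subspace_scale[OF subspace_bounded_funs]) auto
    qed
  qed
qed

lemma card_relabel:
  assumes "E \<in> edge_sets" "relabelling f E"
  shows "card (relabel f E) = card E"
  using assms inj_on_perm_act card_image unfolding relabel_def relabelling_def by blast

text \<open>A common edge would provide a node that is both an even and an odd label.\<close>

lemma even_odd_disjoint:
  assumes "B \<in> edge_sets"
  shows "relabel even_label A \<inter> relabel odd_label B = {}"
proof -
  have "nodes (relabel even_label A \<inter> relabel odd_label B) \<subseteq> even_label ` nodes A \<inter> odd_label ` nodes B"
    unfolding nodes_relabel[symmetric] using nodes_mono by (metis Int_lower1 Int_lower2 Int_greatest)
  then show ?thesis using nodes_dunion_disjoint[OF assms, of A] nodes_eq_empty by blast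
qed

lemma card_dunion:
  assumes "A \<in> edge_sets" "B \<in> edge_sets"
  shows "card (dunion A B) = card A + card B"
proof -
  have "card (relabel even_label A) = card A" "card (relabel odd_label B) = card B"
    using assms by (simp_all add: card_relabel relabelling_even relabelling_odd)
  moreover have "relabel even_label A \<inter> relabel odd_label B = {}"
    using assms(2) by (rule even_odd_disjoint)
  moreover have "finite (relabel even_label A)" "finite (relabel odd_label B)"
    using assms by (auto simp: relabel_def dest: edge_setsD(1))
  ultimately show ?thesis unfolding dunion_def by (simp add: card_Un_disjoint)
qed

interpretation edge_count: edge_size card
proof
  fix E assume E: "E \<in> edge_sets"
  have "card (nodes E) \<le> card (fst ` E) + card (snd ` E)" unfolding nodes_def by (rule card_Un_le)
  also have "\<dots> \<le> card E + card E"
    using edge_setsD(1)[OF E] by (intro add_mono card_image_le)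
  finally show "card (nodes E) \<le> 2 * card E" by simp
qed (erule (1) card_relabel, rule card_Un_le, erule (1) card_dunion)

interpretation node_count: edge_size "\<lambda>E. card (nodes E)"
proof
  fix E f assume "E \<in> edge_sets" "relabelling f E"
  then show "card (nodes (relabel f E)) = card (nodes E)"
    by (simp add: nodes_relabel relabelling_def card_image)
next
  fix A B assume AB: "A \<in> edge_sets" "B \<in> edge_sets"
  show "card (nodes (dunion A B)) = card (nodes A) + card (nodes B)"
    using relabelling_even[OF AB(1)] relabelling_odd[OF AB(2)]
      edge_setsD(4)[OF AB(1)] edge_setsD(4)[OF AB(2)] nodes_dunion_disjoint[OF AB(2), of A]
    by (simp add: nodes_dunion card_Un_disjoint relabelling_def card_image)
qed (unfold nodes_Un, rule card_Un_le, simp)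

section \<open>The Hopf algebra of invariant functions\<close>

text \<open>This instance for the scalars, \<open>a * (b * x) = a * b * x\<close>, loops with \<open>mult.assoc\<close>.\<close>

declare fk.vs2.scale_scale [simp del]

section \<open>Computing maps out of the tensor product\<close>

lemma tensor_add_left: "(u + u') \<otimes> v = u \<otimes> v + u' \<otimes> v"
  by (rule ext) (simp add: tensor_def case_prod_beta distrib_right)

lemma tensor_add_right: "u \<otimes> (v + v') = u \<otimes> v + u \<otimes> v'"
  by (rule ext) (simp add: tensor_def case_prod_beta distrib_left)

lemma tensor_scale_right: "u \<otimes> fscale c v = fscale c (u \<otimes> v)"
  by (rule ext) (simp add: tensor_def fscale_def case_prod_beta mult.left_commute)

lemma subspace_tensor_space: "fs.subspace (tensor_space U V)"
  by (simp add: tensor_space_def)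

lemma tensor_in_tensor_space: "u \<in> U \<Longrightarrow> v \<in> V \<Longrightarrow> u \<otimes> v \<in> tensor_space U V"
  unfolding tensor_space_def by (intro fs.span_base) blast

lemma tensor_space_mono: "U \<subseteq> U' \<Longrightarrow> V \<subseteq> V' \<Longrightarrow> tensor_space U V \<subseteq> tensor_space U' V'"
  unfolding tensor_space_def by (intro fs.span_mono) blast

text \<open>If \<open>\<beta>\<close> is a linear map \<open>L\<close> evaluated at pure tensors,
  then it inherits bilinearity from \<open>\<otimes>\<close>, so the lift is well defined and equals
  \<open>L\<close> by linearity. Each Hopf axiom thus needs only a formula for \<open>L\<close> in
  terms of the values of a function of two arguments.\<close>

lemma tensor_lift_eqI:
  assumes s: "vector_space s" and U: "fs.subspace U" and V: "fs.subspace V"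
    and L: "linear_on s (tensor_space U V) L"
    and \<beta>: "\<And>u v. u \<in> U \<Longrightarrow> v \<in> V \<Longrightarrow> \<beta> u v = L (u \<otimes> v)"
    and t: "t \<in> tensor_space U V"
  shows "tensor_lift U V \<beta> t = L t"
proof -
  have "bilinear_on s U V \<beta>"
    unfolding bilinear_on_def linear_on_def
  proof (intro conjI ballI allI)
    fix u v v' c assume "u \<in> U" "v \<in> V" "v' \<in> V"
    then show "\<beta> u (v + v') = \<beta> u v + \<beta> u v'"
      using L fs.subspace_add[OF V]
      by (simp add: \<beta> tensor_add_right linear_on_def tensor_in_tensor_space del: plus_fun_apply)
  next
    fix u v c assume "u \<in> U" "v \<in> V"
    then show "\<beta> u (fscale c v) = s c (\<beta> u v)" "\<beta> (fscale c u) v = s c (\<beta> u v)"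
      using L fs.subspace_scale[OF V] fs.subspace_scale[OF U]
      by (simp_all add: \<beta> tensor_scale_right tensor_scale_left linear_on_def tensor_in_tensor_space)
  next
    fix u u' v assume "u \<in> U" "u' \<in> U" "v \<in> V"
    then show "\<beta> (u + u') v = \<beta> u v + \<beta> u' v"
      using L fs.subspace_add[OF U]
      by (simp add: \<beta> tensor_add_left linear_on_def tensor_in_tensor_space del: plus_fun_apply)
  qed
  note lift = tensor_lift_sum_list[OF s U V this]
  from tensor_space_sum_list[OF U t] obtain ps
    where ps: "set ps \<subseteq> U \<times> V" "t = (\<Sum>(u, v)\<leftarrow>ps. u \<otimes> v)" .
  have "(\<Sum>(u, v)\<leftarrow>ps. u \<otimes> v) \<in> tensor_space U V \<and>
      L (\<Sum>(u, v)\<leftarrow>ps. u \<otimes> v) = (\<Sum>(u, v)\<leftarrow>ps. \<beta> u v)"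
    using ps(1)
  proof (induction ps)
    case Nil
    then show ?case
      using linear_on_zero[OF s subspace_tensor_space L] fs.subspace_0[OF subspace_tensor_space]
      by (simp del: zero_fun_apply)
  next
    case (Cons p ps)
    then show ?case
      using L \<beta>
      by (auto simp: linear_on_def tensor_in_tensor_space simp del: plus_fun_apply
          intro: fs.subspace_add[OF subspace_tensor_space])
  qed
  then show ?thesis using lift[OF ps(1)] ps(2) by simp
qed

lemma vector_space_fscale: "vector_space fscale"
  by unfold_locales

lemma tensor_lift_fscale_eqI:
  assumes "fs.subspace U" "fs.subspace V" "linear_on fscale UNIV L"
    and "\<And>u v. u \<in> U \<Longrightarrow> v \<in> V \<Longrightarrow> \<beta> u v = L (u \<otimes> v)" "t \<in> tensor_space U V"
  shows "tensor_lift U V \<beta> t = L t"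
  by (rule tensor_lift_eqI[where L = L, OF vector_space_fscale assms(1,2)])
    (use assms(3-5) in \<open>auto simp: linear_on_def\<close>)

subsection \<open>Product\<close>

lemma amb_mult_infinite: "infinite E \<Longrightarrow> amb_mult f g E = 0"
  by (simp add: amb_mult_covers infinite_covers)

lemma amb_mult_commute: "amb_mult f g = amb_mult g f"
proof
  fix E show "amb_mult f g E = amb_mult g f E"
    unfolding amb_mult_covers by (subst sum_covers_swap) (simp add: mult.commute)
qed

lemma amb_mult_add_left: "amb_mult (f + f') g = amb_mult f g + amb_mult f' g"
  by (rule ext) (simp add: amb_mult_covers case_prod_beta distrib_right sum.distrib)

lemma amb_mult_scale_left: "amb_mult (fscale c f) g = fscale c (amb_mult f g)"
  by (rule ext) (simp add: amb_mult_covers fscale_def case_prod_beta sum_distrib_left mult.assoc)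

lemma amb_mult_assoc: "amb_mult (amb_mult f g) h = amb_mult f (amb_mult g h)"
proof
  fix E
  show "amb_mult (amb_mult f g) h E = amb_mult f (amb_mult g h) E"
  proof (cases "finite E")
    case True
    then have fin: "finite (covers E)" "\<And>A B. (A, B) \<in> covers E \<Longrightarrow> finite (covers A) \<and> finite (covers B)"
      by (auto simp: covers_def intro!: finite_covers[unfolded covers_def])
    have "amb_mult (amb_mult f g) h E = (\<Sum>DC\<in>covers E. \<Sum>AB\<in>covers (fst DC). f (fst AB) * g (snd AB) * h (snd DC))"
      by (simp add: amb_mult_covers case_prod_beta sum_distrib_right)
    also have "\<dots> = (\<Sum>(DC, AB)\<in>Sigma (covers E) (\<lambda>DC. covers (fst DC)). f (fst AB) * g (snd AB) * h (snd DC))"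
      using fin by (intro sum.Sigma) auto
    \<comment> \<open>Both sides run over triples A, B, C with union \<open>E\<close>; the auxiliary
      set is A \<union> B on the left and B \<union> C on the right.\<close>
    also have "\<dots> = (\<Sum>(AD, BC)\<in>Sigma (covers E) (\<lambda>AD. covers (snd AD)). f (fst AD) * (g (fst BC) * h (snd BC)))"
      by (rule sum.reindex_bij_witness[where
            j = "\<lambda>((D, C), (A, B)). ((A, B \<union> C), (B, C))" and
            i = "\<lambda>((A, D), (B, C)). ((A \<union> B, C), (A, B))"])
        (clarsimp simp: covers_def Un_assoc mult.assoc)+
    also have "\<dots> = (\<Sum>AD\<in>covers E. \<Sum>BC\<in>covers (snd AD). f (fst AD) * (g (fst BC) * h (snd BC)))"
      using fin by (intro sum.Sigma[symmetric]) auto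
    also have "\<dots> = amb_mult f (amb_mult g h) E"
      by (simp add: amb_mult_covers case_prod_beta sum_distrib_left)
    finally show ?thesis .
  qed (simp add: amb_mult_infinite)
qed

lemma amb_mult_one_left:
  assumes "\<And>E. infinite E \<Longrightarrow> f E = 0"
  shows "amb_mult amb_one f = f"
proof
  fix E
  show "amb_mult amb_one f E = f E"
  proof (cases "finite E")
    case True
    have "amb_mult amb_one f E = (\<Sum>p\<in>covers E. if p = ({}, E) then f E else 0)"
      unfolding amb_mult_covers by (rule sum.cong) (auto simp: covers_def amb_one_def split: if_splits)
    also have "\<dots> = f E"
      using finite_covers[OF True] by (simp add: covers_def)
    finally show ?thesis .
  qed (simp add: assms amb_mult_infinite)
qed

lemma covers_edge_sets: "E \<in> edge_sets \<Longrightarrow> (A, B) \<in> covers E \<Longrightarrow> A \<in> edge_sets \<and> B \<in> edge_sets"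
  unfolding covers_def by auto

lemma amb_mult_nonzero:
  assumes "amb_mult f g E \<noteq> 0"
  obtains A B where "A \<union> B = E" "f A \<noteq> 0" "g B \<noteq> 0"
proof -
  from assms obtain p where "p \<in> covers E" "(case p of (A, B) \<Rightarrow> f A * g B) \<noteq> 0"
    unfolding amb_mult_covers by (rule sum.not_neutral_contains_not_neutral)
  then show thesis using that by (auto simp: covers_def)
qed

lemma amb_mult_shape:
  assumes f: "f \<in> shape_funs" and g: "g \<in> shape_funs"
  shows "amb_mult f g \<in> shape_funs"
proof (rule shape_funsI)
  fix E :: "(nat \<times> nat) set" assume "E \<notin> edge_sets"
  then show "amb_mult f g E = 0"
    using shape_funsD(1)[OF f] shape_funsD(1)[OF g] by (metis amb_mult_nonzero edge_sets_Un)
next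
  fix E h assume E: "E \<in> edge_sets" "relabelling h E"
  show "amb_mult f g (relabel h E) = amb_mult f g E"
    unfolding amb_mult_covers sum_covers_relabel[OF E]
  proof (rule sum.cong[OF refl], clarify)
    fix A B assume "(A, B) \<in> covers E"
    then have "A \<in> edge_sets" "B \<in> edge_sets" "relabelling h A" "relabelling h B"
      using covers_edge_sets[OF E(1)] relabelling_subset[OF E(2)] by (auto simp: covers_def)
    then show "f (relabel h A) * g (relabel h B) = f A * g B"
      using shape_funsD(3)[OF f] shape_funsD(3)[OF g] by simp
  qed
qed

lemma (in edge_size) amb_mult_bounded:
  assumes f: "f \<in> bounded_funs s k" and g: "g \<in> bounded_funs s l"
  shows "amb_mult f g \<in> bounded_funs s (k + l)"
proof -
  have "s E \<le> k + l" if "amb_mult f g E \<noteq> 0" for E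
  proof -
    from that obtain A B where AB: "A \<union> B = E" "f A \<noteq> 0" "g B \<noteq> 0" by (rule amb_mult_nonzero)
    then have "A \<in> edge_sets" "B \<in> edge_sets"
      using shape_funsD(1) bounded_funs_shape f g by blast+
    then show ?thesis
      using size_Un[of A B] bounded_funsD[OF f AB(2)] bounded_funsD[OF g AB(3)] AB(1) by simp
  qed
  then show ?thesis
    using amb_mult_shape[OF bounded_funs_shape[OF f] bounded_funs_shape[OF g]]
    by (simp add: bounded_funs_def)
qed

lemma (in edge_size) amb_one_bounded: "amb_one \<in> bounded_funs s 0"
  using shape_indicator_bounded[of "{}"] by (simp add: shape_indicator_empty size_empty)

lemma graph_funs_finite: "f \<in> graph_funs \<Longrightarrow> infinite E \<Longrightarrow> f E = 0"
  using shape_funsD(1)[OF graph_funs_shape] by (auto dest: edge_setsD(1))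

lemma algebra_graph_funs: "algebra_on graph_funs amb_mult amb_one"
proof
  show "fs.subspace graph_funs" by (rule subspace_graph_funs)
  show "amb_mult x y \<in> graph_funs" if "x \<in> graph_funs" "y \<in> graph_funs" for x y :: "_ \<Rightarrow> 'a"
    using that edge_count.amb_mult_bounded unfolding edge_count.graph_funs_eq by blast
  show "amb_one \<in> graph_funs"
    unfolding edge_count.graph_funs_eq using edge_count.amb_one_bounded by blast
  show "bilinear_on fscale graph_funs graph_funs amb_mult"
    unfolding bilinear_on_def linear_on_def
    by (metis amb_mult_add_left amb_mult_scale_left amb_mult_commute)
  show "amb_mult amb_one x = x" "amb_mult x amb_one = x" if "x \<in> graph_funs" for x :: "_ \<Rightarrow> 'a"
    using amb_mult_one_left[of x] graph_funs_finite[OF that] by (auto simp: amb_mult_commute)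
qed (rule amb_mult_assoc)

subsection \<open>Coproduct\<close>

text \<open>The guard matters because relabelling sorts pairs: \<open>{(2, 1)}\<close> is not an
  edge set, yet \<open>dunion {(2, 1)} {}\<close> is one.\<close>

definition split_fun :: "((nat \<times> nat) set \<Rightarrow> 'k::field) \<Rightarrow> (nat \<times> nat) set \<times> (nat \<times> nat) set \<Rightarrow> 'k"
  where "split_fun f = (\<lambda>(A, B). if A \<in> edge_sets \<and> B \<in> edge_sets then f (dunion A B) else 0)"

lemma split_fun_add: "split_fun (f + g) = split_fun f + split_fun g"
  by (rule ext) (simp add: split_fun_def case_prod_beta)

lemma split_fun_scale: "split_fun (fscale c f) = fscale c (split_fun f)"
  by (rule ext) (simp add: split_fun_def fscale_def case_prod_beta)

lemma split_fun_commute: "f \<in> shape_funs \<Longrightarrow> split_fun f (A, B) = split_fun f (B, A)"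
  using shape_funsD(2)[OF _ dunion_edge_sets dunion_commute, of f A B] by (auto simp: split_fun_def)

lemma split_fun_empty: "f \<in> shape_funs \<Longrightarrow> split_fun f (A, {}) = f A"
  using shape_funsD(1)[of f A] shape_funsD(2)[OF _ _ dunion_empty_right, of f A]
  by (auto simp: split_fun_def)

lemma split_fun_relabel:
  assumes "f \<in> shape_funs" "A \<in> edge_sets" "relabelling h A"
  shows "split_fun f (relabel h A, B) = split_fun f (A, B)"
proof (cases "B \<in> edge_sets")
  case True
  then have "relabelling id B" "relabel id B = B"
    using edge_setsD(5) by (auto simp: relabelling_def intro!: relabel_id)
  then have "edge_iso (dunion A B) (dunion (relabel h A) B)"
    using dunion_relabel[OF assms(2,3) True, of id] by simp
  then show ?thesis
    using assms True relabel_edge_sets shape_funsD(2)[OF assms(1) dunion_edge_sets]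
    by (simp add: split_fun_def)
qed (simp add: split_fun_def)

lemma slice_shape:
  assumes "f \<in> shape_funs"
  shows "(\<lambda>A. split_fun f (A, B)) \<in> shape_funs"
  by (rule shape_funsI) (simp_all add: split_fun_relabel[OF assms], simp add: split_fun_def)

lemma split_fun_relabel_right:
  assumes "f \<in> shape_funs" "B \<in> edge_sets" "relabelling h B"
  shows "split_fun f (A, relabel h B) = split_fun f (A, B)"
  using split_fun_relabel[OF assms] split_fun_commute[OF assms(1)] by metis

text \<open>Additivity of the size on disjoint unions: freezing \<open>B\<close> uses up
  \<open>s B\<close> of the bound. The third claim handles the case where the subtraction
  \<open>k - s B\<close> is truncated.\<close>

lemma (in edge_size) slice_bounded:
  assumes f: "f \<in> bounded_funs s k"
  shows "(\<lambda>A. split_fun f (A, B)) \<in> bounded_funs s (k - s B)"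
    and "(\<lambda>A. split_fun f (B, A)) \<in> bounded_funs s (k - s B)"
    and "s B > k \<Longrightarrow> split_fun f (A, B) = 0"
proof -
  have *: "s A + s B \<le> k" if "split_fun f (A, B) \<noteq> 0" for A
  proof -
    from that have "A \<in> edge_sets" "B \<in> edge_sets" "f (dunion A B) \<noteq> 0"
      by (auto simp: split_fun_def split: if_splits)
    then show ?thesis using bounded_funsD[OF f] size_dunion[of A B] by metis
  qed
  then show "(\<lambda>A. split_fun f (A, B)) \<in> bounded_funs s (k - s B)"
    using slice_shape[OF bounded_funs_shape[OF f]] by (fastforce simp: bounded_funs_def)
  then show "(\<lambda>A. split_fun f (B, A)) \<in> bounded_funs s (k - s B)"
    by (simp add: split_fun_commute[OF bounded_funs_shape[OF f], of B])
  show "s B > k \<Longrightarrow> split_fun f (A, B) = 0"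
    using * by fastforce
qed

text \<open>Expanding in the first argument gives a finite sum of indicators times slices. If the
  representative of the class has size i, then the slice has bound \<open>k - i\<close>, which is
  exactly the grading required of the filtration.\<close>

lemma (in edge_size) split_fun_span:
  assumes f: "f \<in> bounded_funs s k"
  shows "split_fun f \<in> fs.span (\<Union>i\<in>{0..k}. tensor_space (bounded_funs s i) (bounded_funs s (k - i)))"
proof -
  have "split_fun f = (\<Sum>m\<in>shapes k. m \<otimes> (\<lambda>B. split_fun f (shape_rep k m, B)))"
  proof (rule ext, clarify)
    fix A B
    have "(\<lambda>A. split_fun f (A, B)) \<in> bounded_funs s k"
      using slice_bounded(1)[OF f] bounded_funs_mono[of "k - s B" k s] by auto
    from shape_expansion[OF this, of A]
    show "split_fun f (A, B) = (\<Sum>m\<in>shapes k. m \<otimes> (\<lambda>B. split_fun f (shape_rep k m, B))) (A, B)"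
      by (simp add: sum_fun_apply' tensor_def)
  qed
  also have "\<dots> \<in> fs.span (\<Union>i\<in>{0..k}. tensor_space (bounded_funs s i) (bounded_funs s (k - i)))"
  proof (intro fs.span_sum fs.span_base UN_I tensor_in_tensor_space)
    fix m :: "_ \<Rightarrow> 'a" assume m: "m \<in> shapes k"
    show "s (shape_rep k m) \<in> {0..k}" using shape_rep(2)[OF m] by simp
    show "m \<in> bounded_funs s (s (shape_rep k m))"
      using shape_indicator_bounded[OF shape_rep(1)[OF m], where 'k = 'a] shape_rep(3)[OF m] by simp
    show "(\<lambda>B. split_fun f (shape_rep k m, B)) \<in> bounded_funs s (k - s (shape_rep k m))"
      by (rule slice_bounded(2)[OF f])
  qed
  finally show ?thesis .
qed

lemma split_fun_tensor_space:
  assumes "f \<in> graph_funs"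
  shows "split_fun f \<in> tensor_space graph_funs graph_funs"
proof -
  from assms obtain k where "f \<in> bounded_funs card k" by (auto simp: edge_count.graph_funs_eq)
  note edge_count.split_fun_span[OF this]
  moreover have "tensor_space (bounded_funs card i) (bounded_funs card (k - i)) \<subseteq> tensor_space graph_funs (graph_funs :: (_ \<Rightarrow> 'a) set)" for i
    by (rule tensor_space_mono) (auto simp: edge_count.graph_funs_eq)
  ultimately show ?thesis
    using fs.span_minimal[OF _ subspace_tensor_space] by (metis (no_types, lifting) UN_least subsetD)
qed

text \<open>\<open>\<Delta>\<close> and \<open>\<epsilon>\<close> are kept abstract because
  \<open>coproduct\<close> and \<open>counit\<close> are linear extensions from a basis of a
  subspace, and are compared with the explicit formulas only on \<open>graph_funs\<close>.\<close>

lemma coalgebra_graph_funs: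
  assumes \<Delta>: "\<And>f. f \<in> graph_funs \<Longrightarrow> \<Delta> f = split_fun f"
    and \<epsilon>: "\<And>f. f \<in> graph_funs \<Longrightarrow> \<epsilon> f = f {}"
  shows "coalgebra_on (graph_funs :: (_ \<Rightarrow> 'k::field) set) \<Delta> \<epsilon>"
proof
  show sub: "fs.subspace (graph_funs :: (_ \<Rightarrow> 'k) set)" by (rule subspace_graph_funs)
  show "linear_on fscale graph_funs \<Delta>"
    using fs.subspace_add[OF sub] fs.subspace_scale[OF sub]
    by (simp add: linear_on_def \<Delta> split_fun_add split_fun_scale del: plus_fun_apply)
  show "linear_on (*) graph_funs \<epsilon>"
    using fs.subspace_add[OF sub] fs.subspace_scale[OF sub]
    by (simp add: linear_on_def \<epsilon>) (simp add: fscale_def)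
  fix f :: "_ \<Rightarrow> 'k" assume f: "f \<in> graph_funs"
  note shape = graph_funs_shape[OF f]
  note t = split_fun_tensor_space[OF f]
  show "\<Delta> f \<in> tensor_space graph_funs graph_funs"
    using t by (simp add: \<Delta>[OF f])
  \<comment> \<open>Applying \<Delta> to the left factor means replacing the first argument by a
    disjoint union; the guard is the one inside \<open>split_fun\<close>.\<close>
  have "tensor_lift graph_funs graph_funs (\<lambda>a b. \<Delta> a \<otimes> b) (split_fun f)
      = (\<lambda>((A, B), C). if A \<in> edge_sets \<and> B \<in> edge_sets then split_fun f (dunion A B, C) else 0)"
    by (rule tensor_lift_fscale_eqI[OF sub sub _ _ t, where
        L = "\<lambda>t ((A, B), C). if A \<in> edge_sets \<and> B \<in> edge_sets then t (dunion A B, C) else 0"])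
      (auto simp: linear_on_def fscale_def tensor_def \<Delta> split_fun_def)
  moreover have "tensor_lift graph_funs graph_funs (\<lambda>a b. a \<otimes> \<Delta> b) (split_fun f)
      = (\<lambda>(A, B, C). if B \<in> edge_sets \<and> C \<in> edge_sets then split_fun f (A, dunion B C) else 0)"
    by (rule tensor_lift_fscale_eqI[OF sub sub _ _ t, where
        L = "\<lambda>t (A, B, C). if B \<in> edge_sets \<and> C \<in> edge_sets then t (A, dunion B C) else 0"])
      (auto simp: linear_on_def fscale_def tensor_def \<Delta> split_fun_def)
  moreover have "f (dunion A (dunion B C)) = f (dunion (dunion A B) C)"
    if "A \<in> edge_sets" "B \<in> edge_sets" "C \<in> edge_sets" for A B C
    using that dunion_assoc shape_funsD(2)[OF shape] dunion_edge_sets by metis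
  ultimately show "tensor_assoc (tensor_lift graph_funs graph_funs (\<lambda>a b. \<Delta> a \<otimes> b) (\<Delta> f))
      = tensor_lift graph_funs graph_funs (\<lambda>a b. a \<otimes> \<Delta> b) (\<Delta> f)"
    by (auto simp: \<Delta>[OF f] tensor_assoc_def fun_eq_iff split_fun_def dunion_edge_sets)
  have "tensor_lift graph_funs graph_funs (\<lambda>a b. fscale (\<epsilon> a) b) (split_fun f) = (\<lambda>B. split_fun f ({}, B))"
    by (rule tensor_lift_fscale_eqI[OF sub sub _ _ t, where L = "\<lambda>t B. t ({}, B)"])
      (auto simp: linear_on_def fscale_def tensor_def \<epsilon>)
  then show "tensor_lift graph_funs graph_funs (\<lambda>a b. fscale (\<epsilon> a) b) (\<Delta> f) = f"
    by (simp add: \<Delta>[OF f] split_fun_commute[OF shape, of "{}"] split_fun_empty[OF shape])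
  have "tensor_lift graph_funs graph_funs (\<lambda>a b. fscale (\<epsilon> b) a) (split_fun f) = (\<lambda>A. split_fun f (A, {}))"
    by (rule tensor_lift_fscale_eqI[OF sub sub _ _ t, where L = "\<lambda>t A. t (A, {})"])
      (auto simp: linear_on_def fscale_def tensor_def \<epsilon>)
  then show "tensor_lift graph_funs graph_funs (\<lambda>a b. fscale (\<epsilon> b) a) (\<Delta> f) = f"
    by (simp add: \<Delta>[OF f] split_fun_empty[OF shape])
qed

section \<open>Compatibility of product and coproduct\<close>

lemma sum_covers_dunion:
  assumes "A \<in> edge_sets" "B \<in> edge_sets"
  shows "(\<Sum>(X, Y)\<in>covers (dunion A B). h X Y)
    = (\<Sum>(X, Y)\<in>covers A. \<Sum>(X', Y')\<in>covers B. h (dunion X X') (dunion Y Y'))"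
proof -
  \<comment> \<open>\<open>P X\<close> and \<open>Q X\<close> are the parts of \<open>X\<close> in
    the even and in the odd copy, pulled back to \<open>A\<close> and \<open>B\<close>. They invert
    \<open>dunion\<close> because the copies are disjoint and relabelling is injective on
    edges.\<close>
  define P where "P X = {e \<in> A. perm_act even_label e \<in> X}" for X
  define Q where "Q X = {e \<in> B. perm_act odd_label e \<in> X}" for X
  have dPQ: "dunion (P X) (Q X) = X" if "X \<subseteq> dunion A B" for X
    using that by (auto simp: P_def Q_def dunion_def relabel_def)
  have disj: "perm_act even_label e \<noteq> perm_act odd_label e'" if "e \<in> A" "e' \<in> B" for e e'
    using even_odd_disjoint[OF assms(2), of A] that unfolding relabel_def by blast
  have inj: "inj_on (perm_act even_label) A" "inj_on (perm_act odd_label) B"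
    using assms relabelling_even relabelling_odd inj_on_perm_act by (auto simp: relabelling_def)
  have Pd: "P (dunion X X') = X" if "X \<subseteq> A" "X' \<subseteq> B" for X X'
  proof -
    have "perm_act even_label e \<in> dunion X X' \<longleftrightarrow> e \<in> X" if "e \<in> A" for e
      using inj_on_image_mem_iff[OF inj(1) that \<open>X \<subseteq> A\<close>] disj[OF that] \<open>X' \<subseteq> B\<close>
      by (auto simp: dunion_def relabel_def)
    then show ?thesis using that by (auto simp: P_def)
  qed
  have Qd: "Q (dunion X X') = X'" if "X \<subseteq> A" "X' \<subseteq> B" for X X'
  proof -
    have "perm_act odd_label e \<in> dunion X X' \<longleftrightarrow> e \<in> X'" if "e \<in> B" for e
      using inj_on_image_mem_iff[OF inj(2) that \<open>X' \<subseteq> B\<close>] disj[OF _ that] \<open>X \<subseteq> A\<close>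
      by (fastforce simp: dunion_def relabel_def)
    then show ?thesis using that by (auto simp: Q_def)
  qed
  have PQ_Un: "P X \<union> P Y = A" "Q X \<union> Q Y = B" if "X \<union> Y = dunion A B" for X Y
    using that by (auto simp: P_def Q_def dunion_def relabel_def)
  have "(\<Sum>(X, Y)\<in>covers (dunion A B). h X Y)
      = (\<Sum>((X, Y), (X', Y'))\<in>covers A \<times> covers B. h (dunion X X') (dunion Y Y'))"
  proof (rule sum.reindex_bij_witness[where i = "\<lambda>((X, Y), (X', Y')). (dunion X X', dunion Y Y')"
        and j = "\<lambda>(X, Y). ((P X, P Y), (Q X, Q Y))"])
    fix XY assume "XY \<in> covers (dunion A B)"
    then obtain X Y where XY: "XY = (X, Y)" "X \<union> Y = dunion A B" by (auto simp: covers_def)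
    then have "dunion (P X) (Q X) = X" "dunion (P Y) (Q Y) = Y" by (auto intro!: dPQ)
    then show "(\<lambda>((X, Y), (X', Y')). (dunion X X', dunion Y Y')) ((\<lambda>(X, Y). ((P X, P Y), (Q X, Q Y))) XY) = XY"
      "(\<lambda>((X, Y), (X', Y')). h (dunion X X') (dunion Y Y')) ((\<lambda>(X, Y). ((P X, P Y), (Q X, Q Y))) XY)
        = (\<lambda>(X, Y). h X Y) XY"
      by (simp_all add: XY(1))
    show "(\<lambda>(X, Y). ((P X, P Y), (Q X, Q Y))) XY \<in> covers A \<times> covers B"
      using PQ_Un[OF XY(2)] by (simp add: XY(1) covers_def)
  next
    fix Z assume "Z \<in> covers A \<times> covers B"
    then obtain X Y X' Y' where Z: "Z = ((X, Y), (X', Y'))" "X \<union> Y = A" "X' \<union> Y' = B"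
      by (auto simp: covers_def)
    then have "X \<subseteq> A" "Y \<subseteq> A" "X' \<subseteq> B" "Y' \<subseteq> B" by auto
    then show "(\<lambda>(X, Y). ((P X, P Y), (Q X, Q Y))) ((\<lambda>((X, Y), (X', Y')). (dunion X X', dunion Y Y')) Z) = Z"
      by (simp add: Z(1) Pd Qd)
    show "(\<lambda>((X, Y), (X', Y')). (dunion X X', dunion Y Y')) Z \<in> covers (dunion A B)"
      using dunion_Un[of X Y X' Y'] by (simp add: Z covers_def)
  qed
  also have "\<dots> = (\<Sum>(X, Y)\<in>covers A. \<Sum>(X', Y')\<in>covers B. h (dunion X X') (dunion Y Y'))"
    by (simp add: sum.cartesian_product case_prod_beta)
  finally show ?thesis .
qed

text \<open>The product of the tensor square as a formula on arbitrary functions of two edge sets,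
  so that \<open>tensor_mult\<close> can be evaluated without decomposing its arguments.\<close>

definition pair_mult ::
    "((nat \<times> nat) set \<times> (nat \<times> nat) set \<Rightarrow> 'k::field) \<Rightarrow> ((nat \<times> nat) set \<times> (nat \<times> nat) set \<Rightarrow> 'k) \<Rightarrow>
     ((nat \<times> nat) set \<times> (nat \<times> nat) set \<Rightarrow> 'k)"
  where "pair_mult s t = (\<lambda>(A, B). \<Sum>(X, Y)\<in>covers A. \<Sum>(X', Y')\<in>covers B. s (X, X') * t (Y, Y'))"

lemma pair_mult_linear: "linear_on fscale UNIV (pair_mult s)" "linear_on fscale UNIV (\<lambda>s. pair_mult s t)"
  unfolding linear_on_def
  by (safe; rule ext; simp add: pair_mult_def fscale_def case_prod_beta distrib_left distrib_right
      sum.distrib sum_distrib_left ac_simps)+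

lemma pair_mult_tensor: "pair_mult (a \<otimes> b) (c \<otimes> d) = amb_mult a c \<otimes> amb_mult b d"
  by (rule ext) (simp add: pair_mult_def tensor_def amb_mult_covers case_prod_beta sum_product ac_simps)

lemma tensor_mult_eq:
  assumes H: "fs.subspace H" and s: "s \<in> tensor_space H H" and t: "t \<in> tensor_space H H"
  shows "tensor_mult H amb_mult s t = pair_mult s t"
  unfolding tensor_mult_def
proof (rule tensor_lift_fscale_eqI[OF H H pair_mult_linear(2) _ s])
  fix a b
  show "tensor_lift H H (\<lambda>c d. amb_mult a c \<otimes> amb_mult b d) t = pair_mult (a \<otimes> b) t"
    by (rule tensor_lift_fscale_eqI[OF H H pair_mult_linear(1) _ t]) (simp add: pair_mult_tensor)
qed

lemma split_fun_mult:
  assumes f: "f \<in> shape_funs" and g: "g \<in> shape_funs"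
  shows "split_fun (amb_mult f g) = pair_mult (split_fun f) (split_fun g)"
proof (rule ext, clarify)
  fix A B :: "(nat \<times> nat) set"
  show "split_fun (amb_mult f g) (A, B) = pair_mult (split_fun f) (split_fun g) (A, B)"
  proof (cases "A \<in> edge_sets \<and> B \<in> edge_sets")
    case True
    have "split_fun (amb_mult f g) (A, B)
        = (\<Sum>(X, Y)\<in>covers A. \<Sum>(X', Y')\<in>covers B. f (dunion X X') * g (dunion Y Y'))"
      using True by (simp add: split_fun_def amb_mult_covers sum_covers_dunion)
    also have "\<dots> = (\<Sum>(X, Y)\<in>covers A. \<Sum>(X', Y')\<in>covers B. split_fun f (X, X') * split_fun g (Y, Y'))"
      unfolding case_prod_beta using True
      by (intro sum.cong refl arg_cong2[where f = "(*)"]) (auto simp: split_fun_def covers_def)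
    finally show ?thesis by (simp add: pair_mult_def)
  next
    case False
    \<comment> \<open>Edge sets are closed under union: if \<open>A\<close> is not one, then
      \<open>X\<close> or \<open>Y\<close> is not, and likewise for \<open>B\<close>.\<close>
    have "split_fun f (X, X') * split_fun g (Y, Y') = 0" if "X \<union> Y = A" "X' \<union> Y' = B" for X X' Y Y'
      using False that by (auto simp: split_fun_def)
    then have "pair_mult (split_fun f) (split_fun g) (A, B) = 0"
      unfolding pair_mult_def covers_def by (auto intro!: sum.neutral)
    then show ?thesis using False by (auto simp: split_fun_def)
  qed
qed

lemma split_fun_one: "split_fun amb_one = amb_one \<otimes> amb_one"
  by (auto simp: split_fun_def amb_one_def tensor_def fun_eq_iff)

lemma bialgebra_graph_funs:
  assumes \<Delta>: "\<And>f. f \<in> graph_funs \<Longrightarrow> \<Delta> f = split_fun f"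
    and \<epsilon>: "\<And>f. f \<in> graph_funs \<Longrightarrow> \<epsilon> f = f {}"
  shows "bialgebra_on (graph_funs :: (_ \<Rightarrow> 'k::field) set) amb_mult amb_one \<Delta> \<epsilon>"
proof -
  interpret algebra_on "graph_funs :: (_ \<Rightarrow> 'k) set" amb_mult amb_one by (rule algebra_graph_funs)
  interpret coalgebra_on "graph_funs :: (_ \<Rightarrow> 'k) set" \<Delta> \<epsilon> by (rule coalgebra_graph_funs, erule \<Delta>, erule \<epsilon>)
  have empty: "covers {} = {({}, {})}" by (auto simp: covers_def)
  show ?thesis
  proof
    fix f g :: "_ \<Rightarrow> 'k" assume fg: "f \<in> graph_funs" "g \<in> graph_funs"
    show "\<Delta> (amb_mult f g) = tensor_mult graph_funs amb_mult (\<Delta> f) (\<Delta> g)"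
      using fg by (simp add: \<Delta> mul_closed tensor_mult_eq[OF subspace_graph_funs] split_fun_tensor_space
          split_fun_mult graph_funs_shape)
    show "\<epsilon> (amb_mult f g) = \<epsilon> f * \<epsilon> g"
      using fg by (simp add: \<epsilon> mul_closed amb_mult_covers empty)
  next
    show "\<Delta> amb_one = amb_one \<otimes> amb_one"
      by (simp add: \<Delta> unit_closed split_fun_one)
    show "\<epsilon> amb_one = 1"
      by (simp add: \<epsilon> unit_closed) (simp add: amb_one_def)
  qed
qed

subsection \<open>Antipode\<close>

text \<open>
  The recursion is \<open>S f = \<epsilon>(f) - \<Sum> S(f') f''\<close>, the terms whose \<open>f''\<close> is a multiple of the unit
  being left out; it stabilizes once \<open>n\<close> is at least the number of edges occurring in \<open>f\<close>.
\<close>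

primrec antipode_approx :: "nat \<Rightarrow> ((nat \<times> nat) set \<Rightarrow> 'k::field) \<Rightarrow> (nat \<times> nat) set \<Rightarrow> 'k" where
  "antipode_approx 0 f = fscale (f {}) amb_one"
| "antipode_approx (Suc n) f = (\<lambda>E. f {} * amb_one E -
    (\<Sum>(A, B)\<in>covers E. if B = {} then 0 else antipode_approx n (\<lambda>X. split_fun f (X, B)) A))"

text \<open>By \<open>antipode_approx_stable\<close> every admissible bound gives the same value, so
  the choice is harmless on \<open>graph_funs\<close>.\<close>

definition antipode :: "((nat \<times> nat) set \<Rightarrow> 'k::field) \<Rightarrow> (nat \<times> nat) set \<Rightarrow> 'k"
  where "antipode f = antipode_approx (SOME n. f \<in> bounded_funs card n) f"

lemma antipode_approx_add: "antipode_approx n (f + g) = antipode_approx n f + antipode_approx n g"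
proof (induction n arbitrary: f g)
  case (Suc n)
  have slice: "(\<lambda>X. split_fun (f + g) (X, B)) = (\<lambda>X. split_fun f (X, B)) + (\<lambda>X. split_fun g (X, B))" for B
    by (simp add: split_fun_add fun_eq_iff)
  show ?case
    unfolding antipode_approx.simps slice Suc.IH
    by (auto simp: fun_eq_iff case_prod_beta sum.distrib[symmetric] algebra_simps intro!: sum.cong)
qed (auto simp: fun_eq_iff fscale_def algebra_simps)

lemma antipode_approx_scale: "antipode_approx n (fscale c f) = fscale c (antipode_approx n f)"
proof (induction n arbitrary: f)
  case (Suc n)
  have slice: "(\<lambda>X. split_fun (fscale c f) (X, B)) = fscale c (\<lambda>X. split_fun f (X, B))" for B
    by (subst split_fun_scale) (simp add: fscale_def)
  show ?case
    unfolding antipode_approx.simps slice Suc.IH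
    by (auto simp: fun_eq_iff fscale_def case_prod_beta sum_distrib_left algebra_simps intro!: sum.cong)
qed (auto simp: fun_eq_iff fscale_def)

lemma antipode_approx_zero: "antipode_approx n (\<lambda>E. 0) = (\<lambda>E. 0)"
  using antipode_approx_scale[of n 0 "\<lambda>E. 0"] by (simp add: fscale_def)

lemma antipode_approx_shape:
  assumes "f \<in> shape_funs"
  shows "antipode_approx n f \<in> shape_funs"
  using assms
proof (induction n arbitrary: f)
  case 0
  have "amb_one \<in> (shape_funs :: (_ \<Rightarrow> 'a) set)"
    using edge_count.amb_one_bounded bounded_funs_shape by blast
  then show ?case by (auto intro: fs.subspace_scale[OF subspace_shape_funs])
next
  case (Suc n)
  have one: "amb_one \<in> (shape_funs :: (_ \<Rightarrow> 'a) set)"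
    using edge_count.amb_one_bounded bounded_funs_shape by blast
  note slice = Suc.IH[OF slice_shape[OF Suc.prems]]
  show ?case
  proof (rule shape_funsI)
    fix E :: "(nat \<times> nat) set" assume E: "E \<notin> edge_sets"
    have "antipode_approx n (\<lambda>X. split_fun f (X, B)) A = 0" if "A \<union> B = E" for A B
    proof (cases "A \<in> edge_sets")
      case True
      with E that have "B \<notin> edge_sets" by auto
      then have "(\<lambda>X. split_fun f (X, B)) = (\<lambda>X. 0)" by (simp add: split_fun_def fun_eq_iff)
      then show ?thesis by (simp only: antipode_approx_zero)
    qed (use shape_funsD(1)[OF slice] in blast)
    then show "antipode_approx (Suc n) f E = 0"
      using shape_funsD(1)[OF one E] by (auto simp: covers_def intro!: sum.neutral)
  next
    fix E h assume E: "E \<in> edge_sets" "relabelling h E"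
    \<comment> \<open>One relabelling of \<open>E\<close> moves both members of a cover. The slice
      at \<open>B\<close> is unaffected by invariance of \<open>f\<close>, the value at
      \<open>A\<close> by the induction hypothesis.\<close>
    have "(if relabel h B = {} then 0 else antipode_approx n (\<lambda>X. split_fun f (X, relabel h B)) (relabel h A))
        = (if B = {} then 0 else antipode_approx n (\<lambda>X. split_fun f (X, B)) A)"
      if "(A, B) \<in> covers E" for A B
    proof -
      have "A \<in> edge_sets" "B \<in> edge_sets" "relabelling h A" "relabelling h B"
        using that covers_edge_sets[OF E(1)] relabelling_subset[OF E(2)] by (auto simp: covers_def)
      then show ?thesis
        by (simp add: split_fun_relabel_right[OF Suc.prems] shape_funsD(3)[OF slice])
    qed
    then show "antipode_approx (Suc n) f (relabel h E) = antipode_approx (Suc n) f E"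
      unfolding antipode_approx.simps sum_covers_relabel[OF E] shape_funsD(3)[OF one E]
      by (intro arg_cong2[where f = "(-)"] refl sum.cong) auto
  qed
qed

text \<open>In a nonzero term the induction hypothesis bounds \<open>s A\<close> by
  \<open>k - s B\<close>, and subadditivity on unions gives back the \<open>s B\<close>. The depth
  \<open>n\<close> is arbitrary, so the bound may concern a size other than the one that governs the
  recursion.\<close>

lemma (in edge_size) antipode_approx_bounded:
  assumes "f \<in> bounded_funs s k"
  shows "antipode_approx n f \<in> bounded_funs s k"
proof -
  have "s E \<le> k" if "antipode_approx n f E \<noteq> 0" for E
    using assms that
  proof (induction n arbitrary: f k E)
    case 0
    then show ?case by (simp add: fscale_def amb_one_def size_empty split: if_splits)
  next
    case (Suc n)
    show ?case
    proof (cases "E = {}")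
      case False
      with Suc.prems(2) have "(\<Sum>(A, B)\<in>covers E. if B = {} then 0 else antipode_approx n (\<lambda>X. split_fun f (X, B)) A) \<noteq> 0"
        by (simp add: amb_one_def)
      then obtain p where p: "p \<in> covers E"
        "(case p of (A, B) \<Rightarrow> if B = {} then 0 else antipode_approx n (\<lambda>X. split_fun f (X, B)) A) \<noteq> 0"
        by (rule sum.not_neutral_contains_not_neutral)
      then obtain A B where AB: "A \<union> B = E" "antipode_approx n (\<lambda>X. split_fun f (X, B)) A \<noteq> 0"
        by (auto simp: covers_def split: if_splits)
      \<comment> \<open>A nonzero slice forces \<open>s B \<le> k\<close>; without it the truncated
        difference \<open>k - s B\<close> would not bound the sum of the sizes by
        \<open>k\<close>.\<close>
      have "(\<lambda>X. split_fun f (X, B)) \<noteq> (\<lambda>X. 0)"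
        using AB(2) antipode_approx_zero[of n] by metis
      then have B: "B \<in> edge_sets" "s B \<le> k"
        using slice_bounded(3)[OF Suc.prems(1), of B] by (auto simp: split_fun_def not_le[symmetric])
      have "A \<in> edge_sets"
        using AB(2) shape_funsD(1)[OF antipode_approx_shape[OF slice_shape[OF bounded_funs_shape[OF Suc.prems(1)]]]]
        by blast
      moreover have "s A \<le> k - s B"
        using Suc.IH[OF slice_bounded(1)[OF Suc.prems(1)] AB(2)] .
      ultimately show ?thesis using size_Un[of A B] B AB(1) by simp
    qed (simp add: size_empty)
  qed
  then show ?thesis
    using antipode_approx_shape[OF bounded_funs_shape[OF assms]] by (simp add: bounded_funs_def)
qed

text \<open>The termination argument: each recursive call is on a slice at a nonempty
  \<open>B\<close>, which lowers the bound by at least one edge.\<close>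

lemma slice_bounded_less:
  assumes "f \<in> bounded_funs card (Suc n)" "B \<noteq> {}"
  shows "(\<lambda>X. split_fun f (X, B)) \<in> bounded_funs card n"
proof (cases "B \<in> edge_sets")
  case True
  with assms(2) have "card B > 0" using edge_count.size_pos by blast
  then have "Suc n - card B \<le> n" by simp
  then show ?thesis
    using edge_count.slice_bounded(1)[OF assms(1), of B] bounded_funs_mono by blast
next
  case False
  then have "(\<lambda>X. split_fun f (X, B)) = 0" by (simp add: split_fun_def fun_eq_iff)
  then show ?thesis using fs.subspace_0[OF subspace_bounded_funs] by metis
qed

lemma antipode_approx_stable:
  assumes "f \<in> bounded_funs card n" "n \<le> m"
  shows "antipode_approx m f = antipode_approx n f"
proof -
  have "antipode_approx (Suc n) f = antipode_approx n f" if "f \<in> bounded_funs card n" for f :: "_ \<Rightarrow> 'a" and n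
    using that
  proof (induction n arbitrary: f)
    case 0
    \<comment> \<open>A nonempty \<open>B\<close> already exceeds the bound 0, so at the bottom of
      the recursion nothing is left to subtract.\<close>
    have "(\<lambda>X. split_fun f (X, B)) = (\<lambda>X. 0)" if "B \<noteq> {}" for B
    proof (cases "B \<in> edge_sets")
      case True
      with that have "card B > 0" using edge_count.size_pos by blast
      then show ?thesis using edge_count.slice_bounded(3)[OF 0] by blast
    qed (simp add: split_fun_def fun_eq_iff)
    then have "(if B = {} then 0 else antipode_approx 0 (\<lambda>X. split_fun f (X, B)) A) = 0" for A B
      by (metis antipode_approx_zero)
    then show ?case by (simp add: fun_eq_iff fscale_def del: antipode_approx.simps(1)) (simp add: fscale_def)
  next
    case (Suc n)
    have "(if B = {} then 0 else antipode_approx (Suc n) (\<lambda>X. split_fun f (X, B)) A)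
        = (if B = {} then 0 else antipode_approx n (\<lambda>X. split_fun f (X, B)) A)" for A B
      using Suc.IH[OF slice_bounded_less[OF Suc.prems]] by metis
    then show ?case unfolding antipode_approx.simps(2)[of "Suc n"] antipode_approx.simps(2)[of n]
      by presburger
  qed
  with assms(2,1) show ?thesis
  proof (induction rule: dec_induct)
    case (step m)
    then have "f \<in> bounded_funs card m" using bounded_funs_mono by blast
    with step show ?case by metis
  qed simp
qed

lemma antipode_eq:
  assumes "f \<in> bounded_funs card n"
  shows "antipode f = antipode_approx n f"
proof -
  have "f \<in> bounded_funs card (SOME n. f \<in> bounded_funs card n)" using assms by (rule someI)
  with assms show ?thesis unfolding antipode_def
    using antipode_approx_stable by (metis nat_le_linear)
qed

text \<open>The chosen depth refers to edges, but every depth preserves every size bound; hence the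
  same antipode respects the node filtration.\<close>

lemma (in edge_size) antipode_bounded:
  assumes "f \<in> bounded_funs s k"
  shows "antipode f \<in> bounded_funs s k"
  unfolding antipode_def using assms by (rule antipode_approx_bounded)

lemma antipode_linear: "linear_on fscale graph_funs antipode"
  unfolding linear_on_def
proof (intro conjI ballI allI)
  fix f g :: "_ \<Rightarrow> 'a" assume "f \<in> graph_funs" "g \<in> graph_funs"
  then obtain k l where "f \<in> bounded_funs card k" "g \<in> bounded_funs card l"
    by (auto simp: edge_count.graph_funs_eq)
  \<comment> \<open>Additivity is known for each fixed depth of the recursion, so the two functions
    are first placed under one bound.\<close>
  then have fg: "f \<in> bounded_funs card (k + l)" "g \<in> bounded_funs card (k + l)"
    using bounded_funs_mono[of k "k + l" card] bounded_funs_mono[of l "k + l" card] by auto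
  show "antipode (f + g) = antipode f + antipode g"
    using antipode_eq[OF fg(1)] antipode_eq[OF fg(2)]
      antipode_eq[OF fs.subspace_add[OF subspace_bounded_funs fg]]
    by (simp only: antipode_approx_add)
next
  fix c and f :: "_ \<Rightarrow> 'a" assume "f \<in> graph_funs"
  then obtain k where f: "f \<in> bounded_funs card k" by (auto simp: edge_count.graph_funs_eq)
  show "antipode (fscale c f) = fscale c (antipode f)"
    using antipode_eq[OF f] antipode_eq[OF fs.subspace_scale[OF subspace_bounded_funs f]]
    by (simp only: antipode_approx_scale)
qed

text \<open>The left antipode axiom at the coefficient \<open>E\<close>. The cover with
  \<open>B = {}\<close> contributes \<open>antipode f E\<close>, since freezing the empty set leaves
  \<open>f\<close>; the other covers contribute exactly the sum that the recursion
  subtracts.\<close>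

lemma antipode_convolution:
  assumes "f \<in> graph_funs"
  shows "(\<Sum>(A, B)\<in>covers E. antipode (\<lambda>X. split_fun f (X, B)) A) = f {} * amb_one E"
proof (cases "finite E")
  case True
  from assms obtain n where f: "f \<in> bounded_funs card n" by (auto simp: edge_count.graph_funs_eq)
  note shape = bounded_funs_shape[OF f]
  have "antipode (\<lambda>X. split_fun f (X, B)) A = (if (A, B) = (E, {}) then antipode f E else 0)
      + (if B = {} then 0 else antipode_approx n (\<lambda>X. split_fun f (X, B)) A)"
    if "(A, B) \<in> covers E" for A B
  proof (cases "B = {}")
    case True
    with that show ?thesis by (simp add: covers_def split_fun_empty[OF shape])
  next
    case False
    have "f \<in> bounded_funs card (Suc n)" using f bounded_funs_mono[of n "Suc n" card] by auto
    from antipode_eq[OF slice_bounded_less[OF this False]] False show ?thesis by simp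
  qed
  then have "(\<Sum>(A, B)\<in>covers E. antipode (\<lambda>X. split_fun f (X, B)) A)
      = (\<Sum>(A, B)\<in>covers E. (if (A, B) = (E, {}) then antipode f E else 0)
          + (if B = {} then 0 else antipode_approx n (\<lambda>X. split_fun f (X, B)) A))"
    by (intro sum.cong) auto
  also have "\<dots> = (\<Sum>p\<in>covers E. if p = (E, {}) then antipode f E else 0)
      + (\<Sum>(A, B)\<in>covers E. if B = {} then 0 else antipode_approx n (\<lambda>X. split_fun f (X, B)) A)"
    by (simp add: sum.distrib[symmetric] case_prod_beta prod_eq_iff)
  also have "(\<Sum>p\<in>covers E. if p = (E, {}) then antipode f E else 0) = antipode_approx (Suc n) f E"
    using finite_covers[OF True] antipode_eq[OF f] antipode_approx_stable[OF f, of "Suc n"]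
    by (simp add: covers_def del: antipode_approx.simps)
  finally show ?thesis by simp
qed (auto simp: infinite_covers amb_one_def)

text \<open>The formula for \<open>L\<close> in the antipode axioms applies \<open>antipode\<close>
  to slices of arbitrary tensors. This places those slices in \<open>graph_funs\<close>, where
  linearity of \<open>antipode\<close> is available.\<close>

lemma slice_tensor_space:
  assumes "t \<in> tensor_space U V" "fs.subspace U"
  shows "(\<lambda>A. t (A, B)) \<in> U"
  using assms(1) unfolding tensor_space_def
proof (induction rule: fs.span_induct_alt)
  case base
  then show ?case using fs.subspace_0[OF assms(2)] by (simp add: zero_fun_def)
next
  case (step c x y)
  then obtain u v where uv: "x = u \<otimes> v" "u \<in> U" by blast
  have "(\<lambda>A. (fscale c x + y) (A, B)) = fscale (c * v B) u + (\<lambda>A. y (A, B))"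
    by (simp add: uv(1) tensor_def fscale_def fun_eq_iff)
  then show ?case
    using fs.subspace_add[OF assms(2) fs.subspace_scale[OF assms(2) uv(2)] step(2)] by metis
qed

lemma slice_tensor_space_right:
  assumes "t \<in> tensor_space U V" "fs.subspace V"
  shows "(\<lambda>A. t (B, A)) \<in> V"
  using assms(1) unfolding tensor_space_def
proof (induction rule: fs.span_induct_alt)
  case base
  then show ?case using fs.subspace_0[OF assms(2)] by (simp add: zero_fun_def)
next
  case (step c x y)
  then obtain u v where uv: "x = u \<otimes> v" "v \<in> V" by blast
  have "(\<lambda>A. (fscale c x + y) (B, A)) = fscale (c * u B) v + (\<lambda>A. y (B, A))"
    by (simp add: uv(1) tensor_def fscale_def fun_eq_iff)
  then show ?case
    using fs.subspace_add[OF assms(2) fs.subspace_scale[OF assms(2) uv(2)] step(2)] by metis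
qed

lemma hopf_graph_funs:
  assumes \<Delta>: "\<And>f. f \<in> graph_funs \<Longrightarrow> \<Delta> f = split_fun f"
    and \<epsilon>: "\<And>f. f \<in> graph_funs \<Longrightarrow> \<epsilon> f = f {}"
  shows "hopf_algebra_on (graph_funs :: (_ \<Rightarrow> 'k::field) set) amb_mult amb_one \<Delta> \<epsilon> antipode"
proof -
  let ?H = "graph_funs :: (_ \<Rightarrow> 'k) set"
  interpret bialgebra_on ?H amb_mult amb_one \<Delta> \<epsilon> by (rule bialgebra_graph_funs, erule \<Delta>, erule \<epsilon>)
  have sub: "fs.subspace ?H" by (rule subspace_graph_funs)
  have add: "antipode (\<lambda>X. u X + v X) A = antipode u A + antipode v A"
    if "u \<in> ?H" "v \<in> ?H" for u v A
    using antipode_linear that by (auto simp: linear_on_def plus_fun_def fun_eq_iff)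
  have scale: "antipode (\<lambda>X. c * u X) A = c * antipode u A" if "u \<in> ?H" for c u A
    using antipode_linear that by (auto simp: linear_on_def fscale_def fun_eq_iff)
  have scale': "antipode (\<lambda>X. u X * c) A = c * antipode u A" if "u \<in> ?H" for c u A
    using scale[OF that] by (simp add: mult.commute)
  note slices = slice_tensor_space[OF _ sub] slice_tensor_space_right[OF _ sub]
  show ?thesis
  proof
    fix f :: "_ \<Rightarrow> 'k" assume f: "f \<in> graph_funs"
    show "antipode f \<in> graph_funs"
      using f edge_count.antipode_bounded unfolding edge_count.graph_funs_eq by blast
    note t = split_fun_tensor_space[OF f]
    \<comment> \<open>The general \<open>tensor_lift_eqI\<close> is used, since linearity of this
      \<open>L\<close> is established on the tensor space only and not on all functions of two
      arguments.\<close>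
    have "tensor_lift ?H ?H (\<lambda>a b. amb_mult (antipode a) b) (split_fun f)
        = (\<lambda>E. \<Sum>(A, B)\<in>covers E. antipode (\<lambda>X. split_fun f (X, B)) A)"
      by (rule tensor_lift_eqI[OF vector_space_fscale sub sub _ _ t, where
            L = "\<lambda>t E. \<Sum>(A, B)\<in>covers E. antipode (\<lambda>X. t (X, B)) A"])
        (auto simp: linear_on_def fun_eq_iff fscale_def tensor_def amb_mult_covers case_prod_beta
          add scale scale' slices sum.distrib sum_distrib_left mult.commute)
    then show "tensor_lift ?H ?H (\<lambda>a b. amb_mult (antipode a) b) (\<Delta> f) = fscale (\<epsilon> f) amb_one"
      using f by (simp add: \<Delta> \<epsilon> antipode_convolution fscale_def)
    have "tensor_lift ?H ?H (\<lambda>a b. amb_mult a (antipode b)) (split_fun f)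
        = (\<lambda>E. \<Sum>(A, B)\<in>covers E. antipode (\<lambda>X. split_fun f (A, X)) B)"
      by (rule tensor_lift_eqI[OF vector_space_fscale sub sub _ _ t, where
            L = "\<lambda>t E. \<Sum>(A, B)\<in>covers E. antipode (\<lambda>X. t (A, X)) B"])
        (auto simp: linear_on_def fun_eq_iff fscale_def tensor_def amb_mult_covers case_prod_beta
          add scale slices sum.distrib sum_distrib_left)
    also have "\<dots> = (\<lambda>E. \<Sum>(A, B)\<in>covers E. antipode (\<lambda>X. split_fun f (X, B)) A)"
      by (subst sum_covers_swap) (simp add: split_fun_commute[OF graph_funs_shape[OF f]])
    finally show "tensor_lift ?H ?H (\<lambda>a b. amb_mult a (antipode b)) (\<Delta> f) = fscale (\<epsilon> f) amb_one"
      using f by (simp add: \<Delta> \<epsilon> antipode_convolution fscale_def)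
  qed (rule antipode_linear)
qed

lemma (in edge_size) filtered_hopf_graph_funs:
  assumes \<Delta>: "\<And>f. f \<in> graph_funs \<Longrightarrow> \<Delta> f = split_fun f"
    and \<epsilon>: "\<And>f. f \<in> graph_funs \<Longrightarrow> \<epsilon> f = f {}"
  shows "filtered_hopf_algebra_on (graph_funs :: (_ \<Rightarrow> 'k::field) set) amb_mult amb_one \<Delta> \<epsilon> antipode
    (bounded_funs s)"
proof -
  interpret hopf_algebra_on "graph_funs :: (_ \<Rightarrow> 'k) set" amb_mult amb_one \<Delta> \<epsilon> antipode
    by (rule hopf_graph_funs, erule \<Delta>, erule \<epsilon>)
  show ?thesis
  proof
    show "\<Delta> f \<in> fs.span (\<Union>i\<in>{0..k}. tensor_space (bounded_funs s i) (bounded_funs s (k - i)))"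
      if "f \<in> bounded_funs s k" for f :: "_ \<Rightarrow> 'k" and k
    proof -
      have "f \<in> graph_funs" using that by (auto simp: graph_funs_eq)
      then show ?thesis using split_fun_span[OF that] by (simp only: \<Delta>)
    qed
  qed (simp_all add: subspace_bounded_funs bounded_funs_mono graph_funs_eq amb_one_bounded
      amb_mult_bounded antipode_bounded)
qed

section \<open>Graphs as edge sets\<close>

lemma adjacent_commute: "adjacent G u v \<longleftrightarrow> adjacent G v u"
  by (simp add: adjacent_def insert_commute)

lemma adjacent_verts:
  assumes "simple_graph G" "adjacent G u v"
  shows "u \<in> verts G" "v \<in> verts G" "u \<noteq> v"
  using assms by (auto simp: simple_graph_def adjacent_def doubleton_eq_iff)

lemma no_isolated_simple: "no_isolated G \<Longrightarrow> simple_graph G"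
  by (simp add: no_isolated_def)

lemma graph_iso_refl: "graph_iso G G"
  unfolding graph_iso_def by (intro exI[of _ id]) auto

lemma graph_iso_sym:
  assumes "graph_iso G G'"
  shows "graph_iso G' G"
proof -
  from assms obtain f where f: "bij_betw f (verts G) (verts G')"
    "\<And>u v. u \<in> verts G \<Longrightarrow> v \<in> verts G \<Longrightarrow> adjacent G u v \<longleftrightarrow> adjacent G' (f u) (f v)"
    unfolding graph_iso_def by blast
  let ?g = "inv_into (verts G) f"
  have "bij_betw ?g (verts G') (verts G)" using f(1) by (rule bij_betw_inv_into)
  moreover have "adjacent G' u v \<longleftrightarrow> adjacent G (?g u) (?g v)" if "u \<in> verts G'" "v \<in> verts G'" for u v
    using that f(2)[of "?g u" "?g v"] f(1) by (simp add: bij_betw_def inv_into_into f_inv_into_f)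
  ultimately show ?thesis unfolding graph_iso_def by blast
qed

lemma graph_iso_trans:
  assumes "graph_iso G G'" "graph_iso G' G''"
  shows "graph_iso G G''"
proof -
  from assms obtain f g where f: "bij_betw f (verts G) (verts G')"
    "\<And>u v. u \<in> verts G \<Longrightarrow> v \<in> verts G \<Longrightarrow> adjacent G u v \<longleftrightarrow> adjacent G' (f u) (f v)"
    and g: "bij_betw g (verts G') (verts G'')"
    "\<And>u v. u \<in> verts G' \<Longrightarrow> v \<in> verts G' \<Longrightarrow> adjacent G' u v \<longleftrightarrow> adjacent G'' (g u) (g v)"
    unfolding graph_iso_def by blast
  have "bij_betw (g \<circ> f) (verts G) (verts G'')" using f(1) g(1) by (rule bij_betw_trans)
  moreover have "f u \<in> verts G'" if "u \<in> verts G" for u using f(1) that by (auto simp: bij_betw_def)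
  ultimately show ?thesis unfolding graph_iso_def using f(2) g(2) by (intro exI[of _ "g \<circ> f"]) auto
qed

lemma graph_iso_cong_left:
  assumes "graph_iso G G'"
  shows "graph_iso G H \<longleftrightarrow> graph_iso G' H"
proof
  assume "graph_iso G H"
  with graph_iso_sym[OF assms] show "graph_iso G' H" by (rule graph_iso_trans)
next
  assume "graph_iso G' H"
  with assms show "graph_iso G H" by (rule graph_iso_trans)
qed

lemma graph_iso_card: "graph_iso G G' \<Longrightarrow> card (verts G) = card (verts G')"
  unfolding graph_iso_def by (auto dest: bij_betw_same_card)

lemma graph_iso_one_vertex: "graph_iso G G' \<Longrightarrow> one_vertex G \<longleftrightarrow> one_vertex G'"
  by (simp add: one_vertex_def graph_iso_card)

lemma graph_iso_card_edges:
  assumes "graph_iso G G'" "simple_graph G" "simple_graph G'"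
  shows "card (edges G) = card (edges G')"
proof -
  from assms(1) obtain f where f: "bij_betw f (verts G) (verts G')"
    "\<And>u v. u \<in> verts G \<Longrightarrow> v \<in> verts G \<Longrightarrow> adjacent G u v \<longleftrightarrow> adjacent G' (f u) (f v)"
    unfolding graph_iso_def by blast
  have "edges G' = image f ` edges G"
  proof (intro equalityI subsetI)
    fix e assume e: "e \<in> edges G'"
    then obtain u' v' where "e = {u', v'}" "u' \<in> verts G'" "v' \<in> verts G'"
      using assms(3) by (auto simp: simple_graph_def)
    moreover from this obtain u v where "u \<in> verts G" "v \<in> verts G" "u' = f u" "v' = f v"
      using f(1) by (metis bij_betw_def imageE)
    ultimately show "e \<in> image f ` edges G"
      using f(2)[of u v] e by (intro image_eqI[of _ _ "{u, v}"]) (auto simp: adjacent_def)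
  next
    fix e' assume "e' \<in> image f ` edges G"
    then obtain e where e: "e \<in> edges G" "e' = f ` e" by blast
    then obtain u v where "e = {u, v}" "u \<in> verts G" "v \<in> verts G"
      using assms(2) by (auto simp: simple_graph_def)
    then show "e' \<in> edges G'" using e f(2)[of u v] by (auto simp: adjacent_def)
  qed
  moreover have "inj_on (image f) (edges G)"
  proof (rule inj_on_subset)
    show "inj_on (image f) (Pow (verts G))" using f(1) by (simp add: bij_betw_def inj_on_image_Pow)
    show "edges G \<subseteq> Pow (verts G)" using assms(2) by (auto simp: simple_graph_def)
  qed
  ultimately show ?thesis by (simp add: card_image)
qed

section \<open>Passing between graphs and edge sets\<close>

text \<open>The one-vertex graph, which has no edge, is represented by the empty edge set.\<close>

definition graph_of :: "(nat \<times> nat) set \<Rightarrow> nat ugraph"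
  where "graph_of E = (if E = {} then ({0}, {}) else (nodes E, (\<lambda>(i, j). {i, j}) ` E))"

definition graph_edges :: "('v \<Rightarrow> nat) \<Rightarrow> 'v ugraph \<Rightarrow> (nat \<times> nat) set"
  where "graph_edges h G = {(i, j). i < j \<and>
    (\<exists>u\<in>verts G. \<exists>v\<in>verts G. adjacent G u v \<and> i = h u \<and> j = h v)}"

lemma adjacent_graph_of: "adjacent (graph_of E) u v \<longleftrightarrow> (u, v) \<in> E \<or> (v, u) \<in> E"
  by (force simp: adjacent_def graph_of_def doubleton_eq_iff)

lemma verts_graph_of: "E \<noteq> {} \<Longrightarrow> verts (graph_of E) = nodes E"
  by (simp add: graph_of_def)

lemma card_nodes_ge_2:
  assumes "E \<in> edge_sets" "E \<noteq> {}"
  shows "card (nodes E) \<ge> 2"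
proof -
  from assms(2) obtain i j where "(i, j) \<in> E" by fastforce
  with edge_setsD(3)[OF assms(1)] nodesI have "{i, j} \<subseteq> nodes E" "i \<noteq> j" by blast+
  then show ?thesis using card_mono[OF edge_setsD(4)[OF assms(1)], of "{i, j}"] by simp
qed

lemma one_vertex_graph_of: "E \<in> edge_sets \<Longrightarrow> one_vertex (graph_of E) \<longleftrightarrow> E = {}"
  using card_nodes_ge_2[of E] by (cases "E = {}") (simp_all add: one_vertex_def graph_of_def)

lemma simple_graph_of:
  assumes "E \<in> edge_sets"
  shows "simple_graph (graph_of E)"
proof -
  have "{i, j} \<in> {{u, v} | u v. u \<in> nodes E \<and> v \<in> nodes E \<and> u \<noteq> v}" if "(i, j) \<in> E" for i j
    using nodesI[OF that] edge_setsD(3)[OF assms that] by blast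
  then show ?thesis
    using edge_setsD(4)[OF assms] unfolding simple_graph_def graph_of_def by auto
qed

lemma no_isolated_graph_of:
  assumes "E \<in> edge_sets"
  shows "no_isolated (graph_of E)"
proof (cases "E = {}")
  case True
  then show ?thesis using simple_graph_of[OF assms] one_vertex_graph_of[OF assms]
    by (simp add: no_isolated_def)
next
  case False
  have "\<exists>v\<in>nodes E. adjacent (graph_of E) u v" if "u \<in> nodes E" for u
    using that nodesI unfolding adjacent_graph_of by (metis nodesE)
  then show ?thesis
    using simple_graph_of[OF assms] card_nodes_ge_2[OF assms False]
    by (simp add: no_isolated_def verts_graph_of[OF False])
qed

lemma num_edges_graph_of:
  assumes "E \<in> edge_sets"
  shows "num_edges (graph_of E) = card E"
proof -
  have "inj_on (\<lambda>(i, j). {i, j}) E"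
    by (rule inj_onI) (auto simp: doubleton_eq_iff dest!: edge_setsD(3)[OF assms])
  then show ?thesis by (simp add: num_edges_def graph_of_def card_image)
qed

lemma num_nodes_graph_of: "E \<in> edge_sets \<Longrightarrow> num_nodes (graph_of E) = card (nodes E)"
  using one_vertex_graph_of[of E] by (auto simp: num_nodes_def verts_graph_of)

lemma graph_edges_in:
  assumes "simple_graph G" "inj_on h (verts G)" "0 \<notin> h ` verts G"
  shows "graph_edges h G \<in> edge_sets"
proof -
  have "graph_edges h G \<subseteq> h ` verts G \<times> h ` verts G" by (auto simp: graph_edges_def)
  then have "finite (graph_edges h G)"
    using assms(1) by (elim finite_subset) (simp add: simple_graph_def)
  moreover have "0 < h u" if "u \<in> verts G" for u using assms(3) that by (auto simp: image_iff)
  ultimately show ?thesis by (auto simp: edge_sets_def graph_edges_def)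
qed

lemma graph_edges_adjacent:
  assumes "simple_graph G" "inj_on h (verts G)" "u \<in> verts G" "v \<in> verts G"
  shows "(h u, h v) \<in> graph_edges h G \<or> (h v, h u) \<in> graph_edges h G \<longleftrightarrow> adjacent G u v"
proof
  assume "(h u, h v) \<in> graph_edges h G \<or> (h v, h u) \<in> graph_edges h G"
  then obtain u' v' where "u' \<in> verts G" "v' \<in> verts G" "adjacent G u' v'"
    "h u = h u' \<and> h v = h v' \<or> h v = h u' \<and> h u = h v'"
    unfolding graph_edges_def by blast
  then show "adjacent G u v"
    using assms(2-4) adjacent_commute by (metis inj_onD)
next
  assume *: "adjacent G u v"
  then have "h u \<noteq> h v" using adjacent_verts(3)[OF assms(1)] assms(2-4) by (metis inj_onD)
  then show "(h u, h v) \<in> graph_edges h G \<or> (h v, h u) \<in> graph_edges h G"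
    using * assms(3,4) adjacent_commute[of G u v] unfolding graph_edges_def
    by (cases "h u < h v") auto
qed

text \<open>This is where the absence of isolated vertices enters: each vertex lies on an edge, so
  the edge set still knows all vertices.\<close>

lemma nodes_graph_edges:
  assumes G: "no_isolated G" "\<not> one_vertex G" and h: "inj_on h (verts G)"
  shows "nodes (graph_edges h G) = h ` verts G"
proof
  show "nodes (graph_edges h G) \<subseteq> h ` verts G" by (auto simp: nodes_def graph_edges_def)
  show "h ` verts G \<subseteq> nodes (graph_edges h G)"
  proof clarify
    fix u assume u: "u \<in> verts G"
    then obtain v where "v \<in> verts G" "adjacent G u v" using G by (auto simp: no_isolated_def)
    then show "h u \<in> nodes (graph_edges h G)"
      using graph_edges_adjacent[OF no_isolated_simple[OF G(1)] h u] nodesI by metis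
  qed
qed

lemma graph_iso_graph_edges:
  assumes G: "no_isolated G" "\<not> one_vertex G" and h: "inj_on h (verts G)"
  shows "graph_iso G (graph_of (graph_edges h G))"
proof -
  have "graph_edges h G \<noteq> {}"
    using nodes_graph_edges[OF G h] G by (auto simp: no_isolated_def)
  then have verts: "verts (graph_of (graph_edges h G)) = h ` verts G"
    by (simp add: verts_graph_of nodes_graph_edges[OF G h])
  show ?thesis
    unfolding graph_iso_def verts adjacent_graph_of
    using h graph_edges_adjacent[OF no_isolated_simple[OF G(1)] h]
    by (intro exI[of _ h]) (simp add: inj_on_imp_bij_betw)
qed

text \<open>Converse to \<open>graph_iso_graph_edges\<close>: the edge sets isomorphic to
  \<open>G\<close> are precisely those obtained by placing its vertices at positive integers. The
  ordering of pairs in \<open>E\<close> is what upgrades equal adjacency to equal sets.\<close>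

lemma graph_iso_graph_ofE:
  assumes G: "\<not> one_vertex G" and E: "E \<in> edge_sets" and iso: "graph_iso G (graph_of E)"
  obtains h where "inj_on h (verts G)" "h ` verts G = nodes E" "E = graph_edges h G"
proof -
  have "E \<noteq> {}" using G graph_iso_one_vertex[OF iso] one_vertex_graph_of[OF E] by simp
  with iso obtain h where h: "bij_betw h (verts G) (nodes E)"
    "\<And>u v. u \<in> verts G \<Longrightarrow> v \<in> verts G \<Longrightarrow> adjacent G u v \<longleftrightarrow> (h u, h v) \<in> E \<or> (h v, h u) \<in> E"
    unfolding graph_iso_def adjacent_graph_of by (auto simp: verts_graph_of)
  have "E = graph_edges h G"
  proof (intro equalityI subsetI)
    fix e assume e: "e \<in> E"
    obtain i j where ij: "e = (i, j)" by fastforce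
    then have "i \<in> h ` verts G" "j \<in> h ` verts G"
      using e nodesI h(1) by (auto simp: bij_betw_def)
    then show "e \<in> graph_edges h G"
      using e h(2) edge_setsD(3)[OF E, of i j] unfolding ij graph_edges_def by blast
  next
    fix e assume "e \<in> graph_edges h G"
    then obtain u v where "e = (h u, h v)" "h u < h v" "u \<in> verts G" "v \<in> verts G" "adjacent G u v"
      unfolding graph_edges_def by blast
    then show "e \<in> E" using h(2)[of u v] edge_setsD(3)[OF E, of "h v" "h u"] by auto
  qed
  with h(1) show thesis using that by (auto simp: bij_betw_def)
qed

text \<open>Links relabelling an edge set with placing the vertices of a graph, so that
  \<open>edge_iso\<close> can be matched with \<open>graph_iso\<close>.\<close>

lemma relabel_eq_graph_edges:
  assumes "E \<in> edge_sets" "E \<noteq> {}" "inj_on h (nodes E)"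
  shows "relabel h E = graph_edges h (graph_of E)"
proof (intro equalityI subsetI)
  fix e assume "e \<in> relabel h E"
  then obtain i j where ij: "(i, j) \<in> E" "e = (min (h i) (h j), max (h i) (h j))"
    by (auto simp: relabel_def perm_act_def)
  then have "i \<in> nodes E" "j \<in> nodes E" "i \<noteq> j" using nodesI edge_setsD(3)[OF assms(1)] by blast+
  moreover from this have "h i \<noteq> h j" using assms(3) by (auto dest: inj_onD)
  ultimately show "e \<in> graph_edges h (graph_of E)"
    using ij unfolding graph_edges_def adjacent_graph_of verts_graph_of[OF assms(2)]
    by (cases "h i < h j") (auto simp: min_def max_def)
next
  fix e assume "e \<in> graph_edges h (graph_of E)"
  then obtain i j where "e = (h i, h j)" "h i < h j" "(i, j) \<in> E \<or> (j, i) \<in> E"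
    unfolding graph_edges_def adjacent_graph_of by blast
  then have "e = perm_act h (i, j) \<and> (i, j) \<in> E \<or> e = perm_act h (j, i) \<and> (j, i) \<in> E"
    by (auto simp: perm_act_def)
  then show "e \<in> relabel h E" by (auto simp: relabel_def)
qed

lemma graph_iso_graph_of_iff:
  assumes E: "E \<in> edge_sets" and E': "E' \<in> edge_sets"
  shows "graph_iso (graph_of E) (graph_of E') \<longleftrightarrow> edge_iso E E'"
proof (cases "E = {}")
  case True
  have "graph_iso (graph_of {}) (graph_of E') \<longleftrightarrow> E' = {}"
    using graph_iso_one_vertex one_vertex_graph_of[OF E'] one_vertex_graph_of[of "{}"] graph_iso_refl
    by (metis edge_sets_empty)
  then show ?thesis using True by (auto simp: edge_iso_def relabelling_def)
next
  case False
  then have G: "no_isolated (graph_of E)" "\<not> one_vertex (graph_of E)"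
    using E by (simp_all add: no_isolated_graph_of one_vertex_graph_of)
  show ?thesis
  proof
    assume "graph_iso (graph_of E) (graph_of E')"
    from graph_iso_graph_ofE[OF G(2) E' this] obtain h where
      h: "inj_on h (nodes E)" "h ` nodes E = nodes E'" "E' = graph_edges h (graph_of E)"
      by (auto simp: verts_graph_of[OF False])
    then have "relabelling h E" using edge_setsD(5)[OF E'] by (auto simp: relabelling_def)
    then show "edge_iso E E'"
      unfolding edge_iso_def using h(3) relabel_eq_graph_edges[OF E False h(1)] by blast
  next
    assume "edge_iso E E'"
    then obtain h where "inj_on h (nodes E)" "E' = relabel h E"
      unfolding edge_iso_def relabelling_def by blast
    then show "graph_iso (graph_of E) (graph_of E')"
      using graph_iso_graph_edges[OF G, of h] relabel_eq_graph_edges[OF E False]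
      by (simp add: verts_graph_of[OF False])
  qed
qed

lemma graph_iso_graph_of_empty:
  assumes "no_isolated G" "one_vertex G"
  shows "graph_iso G (graph_of {})"
proof -
  from assms(2) obtain x where x: "verts G = {x}" by (auto simp: one_vertex_def card_1_singleton_iff)
  have "\<not> adjacent G x x" using adjacent_verts(3)[OF no_isolated_simple[OF assms(1)]] by blast
  then show ?thesis
    unfolding graph_iso_def x adjacent_graph_of
    by (intro exI[of _ "\<lambda>_. 0"]) (auto simp: graph_of_def bij_betw_def)
qed

lemma graph_of_exists:
  fixes G :: "nat ugraph"
  assumes "no_isolated G"
  obtains E where "E \<in> edge_sets" "graph_iso G (graph_of E)"
proof (cases "one_vertex G")
  case True
  then show thesis using that[of "{}"] graph_iso_graph_of_empty[OF assms] by simp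
next
  case False
  show thesis
    \<comment> \<open>A vertex of \<open>G\<close> may be 0, which is not allowed as a node;
      \<open>Suc\<close> shifts all vertices into the positive integers.\<close>
    using that[of "graph_edges Suc G"] graph_edges_in[OF no_isolated_simple[OF assms], of Suc]
      graph_iso_graph_edges[OF assms False, of Suc] by (auto simp: inj_on_def)
qed

subsection \<open>The polynomials of graphs are indicator functions\<close>

text \<open>A strictly increasing sequence is the enumeration of its image: \<open>r i\<close> is
  the element of rank \<open>i\<close>.\<close>

lemma strict_mono_on_image_eq:
  fixes r r' :: "nat \<Rightarrow> nat"
  assumes "strict_mono_on {1..n} r" "strict_mono_on {1..n} r'" "r ` {1..n} = r' ` {1..n}" "i \<in> {1..n}"
  shows "r i = r' i"
proof -
  have rank: "card {x \<in> q ` {1..n}. x \<le> q i} = i" if "strict_mono_on {1..n} q" "i \<in> {1..n}" for q :: "nat \<Rightarrow> nat" and i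
  proof -
    have "{x \<in> q ` {1..n}. x \<le> q i} = q ` {1..i}"
      using that by (auto simp: strict_mono_on_less_eq)
    moreover have "inj_on q {1..i}"
      using strict_mono_on_imp_inj_on[OF that(1)] that(2) by (auto intro: inj_on_subset)
    ultimately show ?thesis by (simp add: card_image)
  qed
  from assms(3,4) obtain j where j: "j \<in> {1..n}" "r i = r' j" by (metis imageE imageI)
  have "i = j" using rank[OF assms(1,4)] rank[OF assms(2) j(1)] assms(3) j(2) by simp
  with j show ?thesis by simp
qed

lemma index_seqs_eqI:
  assumes "r \<in> index_seqs n" "r' \<in> index_seqs n" "r ` {1..n} = r' ` {1..n}"
  shows "r = r'"
  using assms strict_mono_on_image_eq[of n r r']
  by (intro PiE_ext[of r "{1..n}" "\<lambda>_. {0<..}"]) (auto simp: index_seqs_def)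

lemma index_seqs_exists:
  assumes "finite X" "card X = n" "0 \<notin> X"
  obtains r where "r \<in> index_seqs n" "r ` {1..n} = X"
proof -
  obtain h where h: "bij_betw h {..<card X} X" "strict_mono_on {..<card X} h"
    using ex_bij_betw_strict_mono_card[OF assms(1)] by blast
  \<comment> \<open>\<open>h\<close> enumerates from 0 and \<open>index_seqs\<close> from 1;
    \<open>restrict\<close> provides the \<open>undefined\<close> values that the extensional
    function space demands.\<close>
  define r where "r = restrict (\<lambda>i. h (i - 1)) {1..n}"
  have "r ` {1..n} = h ` (\<lambda>i. i - 1) ` {1..n}" by (auto simp: r_def)
  also have "(\<lambda>i. i - 1) ` {1..n} = {..<n}"
    by (auto simp: image_iff intro!: bexI[of _ "Suc _"])
  finally have im: "r ` {1..n} = X" using h(1) assms(2) by (simp add: bij_betw_def)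
  have "r \<in> index_seqs n"
    unfolding index_seqs_def
  proof (intro CollectI conjI)
    show "r \<in> {1..n} \<rightarrow>\<^sub>E {0<..}"
      using im assms(3) by (auto simp: r_def)
    show "strict_mono_on {1..n} r"
      using h(2) assms(2) by (auto simp: r_def intro!: strict_mono_onI strict_mono_onD[OF h(2)])
  qed
  with im that show thesis by blast
qed

text \<open>The monomial depends on \<open>\<sigma>\<close> only through its family, so a
  permutation may be exchanged for its representative in \<open>R\<close>.\<close>

lemma monomial_perm_family:
  "monomial n a \<sigma> r = {(r i, r j) | i j. (i, j) \<in> pairs n \<and> perm_family n a \<sigma> (i, j)}"
  by (auto simp: monomial_def perm_family_def)

context
  fixes G :: "'v ugraph" and n :: nat and lab :: "nat \<Rightarrow> 'v" and a :: "nat \<times> nat \<Rightarrow> bool"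
  assumes G: "no_isolated G" "\<not> one_vertex G" and lab: "bij_betw lab {1..n} (verts G)"
    and a: "a = (\<lambda>(i, j). adjacent G (lab i) (lab j))"
begin

lemma perm_act_adjacent: "a (perm_act \<sigma> (i, j)) \<longleftrightarrow> adjacent G (lab (\<sigma> i)) (lab (\<sigma> j))"
  by (auto simp: a perm_act_def min_def max_def adjacent_commute)

text \<open>The term of \<open>\<sigma>\<close> and \<open>r\<close> places the vertex labelled
  \<open>\<sigma> i\<close> at position \<open>r i\<close>. Since \<open>r\<close> is increasing,
  the condition i < j selects each edge in its sorted form.\<close>

lemma monomial_eq_graph_edges:
  assumes \<sigma>: "\<sigma> permutes {1..n}" and r: "r \<in> index_seqs n"
    and h: "\<And>i. i \<in> {1..n} \<Longrightarrow> h (lab (\<sigma> i)) = r i"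
  shows "monomial n a \<sigma> r = graph_edges h G"
proof -
  have mono: "r i < r j \<longleftrightarrow> i < j" if "i \<in> {1..n}" "j \<in> {1..n}" for i j
    using r strict_mono_on_less[of "{1..n}" r] that unfolding index_seqs_def by blast
  have "verts G = lab ` \<sigma> ` {1..n}"
    using lab permutes_image[OF \<sigma>] by (simp add: bij_betw_def)
  then have "graph_edges h G = {(r i, r j) | i j. i \<in> {1..n} \<and> j \<in> {1..n} \<and> r i < r j \<and>
      adjacent G (lab (\<sigma> i)) (lab (\<sigma> j))}"
    unfolding graph_edges_def using h by fastforce
  moreover have "(i, j) \<in> pairs n \<and> a (perm_act \<sigma> (i, j)) \<longleftrightarrow>
      i \<in> {1..n} \<and> j \<in> {1..n} \<and> r i < r j \<and> adjacent G (lab (\<sigma> i)) (lab (\<sigma> j))" for i j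
    using mono[of i j] unfolding pairs_def perm_act_adjacent by auto
  ultimately show ?thesis unfolding monomial_def by simp
qed

lemma monomial_graph_edges:
  assumes \<sigma>: "\<sigma> permutes {1..n}" and r: "r \<in> index_seqs n"
  obtains h where "inj_on h (verts G)" "h ` verts G = r ` {1..n}" "monomial n a \<sigma> r = graph_edges h G"
proof -
  have bij: "bij_betw (lab \<circ> \<sigma>) {1..n} (verts G)"
    using permutes_imp_bij[OF \<sigma>] lab by (rule bij_betw_trans)
  have "inj_on r {1..n}" using r strict_mono_on_imp_inj_on by (auto simp: index_seqs_def)
  then have "bij_betw (r \<circ> inv_into {1..n} (lab \<circ> \<sigma>)) (verts G) (r ` {1..n})"
    using bij_betw_trans[OF bij_betw_inv_into[OF bij]] inj_on_imp_bij_betw by blast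
  moreover have "(r \<circ> inv_into {1..n} (lab \<circ> \<sigma>)) (lab (\<sigma> i)) = r i" if "i \<in> {1..n}" for i
    using inv_into_f_f[of "lab \<circ> \<sigma>" "{1..n}" i] bij that by (simp add: bij_betw_def)
  ultimately show thesis
    using that monomial_eq_graph_edges[OF \<sigma> r] by (metis bij_betw_def)
qed

text \<open>At most one term equals \<open>E\<close>: its nodes determine \<open>r\<close>,
  injectivity of \<open>r\<close> then recovers the family, and \<open>R\<close> has one permutation
  per family. Labelling and \<open>R\<close> are arbitrary here, which also shows that the choices
  made in \<open>M\<close> are immaterial.\<close>

lemma M_sum_eq:
  assumes R: "rep_set n a R"
  shows "M_sum n a R E = (if E \<in> edge_sets \<and> graph_iso G (graph_of E) then 1 else 0 :: 'k::field)"
proof -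
  define T where "T = {(r, \<sigma>). r \<in> index_seqs n \<and> \<sigma> \<in> R \<and> monomial n a \<sigma> r = E}"
  have R': "R \<subseteq> {\<sigma>. \<sigma> permutes {1..n}}" "inj_on (perm_family n a) R"
    "perm_family n a ` R = perm_family n a ` {\<sigma>. \<sigma> permutes {1..n}}"
    using R by (auto simp: rep_set_def)
  have nodes: "nodes (monomial n a \<sigma> r) = r ` {1..n}" if "r \<in> index_seqs n" "\<sigma> permutes {1..n}" for r \<sigma>
    using monomial_graph_edges[OF that(2,1)] nodes_graph_edges[OF G] by metis
  have unique: "t = t'" if "t \<in> T" "t' \<in> T" for t t'
  proof -
    obtain r \<sigma> r' \<sigma>' where t: "t = (r, \<sigma>)" "t' = (r', \<sigma>')" by fastforce
    then have in_T: "r \<in> index_seqs n" "r' \<in> index_seqs n" "\<sigma> \<in> R" "\<sigma>' \<in> R"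
      "monomial n a \<sigma> r = E" "monomial n a \<sigma>' r' = E"
      using that by (auto simp: T_def)
    then have perm: "\<sigma> permutes {1..n}" "\<sigma>' permutes {1..n}" using R'(1) by auto
    have "r ` {1..n} = r' ` {1..n}"
      using nodes[OF in_T(1) perm(1)] nodes[OF in_T(2) perm(2)] in_T(5,6) by simp
    then have rr: "r = r'" by (rule index_seqs_eqI[OF in_T(1,2)])
    have inj: "inj_on r {1..n}"
      using in_T(1) strict_mono_on_imp_inj_on by (auto simp: index_seqs_def)
    have mem: "perm_family n a \<tau> (i, j) \<longleftrightarrow> (r i, r j) \<in> monomial n a \<tau> r" if "(i, j) \<in> pairs n" for \<tau> i j
    proof
      assume "(r i, r j) \<in> monomial n a \<tau> r"
      then obtain i' j' where ij: "r i = r i'" "r j = r j'" "(i', j') \<in> pairs n" "perm_family n a \<tau> (i', j')"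
        unfolding monomial_perm_family by blast
      then have "{i, j, i', j'} \<subseteq> {1..n}" using that by (auto simp: pairs_def)
      then have "i = i'" "j = j'" using ij(1,2) inj by (simp_all add: inj_on_eq_iff)
      with ij(4) show "perm_family n a \<tau> (i, j)" by simp
    qed (use that in \<open>auto simp: monomial_perm_family\<close>)
    have "perm_family n a \<sigma> = perm_family n a \<sigma>'"
    proof
      fix p
      show "perm_family n a \<sigma> p = perm_family n a \<sigma>' p"
      proof (cases "p \<in> pairs n")
        case True
        obtain i j where "p = (i, j)" by fastforce
        with True mem[of i j \<sigma>] mem[of i j \<sigma>'] in_T(5,6) rr show ?thesis by simp
      qed (simp add: perm_family_def)
    qed
    then have "\<sigma> = \<sigma>'" by (rule inj_onD[OF R'(2) _ in_T(3,4)])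
    with rr t show ?thesis by simp
  qed
  have ex: "T \<noteq> {} \<longleftrightarrow> E \<in> edge_sets \<and> graph_iso G (graph_of E)"
  proof
    assume "T \<noteq> {}"
    then obtain r \<sigma> where t: "r \<in> index_seqs n" "\<sigma> permutes {1..n}" "monomial n a \<sigma> r = E"
      using R'(1) by (auto simp: T_def)
    from monomial_graph_edges[OF t(2,1)] t(3) obtain h where
      h: "inj_on h (verts G)" "h ` verts G = r ` {1..n}" "E = graph_edges h G" by metis
    have "0 \<notin> r ` {1..n}" using t(1) by (auto simp: index_seqs_def PiE_iff)
    then show "E \<in> edge_sets \<and> graph_iso G (graph_of E)"
      using graph_edges_in[OF no_isolated_simple[OF G(1)] h(1)] graph_iso_graph_edges[OF G h(1)] h by simp
  next
    assume "E \<in> edge_sets \<and> graph_iso G (graph_of E)"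
    then have E: "E \<in> edge_sets" and iso: "graph_iso G (graph_of E)" by auto
    from graph_iso_graph_ofE[OF G(2) E iso] obtain h where
      h: "inj_on h (verts G)" "h ` verts G = nodes E" "E = graph_edges h G" .
    have "card (nodes E) = n"
      using card_image[OF h(1)] h(2) bij_betw_same_card[OF lab] by simp
    then obtain r where r: "r \<in> index_seqs n" "r ` {1..n} = nodes E"
      using index_seqs_exists[of "nodes E" n] edge_setsD(4,5)[OF E] by auto
    \<comment> \<open>Position \<open>i\<close> receives the label of the vertex that
      \<open>h\<close> places at \<open>r i\<close>. This permutation need not lie in
      \<open>R\<close>; its representative \<open>\<sigma>'\<close> yields the same
      monomial.\<close>
    define \<sigma> where "\<sigma> i = (if i \<in> {1..n} then inv_into {1..n} lab (inv_into (verts G) h (r i)) else i)" for i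
    have "bij_betw r {1..n} (nodes E)"
      using r strict_mono_on_imp_inj_on by (auto simp: bij_betw_def index_seqs_def)
    moreover have "bij_betw (inv_into (verts G) h) (nodes E) (verts G)"
      using h(1,2) by (intro bij_betw_inv_into) (simp add: bij_betw_def)
    moreover have "bij_betw (inv_into {1..n} lab) (verts G) {1..n}"
      using lab by (rule bij_betw_inv_into)
    ultimately have "bij_betw (inv_into {1..n} lab \<circ> (inv_into (verts G) h \<circ> r)) {1..n} {1..n}"
      by (intro bij_betw_trans)
    then have "bij_betw \<sigma> {1..n} {1..n}"
      by (rule bij_betw_cong[THEN iffD1, rotated]) (simp add: \<sigma>_def)
    then have \<sigma>: "\<sigma> permutes {1..n}" by (rule bij_imp_permutes) (auto simp: \<sigma>_def)
    have "h (lab (\<sigma> i)) = r i" if "i \<in> {1..n}" for i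
    proof -
      have ri: "r i \<in> h ` verts G" using that r(2) h(2) by blast
      then have "inv_into (verts G) h (r i) \<in> lab ` {1..n}"
        using lab by (simp add: bij_betw_def inv_into_into)
      then have "lab (\<sigma> i) = inv_into (verts G) h (r i)"
        using that by (simp add: \<sigma>_def f_inv_into_f)
      then show ?thesis using ri by (simp add: f_inv_into_f)
    qed
    then have "monomial n a \<sigma> r = E"
      using monomial_eq_graph_edges[OF \<sigma> r(1), of h] h(3) by simp
    moreover obtain \<sigma>' where "\<sigma>' \<in> R" "perm_family n a \<sigma>' = perm_family n a \<sigma>"
      using R'(3) \<sigma> by (metis (no_types, lifting) imageE imageI mem_Collect_eq)
    ultimately have "(r, \<sigma>') \<in> T"
      using r(1) unfolding T_def monomial_perm_family by simp
    then show "T \<noteq> {}" by blast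
  qed
  show ?thesis
  proof (cases "T = {}")
    case True
    then show ?thesis using ex by (simp add: M_sum_def T_def[symmetric])
  next
    case False
    then obtain t where "T = {t}" using unique by blast
    then show ?thesis using ex False by (simp add: M_sum_def T_def[symmetric])
  qed
qed

end

lemma rep_set_exists: "\<exists>R. rep_set n a R"
proof -
  obtain R where "R \<subseteq> {\<sigma>. \<sigma> permutes {1..n}}" "inj_on (perm_family n a) R"
    "perm_family n a ` {\<sigma>. \<sigma> permutes {1..n}} = perm_family n a ` R"
    using subset_image_inj[THEN iffD1, OF order_refl] by metis
  then show ?thesis unfolding rep_set_def by blast
qed

lemma M_eq:
  assumes "no_isolated G"
  shows "M G E = (if E \<in> edge_sets \<and> graph_iso G (graph_of E) then 1 else 0 :: 'k::field)"
proof (cases "one_vertex G")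
  case True
  have "graph_iso G (graph_of {})" using assms True by (rule graph_iso_graph_of_empty)
  then have "E \<in> edge_sets \<and> graph_iso G (graph_of E) \<longleftrightarrow> E = {}"
    using True graph_iso_one_vertex one_vertex_graph_of edge_sets_empty by metis
  then show ?thesis using True by (simp add: M_def amb_one_def)
next
  case False
  define n where "n = card (verts G)"
  define lab where "lab = (SOME lab. bij_betw lab {1..n} (verts G))"
  define a where "a = (\<lambda>(i, j). adjacent G (lab i) (lab j))"
  define R where "R = (SOME R. rep_set n a R)"
  have "finite (verts G)" using no_isolated_simple[OF assms] by (simp add: simple_graph_def)
  then have "\<exists>lab. bij_betw lab {1..n} (verts G)"
    unfolding n_def by (rule ex_bij_betw_nat_finite_1)
  then have lab: "bij_betw lab {1..n} (verts G)" unfolding lab_def by (rule someI_ex)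
  have R: "rep_set n a R" unfolding R_def by (rule someI_ex) (rule rep_set_exists)
  have "M G E = (M_sum n a R E :: 'k)"
    using False by (simp add: M_def Let_def n_def lab_def a_def R_def)
  then show ?thesis by (rule trans[OF _ M_sum_eq[OF assms False lab a_def R]])
qed

lemma M_eq_shape_indicator:
  assumes "no_isolated G" "E \<in> edge_sets" "graph_iso G (graph_of E)"
  shows "M G = shape_indicator E"
proof
  fix E'
  show "M G E' = shape_indicator E E'"
    unfolding M_eq[OF assms(1)] graph_iso_cong_left[OF assms(3)] shape_indicator_def
    using graph_iso_graph_of_iff[OF assms(2), of E'] edge_iso_edge_sets[OF assms(2), of E']
    by (intro if_cong refl) blast
qed

lemma M_graph_of: "E \<in> edge_sets \<Longrightarrow> M (graph_of E) = shape_indicator E"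
  by (intro M_eq_shape_indicator no_isolated_graph_of graph_iso_refl)

text \<open>A single transfer of spanning sets, used for the basis and for both filtrations.\<close>

lemma M_set_eq:
  assumes "\<And>G E. no_isolated G \<Longrightarrow> E \<in> edge_sets \<Longrightarrow> graph_iso G (graph_of E) \<Longrightarrow> P G \<longleftrightarrow> Q E"
  shows "{M G | G :: nat ugraph. no_isolated G \<and> P G} = shape_indicator ` {E \<in> edge_sets. Q E}"
proof (intro equalityI subsetI)
  fix m assume "m \<in> {M G | G :: nat ugraph. no_isolated G \<and> P G}"
  then obtain G :: "nat ugraph" where G: "m = M G" "no_isolated G" "P G" by blast
  from graph_of_exists[OF G(2)] obtain E where "E \<in> edge_sets" "graph_iso G (graph_of E)" .
  with G assms M_eq_shape_indicator[OF G(2)] show "m \<in> shape_indicator ` {E \<in> edge_sets. Q E}" by blast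
next
  fix m assume "m \<in> shape_indicator ` {E \<in> edge_sets. Q E}"
  then obtain E where E: "E \<in> edge_sets" "Q E" "m = shape_indicator E" by blast
  then have "P (graph_of E)"
    using assms[OF no_isolated_graph_of[OF E(1)] E(1) graph_iso_refl] by blast
  with E no_isolated_graph_of[OF E(1)]
  show "m \<in> {M G | G :: nat ugraph. no_isolated G \<and> P G}"
    by (intro CollectI exI[of _ "graph_of E"]) (simp add: M_graph_of)
qed

lemma M_basis_eq: "M_basis = shape_indicator ` edge_sets"
  using M_set_eq[of "\<lambda>_. True" "\<lambda>_. True"] by (simp add: M_basis_def)

lemma UGQSym_eq: "UGQSym = graph_funs"
  by (simp add: UGQSym_def graph_funs_def M_basis_eq)

lemma edge_filtration_eq: "edge_filtration = bounded_funs card"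
proof
  fix k
  have "num_edges G = card E" if "no_isolated G" "E \<in> edge_sets" "graph_iso G (graph_of E)"
    for G :: "nat ugraph" and E
    using graph_iso_card_edges[OF that(3) no_isolated_simple[OF that(1)] simple_graph_of[OF that(2)]]
      num_edges_graph_of[OF that(2)] by (simp add: num_edges_def)
  then show "edge_filtration k = bounded_funs card k"
    unfolding edge_filtration_def edge_count.bounded_funs_span edge_count.shapes_def
    by (intro arg_cong[where f = fs.span] M_set_eq) simp
qed

lemma node_filtration_eq: "node_filtration = bounded_funs (\<lambda>E. card (nodes E))"
proof
  fix k
  have "num_nodes G = card (nodes E)" if "no_isolated G" "E \<in> edge_sets" "graph_iso G (graph_of E)"
    for G :: "nat ugraph" and E
    using graph_iso_card[OF that(3)] graph_iso_one_vertex[OF that(3)]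
      num_nodes_graph_of[OF that(2), symmetric] by (simp add: num_nodes_def)
  then show "node_filtration k = bounded_funs (\<lambda>E. card (nodes E)) k"
    unfolding node_filtration_def node_count.bounded_funs_span node_count.shapes_def
    by (intro arg_cong[where f = fs.span] M_set_eq) simp
qed

lemma independent_M_basis: "fs.independent (M_basis :: (_ \<Rightarrow> 'k::field) set)"
  unfolding fs.independent_explicit_module M_basis_eq
proof (intro allI impI)
  fix T u and m :: "_ \<Rightarrow> 'k"
  assume T: "finite T" "T \<subseteq> shape_indicator ` edge_sets" "(\<Sum>m\<in>T. fscale (u m) m) = 0" "m \<in> T"
  then obtain E where E: "E \<in> edge_sets" "m = shape_indicator E" by blast
  \<comment> \<open>Evaluation at \<open>E\<close> isolates the coefficient of \<open>m\<close>,
    since distinct indicators have disjoint supports.\<close>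
  have *: "m' E = (if m' = m then 1 else 0)" if "m' \<in> T" for m'
  proof -
    from that T(2) obtain E' where "E' \<in> edge_sets" "m' = shape_indicator E'" by blast
    then show ?thesis
      using shape_indicator_eq[OF _ E(1), of E', where 'k = 'k] E(2) by (auto simp: shape_indicator_def)
  qed
  have "(\<Sum>m'\<in>T. fscale (u m') m') E = (\<Sum>m'\<in>T. if m' = m then u m' else 0)"
    unfolding sum_fun_apply'
  proof (intro sum.cong refl)
    fix m' assume "m' \<in> T"
    then show "fscale (u m') m' E = (if m' = m then u m' else 0)"
      using *[of m'] by (simp add: fscale_def)
  qed
  then show "u m = 0" using T(1,3,4) by simp
qed

subsection \<open>The coproduct\<close>

lemma verts_disjoint_union: "verts (disjoint_union G G') = verts G <+> verts G'"
  by (simp add: disjoint_union_def)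

lemma adjacent_disjoint_union [simp]:
  "adjacent (disjoint_union G G') (Inl u) (Inl v) \<longleftrightarrow> adjacent G u v"
  "adjacent (disjoint_union G G') (Inr u') (Inr v') \<longleftrightarrow> adjacent G' u' v'"
  "\<not> adjacent (disjoint_union G G') (Inl u) (Inr v')"
  "\<not> adjacent (disjoint_union G G') (Inr u') (Inl v)"
proof -
  have same: "{Inl u, Inl v} = Inl ` e \<longleftrightarrow> {u, v} = e" "{Inr u', Inr v'} = Inr ` e' \<longleftrightarrow> {u', v'} = e'"
    for e :: "'a set" and e' :: "'b set"
    using inj_image_eq_iff[OF inj_Inl, of "{u, v}" e] inj_image_eq_iff[OF inj_Inr, of "{u', v'}" e'] by auto
  have diff: "{Inl u, x} \<noteq> Inr ` e'" "{Inr v', x} \<noteq> Inl ` e" "{Inr u', x} \<noteq> Inl ` e"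
    "{y, Inr v'} \<noteq> Inl ` e" "{y, Inl v} \<noteq> Inr ` e'" for x y and e :: "'a set" and e' :: "'b set"
    by blast+
  have "e \<in> edges (disjoint_union G G') \<longleftrightarrow> (\<exists>d\<in>edges G. e = Inl ` d) \<or> (\<exists>d\<in>edges G'. e = Inr ` d)" for e
    unfolding disjoint_union_def by auto
  then show "adjacent (disjoint_union G G') (Inl u) (Inl v) \<longleftrightarrow> adjacent G u v"
    "adjacent (disjoint_union G G') (Inr u') (Inr v') \<longleftrightarrow> adjacent G' u' v'"
    "\<not> adjacent (disjoint_union G G') (Inl u) (Inr v')"
    "\<not> adjacent (disjoint_union G G') (Inr u') (Inl v)"
    unfolding adjacent_def by (simp_all add: same diff)
qed

lemma graph_iso_disjoint_union:
  assumes "graph_iso G H" "graph_iso G' H'"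
  shows "graph_iso (disjoint_union G G') (disjoint_union H H')"
proof -
  from assms obtain f g where f: "bij_betw f (verts G) (verts H)"
    "\<And>u v. u \<in> verts G \<Longrightarrow> v \<in> verts G \<Longrightarrow> adjacent G u v \<longleftrightarrow> adjacent H (f u) (f v)"
    and g: "bij_betw g (verts G') (verts H')"
    "\<And>u v. u \<in> verts G' \<Longrightarrow> v \<in> verts G' \<Longrightarrow> adjacent G' u v \<longleftrightarrow> adjacent H' (g u) (g v)"
    unfolding graph_iso_def by blast
  have "inj_on (map_sum f g) (verts G <+> verts G')"
    using f(1) g(1) by (intro inj_onI) (auto simp: bij_betw_def inj_on_eq_iff)
  moreover have "map_sum f g ` (verts G <+> verts G') = verts H <+> verts H'"
    unfolding bij_betw_imp_surj_on[OF f(1), symmetric] bij_betw_imp_surj_on[OF g(1), symmetric]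
    by (simp add: Plus_def image_Un image_image)
  ultimately have "bij_betw (map_sum f g) (verts (disjoint_union G G')) (verts (disjoint_union H H'))"
    by (simp add: bij_betw_def verts_disjoint_union)
  moreover have "adjacent (disjoint_union G G') u v \<longleftrightarrow>
      adjacent (disjoint_union H H') (map_sum f g u) (map_sum f g v)"
    if "u \<in> verts G <+> verts G'" "v \<in> verts G <+> verts G'" for u v
    using that f(2) g(2) by (elim PlusE) simp_all
  ultimately show ?thesis
    unfolding graph_iso_def by (metis verts_disjoint_union)
qed

lemma graph_iso_disjoint_union_dunion:
  assumes A: "A \<in> edge_sets" "A \<noteq> {}" and B: "B \<in> edge_sets" "B \<noteq> {}"
  shows "graph_iso (disjoint_union (graph_of A) (graph_of B)) (graph_of (dunion A B))"
proof -
  let ?G = "disjoint_union (graph_of A) (graph_of B)" and ?h = "case_sum even_label odd_label"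
  have verts: "verts ?G = nodes A <+> nodes B"
    using A(2) B(2) by (simp add: verts_disjoint_union verts_graph_of)
  have pos: "x > 0" if "x \<in> nodes B" for x using edge_setsD(5)[OF B(1) that] .
  have eo: "even_label x \<noteq> odd_label y" if "y \<in> nodes B" for x y
    using pos[OF that] unfolding even_label_def odd_label_def by presburger
  have oe: "odd_label y \<noteq> even_label x" if "y \<in> nodes B" for x y
    using eo[OF that] by metis
  \<comment> \<open>Both labels are increasing on nodes, so relabelling with them never has to swap
    the end points of a pair.\<close>
  have edges: "(i, j) \<in> relabel f E \<longleftrightarrow> (\<exists>x y. (x, y) \<in> E \<and> i = f x \<and> j = f y)"
    if "E \<in> edge_sets" "strict_mono_on (nodes E) f" for i j f E
  proof -
    have "perm_act f (x, y) = (f x, f y)" if "(x, y) \<in> E" for x y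
    proof -
      have "f x < f y"
        using \<open>strict_mono_on (nodes E) f\<close> nodesI[OF that] edge_setsD(3)[OF \<open>E \<in> edge_sets\<close> that]
        by (auto simp: strict_mono_on_def)
      then show ?thesis by (simp add: perm_act_def)
    qed
    then have "relabel f E = (\<lambda>(x, y). (f x, f y)) ` E"
      unfolding relabel_def by (intro image_cong refl) auto
    then show ?thesis by auto
  qed
  have mono: "strict_mono_on (nodes A) even_label" "strict_mono_on (nodes B) odd_label"
    using pos by (fastforce simp: strict_mono_on_def even_label_def odd_label_def)+
  have mem: "(i, j) \<in> dunion A B \<longleftrightarrow> (\<exists>x y. (x, y) \<in> A \<and> i = even_label x \<and> j = even_label y) \<or>
      (\<exists>x y. (x, y) \<in> B \<and> i = odd_label x \<and> j = odd_label y)" for i j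
    unfolding dunion_def by (simp add: edges[OF A(1) mono(1)] edges[OF B(1) mono(2)])
  have ev: "even_label x = even_label y \<longleftrightarrow> x = y" for x y by (simp add: even_label_def)
  have od: "odd_label x = odd_label y \<longleftrightarrow> x = y" if "x \<in> nodes B" "y \<in> nodes B" for x y
    using pos[OF that(1)] pos[OF that(2)] unfolding odd_label_def by presburger
  have AA: "(even_label x, even_label y) \<in> dunion A B \<longleftrightarrow> (x, y) \<in> A" for x y
    using eo nodesI(1) unfolding mem ev by blast
  have BB: "(odd_label x, odd_label y) \<in> dunion A B \<longleftrightarrow> (x, y) \<in> B"
    if "x \<in> nodes B" "y \<in> nodes B" for x y
    using oe[OF that(1)] od that nodesI unfolding mem by metis
  have AB: "(even_label x, odd_label y) \<notin> dunion A B" "(odd_label y, even_label x) \<notin> dunion A B"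
    if "y \<in> nodes B" for x y
    using oe[OF that] eo nodesI unfolding mem by metis+
  have "adjacent ?G u v \<longleftrightarrow> (?h u, ?h v) \<in> dunion A B \<or> (?h v, ?h u) \<in> dunion A B"
    if "u \<in> verts ?G" "v \<in> verts ?G" for u v
    using that unfolding verts by (elim PlusE) (simp_all add: adjacent_graph_of AA BB AB)
  moreover have "inj_on ?h (verts ?G)"
    unfolding verts using oe by (intro inj_onI) (auto simp: ev od dest: eo)
  moreover have "?h ` verts ?G = nodes (dunion A B)"
    unfolding verts nodes_dunion Plus_def image_Un image_image by simp
  ultimately show ?thesis
    unfolding graph_iso_def adjacent_graph_of using A(2)
    by (intro exI[of _ ?h]) (simp add: verts_graph_of bij_betw_def)
qed

text \<open>The case distinction in \<open>splits\<close> disappears on edge sets: the one-vertex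
  graph becomes the empty set, which is neutral for \<open>dunion\<close> up to isomorphism.\<close>

lemma splits_iff:
  assumes A: "A \<in> edge_sets" "graph_iso G' (graph_of A)" and B: "B \<in> edge_sets" "graph_iso G'' (graph_of B)"
  shows "splits G G' G'' \<longleftrightarrow> graph_iso (graph_of (dunion A B)) G"
proof -
  have one: "one_vertex G' \<longleftrightarrow> A = {}" "one_vertex G'' \<longleftrightarrow> B = {}"
    using graph_iso_one_vertex[OF A(2)] graph_iso_one_vertex[OF B(2)]
      one_vertex_graph_of[OF A(1)] one_vertex_graph_of[OF B(1)] by simp_all
  consider "A = {}" | "A \<noteq> {}" "B = {}" | "A \<noteq> {}" "B \<noteq> {}" by blast
  then show ?thesis
  proof cases
    case 1
    have "graph_iso (graph_of B) (graph_of (dunion {} B))"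
      using B(1) dunion_empty_left[OF B(1)] by (simp add: graph_iso_graph_of_iff dunion_edge_sets)
    with B(2) have "graph_iso G'' (graph_of (dunion {} B))" by (rule graph_iso_trans)
    from graph_iso_cong_left[OF this] 1 show ?thesis by (simp add: splits_def one)
  next
    case 2
    have "graph_iso (graph_of A) (graph_of (dunion A {}))"
      using A(1) dunion_empty_right[OF A(1)] by (simp add: graph_iso_graph_of_iff dunion_edge_sets)
    with A(2) have "graph_iso G' (graph_of (dunion A {}))" by (rule graph_iso_trans)
    from graph_iso_cong_left[OF this] 2 show ?thesis by (simp add: splits_def one)
  next
    case 3
    have "graph_iso (disjoint_union G' G'') (graph_of (dunion A B))"
      using graph_iso_disjoint_union[OF A(2) B(2)]
        graph_iso_disjoint_union_dunion[OF A(1) 3(1) B(1) 3(2)] by (rule graph_iso_trans)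
    from graph_iso_cong_left[OF this] 3 show ?thesis by (simp add: splits_def one)
  qed
qed

definition iso_class :: "(nat \<times> nat) set \<Rightarrow> nat ugraph set"
  where "iso_class E = {G. no_isolated G \<and> graph_iso (graph_of E) G}"

lemma iso_classes_eq: "iso_classes = iso_class ` edge_sets"
proof -
  let ?r = "{(G :: nat ugraph, G' :: nat ugraph). no_isolated G \<and> no_isolated G' \<and> graph_iso G G'}"
  have cls: "?r `` {G} = iso_class E" if "no_isolated G" "graph_iso G (graph_of E)" for G E
    using graph_iso_cong_left[OF that(2)] that(1) unfolding iso_class_def by auto
  show ?thesis
  proof (intro equalityI subsetI)
    fix C assume "C \<in> iso_classes"
    then obtain G where C: "C = ?r `` {G}" and "G \<in> {G. no_isolated G}"
      unfolding iso_classes_def by (rule quotientE)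
    then have G: "no_isolated G" by blast
    from graph_of_exists[OF G] obtain E where "E \<in> edge_sets" "graph_iso G (graph_of E)" .
    with cls[OF G] C show "C \<in> iso_class ` edge_sets" by blast
  next
    fix C assume "C \<in> iso_class ` edge_sets"
    then obtain E where E: "E \<in> edge_sets" "C = iso_class E" by blast
    then have C: "C = ?r `` {graph_of E}" using cls[OF no_isolated_graph_of graph_iso_refl] by simp
    show "C \<in> iso_classes"
      unfolding iso_classes_def C using no_isolated_graph_of[OF E(1)] by (intro quotientI) blast
  qed
qed

lemma M_class_iso_class:
  assumes "E \<in> edge_sets"
  shows "M_class (iso_class E) = shape_indicator E"
proof -
  have "graph_of E \<in> iso_class E"
    using no_isolated_graph_of[OF assms] graph_iso_refl by (simp add: iso_class_def)
  then have "(SOME G. G \<in> iso_class E) \<in> iso_class E" by (rule someI)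
  then show ?thesis
    unfolding M_class_def iso_class_def
    using M_eq_shape_indicator[OF _ assms] graph_iso_sym by blast
qed

lemma iso_class_eq_iff:
  assumes "E \<in> edge_sets" "E' \<in> edge_sets"
  shows "iso_class E = iso_class E' \<longleftrightarrow> edge_iso E E'"
proof
  assume "iso_class E = iso_class E'"
  then have "graph_of E' \<in> iso_class E"
    using no_isolated_graph_of[OF assms(2)] graph_iso_refl by (simp add: iso_class_def)
  then show "edge_iso E E'" using graph_iso_graph_of_iff[OF assms] by (simp add: iso_class_def)
next
  assume "edge_iso E E'"
  then have "graph_iso (graph_of E) (graph_of E')" using graph_iso_graph_of_iff[OF assms] by simp
  then show "iso_class E = iso_class E'"
    using graph_iso_cong_left unfolding iso_class_def by blast
qed

text \<open>At \<open>(A, B)\<close> only the pair of the classes of \<open>A\<close> and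
  \<open>B\<close> can contribute, and it occurs in the sum exactly when A \<squnion> B is
  isomorphic to \<open>G\<close>.\<close>

lemma M_coproduct_eq:
  assumes G: "no_isolated G"
  shows "M_coproduct G = (split_fun (M G) :: _ \<Rightarrow> 'k::field)"
proof (rule ext, clarify)
  fix A B :: "(nat \<times> nat) set"
  define X where "X = {(C', C''). C' \<in> iso_classes \<and> C'' \<in> iso_classes \<and>
      (\<exists>G'\<in>C'. \<exists>G''\<in>C''. splits G G' G'')}"
  have X_iff: "(iso_class A, iso_class B) \<in> X \<longleftrightarrow> graph_iso (graph_of (dunion A B)) G"
    if "A \<in> edge_sets" "B \<in> edge_sets" for A B
  proof -
    have splits: "splits G G' G'' \<longleftrightarrow> graph_iso (graph_of (dunion A B)) G"
      if "G' \<in> iso_class A" "G'' \<in> iso_class B" for G' G''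
      using that \<open>A \<in> edge_sets\<close> \<open>B \<in> edge_sets\<close>
      by (intro splits_iff) (auto simp: iso_class_def intro: graph_iso_sym)
    have reps: "graph_of A \<in> iso_class A" "graph_of B \<in> iso_class B"
      using that by (simp_all add: iso_class_def no_isolated_graph_of graph_iso_refl)
    have "iso_class A \<in> iso_classes" "iso_class B \<in> iso_classes"
      using that by (simp_all add: iso_classes_eq)
    then have "(iso_class A, iso_class B) \<in> X \<longleftrightarrow>
        (\<exists>G'\<in>iso_class A. \<exists>G''\<in>iso_class B. splits G G' G'')"
      unfolding X_def mem_Collect_eq case_prod_conv by simp
    also have "\<dots> \<longleftrightarrow> (\<exists>G'\<in>iso_class A. \<exists>G''\<in>iso_class B. graph_iso (graph_of (dunion A B)) G)"
      using splits by (intro bex_cong refl)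
    also have "\<dots> \<longleftrightarrow> graph_iso (graph_of (dunion A B)) G"
      using reps by blast
    finally show ?thesis .
  qed
  from graph_of_exists[OF G] obtain E where E: "E \<in> edge_sets" "graph_iso G (graph_of E)" .
  \<comment> \<open>Otherwise the sum would be the default value 0. Edge numbers add up in a
    splitting, so both classes have at most \<open>card E\<close> edges.\<close>
  have "finite X"
  proof (rule finite_subset)
    let ?D = "iso_class ` {A \<in> edge_sets. card A \<le> card E}"
    \<comment> \<open>Finiteness is carried over from \<open>shapes\<close> along
      \<open>M_class\<close>, which separates these classes.\<close>
    have inj: "inj_on (M_class :: _ \<Rightarrow> _ \<Rightarrow> 'k) ?D"
      by (auto simp: inj_on_def M_class_iso_class shape_indicator_eq iso_class_eq_iff)
    have im: "(M_class :: _ \<Rightarrow> _ \<Rightarrow> 'k) ` ?D = edge_count.shapes (card E)"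
      by (auto simp: edge_count.shapes_def M_class_iso_class image_iff)
    have "finite ?D"
      by (rule finite_imageD[OF _ inj]) (unfold im, rule edge_count.finite_shapes)
    then show "finite (?D \<times> ?D)" by simp
    show "X \<subseteq> ?D \<times> ?D"
    proof clarify
      fix C' C'' assume C: "(C', C'') \<in> X"
      then obtain A B where AB: "A \<in> edge_sets" "B \<in> edge_sets" "C' = iso_class A" "C'' = iso_class B"
        by (auto simp: X_def iso_classes_eq)
      with C X_iff have "graph_iso (graph_of (dunion A B)) (graph_of E)"
        using graph_iso_trans[OF _ E(2)] by blast
      then have "edge_iso (dunion A B) E"
        using AB E(1) by (simp add: graph_iso_graph_of_iff dunion_edge_sets)
      then have "card E = card A + card B"
        using edge_count.size_edge_iso[OF dunion_edge_sets[OF AB(1,2)]] card_dunion[OF AB(1,2)] by simp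
      with AB show "C' \<in> ?D \<and> C'' \<in> ?D" by auto
    qed
  qed
  have eval: "(M_class C A :: 'k) = (if A \<in> edge_sets \<and> C = iso_class A then 1 else 0)"
    if "C \<in> iso_classes" for C A
  proof -
    from that obtain E where "E \<in> edge_sets" "C = iso_class E" by (auto simp: iso_classes_eq)
    then show ?thesis
      using edge_iso_edge_sets iso_class_eq_iff by (auto simp: M_class_iso_class shape_indicator_def)
  qed
  have "M_coproduct G (A, B) = (\<Sum>(C', C'')\<in>X. M_class C' A * M_class C'' B :: 'k)"
    by (simp add: M_coproduct_def X_def[symmetric] sum_fun_apply' tensor_def case_prod_beta)
  also have "\<dots> = (\<Sum>p\<in>X. if p = (iso_class A, iso_class B) then if A \<in> edge_sets \<and> B \<in> edge_sets then 1 else 0 else 0)"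
  proof (rule sum.cong[OF refl])
    fix p assume "p \<in> X"
    then obtain C' C'' where "p = (C', C'')" "C' \<in> iso_classes" "C'' \<in> iso_classes"
      by (auto simp: X_def)
    then show "((case p of (C', C'') \<Rightarrow> M_class C' A * M_class C'' B) :: 'k)
        = (if p = (iso_class A, iso_class B) then if A \<in> edge_sets \<and> B \<in> edge_sets then 1 else 0 else 0)"
      by (simp add: eval)
  qed
  also have "\<dots> = (if A \<in> edge_sets \<and> B \<in> edge_sets \<and> graph_iso (graph_of (dunion A B)) G then 1 else 0)"
    using X_iff[of A B] \<open>finite X\<close> by simp
  also have "\<dots> = split_fun (M G) (A, B)"
    using graph_iso_sym[of "graph_of (dunion A B)" G] graph_iso_sym[of G "graph_of (dunion A B)"]
    by (auto simp: split_fun_def M_eq[OF G] dunion_edge_sets)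
  finally show "M_coproduct G (A, B) = split_fun (M G :: _ \<Rightarrow> 'k) (A, B)" .
qed

section \<open>Identification of coproduct and counit\<close>

lemma M_basis_some:
  assumes "m \<in> (M_basis :: (_ \<Rightarrow> 'k::field) set)"
  shows "no_isolated (SOME G :: nat ugraph. no_isolated G \<and> M G = m)"
    and "M (SOME G :: nat ugraph. no_isolated G \<and> M G = m) = m"
proof -
  have "\<exists>G :: nat ugraph. no_isolated G \<and> M G = m" using assms by (auto simp: M_basis_def)
  from someI_ex[OF this] show "no_isolated (SOME G :: nat ugraph. no_isolated G \<and> M G = m)"
    and "M (SOME G :: nat ugraph. no_isolated G \<and> M G = m) = m" by auto
qed

lemma coproduct_eq:
  assumes "f \<in> graph_funs"
  shows "coproduct f = split_fun (f :: _ \<Rightarrow> 'k::field)"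
proof -
  interpret lin: Vector_Spaces.linear fscale fscale "coproduct :: (_ \<Rightarrow> 'k) \<Rightarrow> _"
    unfolding coproduct_def by (rule ff.linear_construct[OF independent_M_basis])
  have basis: "coproduct m = split_fun m" if "m \<in> M_basis" for m :: "_ \<Rightarrow> 'k"
    unfolding coproduct_def ff.construct_basis[OF independent_M_basis that]
    \<comment> \<open>By \<open>M_coproduct_eq\<close> the coproduct depends on the graph only
      through \<open>M G\<close>, so it does not matter which graph is selected for
      \<open>m\<close>.\<close>
    by (simp only: M_coproduct_eq[OF M_basis_some(1)[OF that]] M_basis_some(2)[OF that])
  show ?thesis
    using assms unfolding graph_funs_def M_basis_eq[symmetric]
  proof (induction rule: fs.span_induct_alt)
    case base
    have "split_fun (0 :: _ \<Rightarrow> 'k) = 0" by (rule ext) (simp add: split_fun_def case_prod_beta)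
    then show ?case by (simp only: lin.zero)
  next
    case (step c x y)
    then show ?case by (simp only: lin.add lin.scale basis split_fun_add split_fun_scale)
  qed
qed

lemma counit_eq:
  assumes "f \<in> graph_funs"
  shows "counit f = (f {} :: 'k::field)"
proof -
  interpret lin: Vector_Spaces.linear fscale "(*)" "counit :: (_ \<Rightarrow> 'k) \<Rightarrow> _"
    unfolding counit_def by (rule fk.linear_construct[OF independent_M_basis])
  have basis: "counit m = m {}" if "m \<in> M_basis" for m :: "_ \<Rightarrow> 'k"
  proof -
    define G where "G = (SOME G :: nat ugraph. no_isolated G \<and> M G = m)"
    have G: "no_isolated G" "M G = m" unfolding G_def using M_basis_some[OF that] by auto
    from graph_of_exists[OF G(1)] obtain E where E: "E \<in> edge_sets" "graph_iso G (graph_of E)" .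
    then have "one_vertex G \<longleftrightarrow> E = {}"
      using graph_iso_one_vertex[OF E(2)] one_vertex_graph_of[OF E(1)] by simp
    moreover have "m = shape_indicator E" unfolding G(2)[symmetric] by (rule M_eq_shape_indicator[OF G(1) E])
    moreover have "edge_iso E {} \<longleftrightarrow> E = {}"
      by (auto simp: edge_iso_def relabelling_def eq_commute[of "{}" "relabel _ _"])
    ultimately show ?thesis
      unfolding counit_def fk.construct_basis[OF independent_M_basis that] G_def[symmetric]
      by (simp add: shape_indicator_def)
  qed
  show ?thesis
    using assms unfolding graph_funs_def M_basis_eq[symmetric]
  proof (induction rule: fs.span_induct_alt)
    case base
    show ?case by (simp add: lin.zero del: zero_fun_apply) simp
  next
    case (step c x y)
    then show ?case by (simp only: lin.add lin.scale basis) (simp add: fscale_def)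
  qed
qed

theorem proposition3p5:
  shows "\<exists>S. hopf_algebra_on (UGQSym :: ((nat \<times> nat) set \<Rightarrow> 'k::field_char_0) set)
      amb_mult amb_one coproduct counit S \<and>
    filtered_hopf_algebra_on UGQSym amb_mult amb_one coproduct counit S edge_filtration \<and>
    filtered_hopf_algebra_on UGQSym amb_mult amb_one coproduct counit S node_filtration"
  unfolding UGQSym_eq edge_filtration_eq node_filtration_eq
  by (intro exI[of _ antipode] conjI hopf_graph_funs edge_count.filtered_hopf_graph_funs
      node_count.filtered_hopf_graph_funs coproduct_eq counit_eq)

end
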